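(* Let $G=Sp_{2n}$ and $N=2n$. Start from the seed for $\mathrm{Conf}_3\mathcal A_{Sp_{2n}}$ described in the context and perform the following mutations: for $r=1,2,\dots,n-1$ in turn, and for each such $r$ for the rows $i=n-1,n-2,\dots,r$ in turn, mutate all $x_{ij}$ with $i<j\le n$ (the order within a row being immaterial). Then each $x_{ij}$ with $1\le i<j\le n$ is mutated $i$ times in total, and the function attached to it, which is initially $[n-i,2n+i-j;n;j]$, transforms as follows: for $1\le t\le i-1$, after $t$ mutations it is $$[\,n-i+t,\ 2n+i-j-t\,;\ n,n\,;\ j-t,\ n+t\,],$$ and after $i$ mutations it is $$[\,2n-j;\ n;\ j-i,\,n+i\,]=[\,j;\ n;\ n-i,\,2n+i-j\,].$$
   Context: **Flags.** $V=\mathbb C^{N}$, $N=2n$, with symplectic form $\langle e_i,e_{2n+1-i}\rangle=(-1)^{i-1}$ ($1\le i\le n$), other pairings of basis vectors zero up to skew-symmetry. A point of $\mathcal A_{Sp_{2n}}=Sp_{2n}/U$ is given by vectors $v_1,\dots,v_n$ spanning isotropic subspaces $\langle v_1,\dots,v_i\rangle$, each $v_i$ mattering only modulo the span of the previous ones; complete to a symplectic basis $v_1,\dots,v_{2n}$ with $\langle v_i,v_{2n+1-i}\rangle=(-1)^{i-1}$ ($i\le n$), other pairings zero. This gives $\mathcal A_{Sp_{2n}}\hookrightarrow\mathcal A_{SL_{2n}}$ and $\mathrm{Conf}_3\mathcal A_{Sp_{2n}}\hookrightarrow\mathrm{Conf}_3\mathcal A_{SL_{2n}}$ ($\mathrm{Conf}_3\mathcal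 A_G=G\backslash(G/U)^3$); functions below are pulled back along this. Write $V_a=v_1\wedge\dots\wedge v_a$, $V_0=1$. **Three-flag functions.** Identify $\bigwedge^NV=\mathbb C$; $\phi_{p_1,\dots,p_r}:\bigwedge^{p_1+\dots+p_r}V\to\bigotimes_i\bigwedge^{p_i}V$ is the natural (signed shuffle) comultiplication. For three flags $A,B,C$ with forms $U_\bullet,V_\bullet,W_\bullet$: (i) if $a+b+c=N$, $[a;b;c]=U_a\wedge V_b\wedge W_c$; (ii) if $a+b+c+d=2N$ and $b\le N-c,N-d\le a$, then $[a,b;c;d]=[b,a;c;d]$ is obtained by applying $U_b\wedge-\wedge W_d$ and $U_a\wedge-$ to the two factors of $\phi_{a+c-N,N-a}(V_c)$ and multiplying; (iii) $[a;b;c,d](A,B,C)=[c,d;a;b](s_GC,A,B)$, where $s_G=-1$ acts on $\bigwedge^k V$ by $(-1)^k$; (iv) for $a,c\le n\le b,d$ with $a+b+c+d=2N$, $[a,b;n,n;c,d]$ is obtained by applying $-\wedge W_d$, $U_b\wedge-$, $U_a\wedge V_n\wedge-$ to the three factors of $\phi_{N-d,N-b,n-a}(V_n\wedge W_c)$ and multiplying. An entry $0$ or $N$ of a pair may be omitted: $[N,b;c;d]=[b;c;d]$, $[a,0;c;d]=[a;c;d]$. **Seed.** Vertices $x_{ij}$ ($0\le i\le n$, $1\le j\le n$), $y_k$ ($1\le k\le n$); frozen: all $y_k$, $x_{0j}$, $x_{nj}$. The vertices $x_{in}$ and $y_n$ are white, the others black. Solid arrows: $x_{ij}\to x_{i-1,j}$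 ($1\le i\le n$); $x_{ij}\to x_{i,j-1}$ ($1\le i\le n-1$, $j\ge2$); $x_{i1}\to y_{n-i}$ ($1\le i\le n-1$); $y_n\to x_{1n}$; $x_{ij}\to x_{i+1,j+1}$ ($0\le i\le n-1$, $j\le n-1$); $x_{0n}\to y_n$; $y_k\to x_{n-k+1,1}$ ($1\le k\le n-1$). Dotted arrows: $x_{0j}\to x_{0,j-1}$, $x_{nj}\to x_{n,j-1}$, $y_k\to y_{k+1}$. An arrow $p\to q$ means $b_{pq}>0>b_{qp}$; $|b_{pq}|=2$ if $p$ is white and $q$ is black, $|b_{pq}|=1$ otherwise; dotted arrows have half these values. Functions: $y_k$: $U_k\wedge V_{2n-k}$; $x_{0j}$: $[2n-j;0;j]$; $x_{ij}$ with $i\ge j$: $[n-i;n+i-j;j]$; $x_{ij}$ with $0<i<j$: $[n-i,2n+i-j;n;j]$. **Mutation at unfrozen $k$.** The function $A_k$ is replaced by $A_k'$ with $A_kA_k'=\prod_{b_{kj}>0}A_j^{b_{kj}}+\prod_{b_{kj}<0}A_j^{-b_{kj}}$, and $b'_{ij}=-b_{ij}$ if $k\in\{i,j\}$, $b'_{ij}=b_{ij}$ if $b_{ik}b_{kj}\le0$, $b'_{ij}=b_{ij}+|b_{ik}|b_{kj}$ otherwise. *)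

theory Defs
  imports Complex_Main
begin

section \<open>The exterior algebra of \<open>\<complex>\<^sup>N\<close>, \<open>N = 2n\<close>\<close>

text \<open>
  A vector of \<open>\<complex>\<^sup>N\<close> is a function of its coordinates \<open>1, \<dots>, N\<close> and vanishes at all other
  arguments. An element of the exterior algebra is given by its coordinates with respect to the
  basis \<open>e\<^sub>I = e\<^bsub>i\<^sub>1\<^esub> \<and> \<dots> \<and> e\<^bsub>i\<^sub>k\<^esub>\<close>, where \<open>I = {i\<^sub>1 < \<dots> < i\<^sub>k} \<subseteq> {1..N}\<close>, and an element of an
  \<open>r\<close>-fold tensor product of exterior powers by its coordinates with respect to the basis
  \<open>e\<^bsub>I\<^sub>1\<^esub> \<otimes> \<dots> \<otimes> e\<^bsub>I\<^sub>r\<^esub>\<close>, indexed by lists of index sets.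
\<close>

type_synonym vec = "nat \<Rightarrow> complex"
type_synonym form = "nat set \<Rightarrow> complex"
type_synonym tensor = "nat set list \<Rightarrow> complex"

text \<open>\<open>e\<^sub>I \<and> e\<^sub>J = shuffle_sign I J \<cdot> e\<^bsub>I \<union> J\<^esub>\<close> for disjoint \<open>I\<close>, \<open>J\<close>.\<close>

definition shuffle_sign :: "nat set \<Rightarrow> nat set \<Rightarrow> complex" where
  "shuffle_sign I J = (-1) ^ card {(i, j). i \<in> I \<and> j \<in> J \<and> j < i}"

definition wedge :: "form \<Rightarrow> form \<Rightarrow> form"  (infixl "\<and>\<^sub>e" 70) where
  "\<alpha> \<and>\<^sub>e \<beta> = (\<lambda>K. \<Sum>I\<in>Pow K. shuffle_sign I (K - I) * \<alpha> I * \<beta> (K - I))"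

definition basis_form :: "nat set \<Rightarrow> form" where
  "basis_form I = (\<lambda>K. if K = I then 1 else 0)"

definition vec_form :: "vec \<Rightarrow> form" where
  "vec_form x = (\<lambda>K. if card K = 1 then x (the_elem K) else 0)"

text \<open>The identification of the top exterior power with \<open>\<complex>\<close> sends \<open>e\<^sub>1 \<and> \<dots> \<and> e\<^sub>N\<close> to \<open>1\<close>.\<close>

definition top_coeff :: "nat \<Rightarrow> form \<Rightarrow> complex" where
  "top_coeff n \<alpha> = \<alpha> {1..2 * n}"

text \<open>\<open>e\<^bsub>I\<^sub>1\<^esub> \<and> \<dots> \<and> e\<^bsub>I\<^sub>r\<^esub> = shuffle_sign_list [I\<^sub>1, \<dots>, I\<^sub>r] \<cdot> e\<^bsub>I\<^sub>1 \<union> \<dots> \<union> I\<^sub>r\<^esub>\<close> for pairwise disjoint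
  index sets.\<close>

fun shuffle_sign_list :: "nat set list \<Rightarrow> complex" where
  "shuffle_sign_list [] = 1"
| "shuffle_sign_list (I # Is) = shuffle_sign I (\<Union> (set Is)) * shuffle_sign_list Is"

text \<open>
  The comultiplication \<open>\<phi>\<^bsub>p\<^sub>1,\<dots>,p\<^sub>r\<^esub>\<close>: it sends \<open>e\<^sub>K\<close> to the sum of
  \<open>\<plusminus> e\<^bsub>I\<^sub>1\<^esub> \<otimes> \<dots> \<otimes> e\<^bsub>I\<^sub>r\<^esub>\<close> over all ordered partitions of \<open>K\<close> into parts with
  \<open>|I\<^sub>k| = p\<^sub>k\<close>, with the sign of the corresponding shuffle.
\<close>

definition comult :: "nat list \<Rightarrow> form \<Rightarrow> tensor" where
  "comult ps \<alpha> = (\<lambda>Is.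
     if map card Is = ps \<and> sorted_wrt (\<lambda>I J. I \<inter> J = {}) Is
     then shuffle_sign_list Is * \<alpha> (\<Union> (set Is)) else 0)"

text \<open>Apply the linear functionals in the list \<open>ls\<close> to the tensor factors of \<open>T\<close> and multiply.\<close>

definition contract :: "nat \<Rightarrow> (form \<Rightarrow> complex) list \<Rightarrow> tensor \<Rightarrow> complex" where
  "contract n ls T =
     (\<Sum>Is | set Is \<subseteq> Pow {1..2 * n} \<and> length Is = length ls.
        T Is * (\<Prod>k<length ls. (ls ! k) (basis_form (Is ! k))))"


section \<open>Flags\<close>

definition symplectic_form :: "nat \<Rightarrow> vec \<Rightarrow> vec \<Rightarrow> complex" where
  "symplectic_form n x y =
     (\<Sum>i=1..n. (-1) ^ (i - 1) * (x i * y (2 * n + 1 - i) - x (2 * n + 1 - i) * y i))"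

text \<open>
  A point of \<open>\<A> = Sp\<^sub>2\<^sub>n/U\<close> is represented by any completion \<open>v\<^sub>1, \<dots>, v\<^sub>2\<^sub>n\<close> of its isotropic
  vectors \<open>v\<^sub>1, \<dots>, v\<^sub>n\<close> to a symplectic basis. Symplectic bases are the same thing as elements of
  \<open>Sp\<^sub>2\<^sub>n\<close>; linear independence follows from the pairings.
\<close>

type_synonym flag = "nat \<Rightarrow> vec"

definition symplectic_basis :: "nat \<Rightarrow> flag \<Rightarrow> bool" where
  "symplectic_basis n v \<longleftrightarrow>
     (\<forall>i a. v i a \<noteq> 0 \<longrightarrow> i \<in> {1..2 * n} \<and> a \<in> {1..2 * n}) \<and>
     (\<forall>i\<in>{1..2 * n}. \<forall>j\<in>{1..2 * n}. i < j \<longrightarrow>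
        symplectic_form n (v i) (v j) = (if i + j = 2 * n + 1 then (-1) ^ (i - 1) else 0))"

text \<open>The form \<open>V\<^sub>a = v\<^sub>1 \<and> \<dots> \<and> v\<^sub>a\<close>.\<close>

fun flag_form :: "flag \<Rightarrow> nat \<Rightarrow> form" where
  "flag_form v 0 = basis_form {}"
| "flag_form v (Suc a) = flag_form v a \<and>\<^sub>e vec_form (v (Suc a))"

text \<open>The action of \<open>s\<^sub>G = -1\<close>.\<close>

definition neg_flag :: "flag \<Rightarrow> flag" where
  "neg_flag v = (\<lambda>i a. - v i a)"

type_synonym flags = "flag \<times> flag \<times> flag"

definition flag_triples :: "nat \<Rightarrow> flags set" where
  "flag_triples n = {A. symplectic_basis n A} \<times> {B. symplectic_basis n B} \<times> {C. symplectic_basis n C}"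


section \<open>Functions of three flags\<close>

text \<open>The function \<open>[a; b; c]\<close>, for \<open>a + b + c = 2n\<close>.\<close>

definition br111 :: "nat \<Rightarrow> nat \<Rightarrow> nat \<Rightarrow> nat \<Rightarrow> flags \<Rightarrow> complex" where
  "br111 n a b c = (\<lambda>(A, B, C). top_coeff n (flag_form A a \<and>\<^sub>e flag_form B b \<and>\<^sub>e flag_form C c))"

text \<open>
  The function \<open>[a, b; c; d] = [b, a; c; d]\<close>, for \<open>a + b + c + d = 4n\<close> and
  \<open>min a b \<le> 2n - c, 2n - d \<le> max a b\<close>.
\<close>

definition br211 :: "nat \<Rightarrow> nat \<Rightarrow> nat \<Rightarrow> nat \<Rightarrow> nat \<Rightarrow> flags \<Rightarrow> complex" where
  "br211 n a b c d = (\<lambda>(A, B, C).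
     let hi = max a b; lo = min a b in
     contract n
       [\<lambda>\<xi>. top_coeff n (flag_form A lo \<and>\<^sub>e \<xi> \<and>\<^sub>e flag_form C d),
        \<lambda>\<xi>. top_coeff n (flag_form A hi \<and>\<^sub>e \<xi>)]
       (comult [hi + c - 2 * n, 2 * n - hi] (flag_form B c)))"

text \<open>The function \<open>[a; b; c, d]\<close>.\<close>

definition br112 :: "nat \<Rightarrow> nat \<Rightarrow> nat \<Rightarrow> nat \<Rightarrow> nat \<Rightarrow> flags \<Rightarrow> complex" where
  "br112 n a b c d = (\<lambda>(A, B, C). br211 n c d a b (neg_flag C, A, B))"

text \<open>The function \<open>[a, b; n, n; c, d]\<close>, for \<open>a, c \<le> n \<le> b, d\<close> and \<open>a + b + c + d = 4n\<close>.\<close>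

definition br222 :: "nat \<Rightarrow> nat \<Rightarrow> nat \<Rightarrow> nat \<Rightarrow> nat \<Rightarrow> flags \<Rightarrow> complex" where
  "br222 n a b c d = (\<lambda>(A, B, C).
     contract n
       [\<lambda>\<xi>. top_coeff n (\<xi> \<and>\<^sub>e flag_form C d),
        \<lambda>\<xi>. top_coeff n (flag_form A b \<and>\<^sub>e \<xi>),
        \<lambda>\<xi>. top_coeff n (flag_form A a \<and>\<^sub>e flag_form B n \<and>\<^sub>e \<xi>)]
       (comult [2 * n - d, 2 * n - b, n - a] (flag_form B n \<and>\<^sub>e flag_form C c)))"


section \<open>Rational functions\<close>

text \<open>
  Rational functions on \<open>Conf\<^sub>3 \<A>\<close> are represented by their pullbacks along the quotient map
  \<open>Sp\<^sub>2\<^sub>n\<^sup>3 \<rightarrow> Sp\<^sub>2\<^sub>n \ (Sp\<^sub>2\<^sub>n/U)\<^sup>3\<close>, which embeds the function field of \<open>Conf\<^sub>3 \<A>\<close> into that of the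
  irreducible variety \<open>Sp\<^sub>2\<^sub>n\<^sup>3\<close>; so they are functions of triples of symplectic bases, considered up
  to equality on a nonempty Zariski open set. On triples of symplectic bases the regular functions
  are the polynomials in the coordinates of the basis vectors, because \<open>Sp\<^sub>2\<^sub>n\<close> is closed in the space
  of matrices.
\<close>

inductive_set regular_functions :: "nat \<Rightarrow> (flags \<Rightarrow> complex) set" for n :: nat where
  const: "(\<lambda>_. c) \<in> regular_functions n"
| coord1: "(\<lambda>(A, B, C). A i a) \<in> regular_functions n"
| coord2: "(\<lambda>(A, B, C). B i a) \<in> regular_functions n"
| coord3: "(\<lambda>(A, B, C). C i a) \<in> regular_functions n"
| add: "f \<in> regular_functions n \<Longrightarrow> g \<in> regular_functions n \<Longrightarrow> (\<lambda>X. f X + g X) \<in> regular_functions n"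
| mult: "f \<in> regular_functions n \<Longrightarrow> g \<in> regular_functions n \<Longrightarrow> (\<lambda>X. f X * g X) \<in> regular_functions n"

definition generically :: "nat \<Rightarrow> (flags \<Rightarrow> bool) \<Rightarrow> bool" where
  "generically n P \<longleftrightarrow>
     (\<exists>q\<in>regular_functions n. (\<exists>X\<in>flag_triples n. q X \<noteq> 0) \<and>
        (\<forall>X\<in>flag_triples n. q X \<noteq> 0 \<longrightarrow> P X))"

text \<open>Equality in the function field.\<close>

definition rational_eq :: "nat \<Rightarrow> (flags \<Rightarrow> complex) \<Rightarrow> (flags \<Rightarrow> complex) \<Rightarrow> bool" where
  "rational_eq n f g \<longleftrightarrow> generically n (\<lambda>X. f X = g X)"


section \<open>The seed and its mutations\<close>

datatype vertex = X nat nat | Y nat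

definition vertices :: "nat \<Rightarrow> vertex set" where
  "vertices n = {X i j | i j. i \<le> n \<and> 1 \<le> j \<and> j \<le> n} \<union> {Y k | k. 1 \<le> k \<and> k \<le> n}"

definition frozen :: "nat \<Rightarrow> vertex set" where
  "frozen n = {Y k | k. 1 \<le> k \<and> k \<le> n} \<union> {X 0 j | j. 1 \<le> j \<and> j \<le> n} \<union> {X n j | j. 1 \<le> j \<and> j \<le> n}"

fun white :: "nat \<Rightarrow> vertex \<Rightarrow> bool" where
  "white n (X i j) = (j = n)"
| "white n (Y k) = (k = n)"

definition solid_arrows :: "nat \<Rightarrow> (vertex \<times> vertex) set" where
  "solid_arrows n =
     {(X i j, X (i - 1) j) | i j. 1 \<le> i \<and> i \<le> n \<and> 1 \<le> j \<and> j \<le> n}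
   \<union> {(X i j, X i (j - 1)) | i j. 1 \<le> i \<and> i \<le> n - 1 \<and> 2 \<le> j \<and> j \<le> n}
   \<union> {(X i 1, Y (n - i)) | i. 1 \<le> i \<and> i \<le> n - 1}
   \<union> {(Y n, X 1 n)}
   \<union> {(X i j, X (i + 1) (j + 1)) | i j. i \<le> n - 1 \<and> 1 \<le> j \<and> j \<le> n - 1}
   \<union> {(X 0 n, Y n)}
   \<union> {(Y k, X (n - k + 1) 1) | k. 1 \<le> k \<and> k \<le> n - 1}"

definition dotted_arrows :: "nat \<Rightarrow> (vertex \<times> vertex) set" where
  "dotted_arrows n =
     {(X 0 j, X 0 (j - 1)) | j. 2 \<le> j \<and> j \<le> n}
   \<union> {(X n j, X n (j - 1)) | j. 2 \<le> j \<and> j \<le> n}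
   \<union> {(Y k, Y (k + 1)) | k. 1 \<le> k \<and> k \<le> n - 1}"

type_synonym exchange_matrix = "vertex \<Rightarrow> vertex \<Rightarrow> rat"

definition initial_matrix :: "nat \<Rightarrow> exchange_matrix" where
  "initial_matrix n p q =
     (let w = (if white n p \<and> \<not> white n q then 2 else 1) in
      if (p, q) \<in> solid_arrows n then w
      else if (q, p) \<in> solid_arrows n then - w
      else if (p, q) \<in> dotted_arrows n then w / 2
      else if (q, p) \<in> dotted_arrows n then - w / 2
      else 0)"

fun initial_functions :: "nat \<Rightarrow> vertex \<Rightarrow> flags \<Rightarrow> complex" where
  "initial_functions n (Y k) = (\<lambda>(A, B, C). top_coeff n (flag_form A k \<and>\<^sub>e flag_form B (2 * n - k)))"
| "initial_functions n (X i j) =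
     (if i = 0 then br111 n (2 * n - j) 0 j
      else if j \<le> i then br111 n (n - i) (n + i - j) j
      else br211 n (n - i) (2 * n + i - j) n j)"

type_synonym seed = "exchange_matrix \<times> (vertex \<Rightarrow> flags \<Rightarrow> complex)"

definition initial_seed :: "nat \<Rightarrow> seed" where
  "initial_seed n = (initial_matrix n, initial_functions n)"

definition mutate_matrix :: "vertex \<Rightarrow> exchange_matrix \<Rightarrow> exchange_matrix" where
  "mutate_matrix k b i j =
     (if k = i \<or> k = j then - b i j
      else if b i k * b k j \<le> 0 then b i j
      else b i j + \<bar>b i k\<bar> * b k j)"

text \<open>
  The right-hand side of the exchange relation. For an unfrozen vertex \<open>k\<close> the entries \<open>b k j\<close> are
  integers: half-integral entries only occur between two frozen vertices.
\<close>

definition exchange_rhs :: "nat \<Rightarrow> vertex \<Rightarrow> seed \<Rightarrow> flags \<Rightarrow> complex" where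
  "exchange_rhs n k s Z =
     (\<Prod>j | j \<in> vertices n \<and> fst s k j > 0. snd s j Z ^ nat \<lfloor>fst s k j\<rfloor>) +
     (\<Prod>j | j \<in> vertices n \<and> fst s k j < 0. snd s j Z ^ nat \<lfloor>- fst s k j\<rfloor>)"

text \<open>
  The new function is the solution \<open>A'\<^sub>k\<close> of the exchange relation \<open>A\<^sub>k A'\<^sub>k = exchange_rhs\<close> in the
  function field. The pointwise quotient represents it as long as \<open>A\<^sub>k\<close> is not the zero rational
  function.
\<close>

definition mutate :: "nat \<Rightarrow> vertex \<Rightarrow> seed \<Rightarrow> seed" where
  "mutate n k s =
     (mutate_matrix k (fst s), (snd s)(k := (\<lambda>Z. exchange_rhs n k s Z / snd s k Z)))"

definition mutated_seed :: "nat \<Rightarrow> vertex list \<Rightarrow> seed" where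
  "mutated_seed n ks = fold (mutate n) ks (initial_seed n)"

abbreviation cluster_function :: "nat \<Rightarrow> vertex list \<Rightarrow> vertex \<Rightarrow> flags \<Rightarrow> complex" where
  "cluster_function n ks \<equiv> snd (mutated_seed n ks)"

text \<open>
  The pairs \<open>(r, i)\<close> in the order in which they are processed; at \<open>(r, i)\<close> the vertices
  \<open>x\<^sub>i\<^sub>j\<close> with \<open>i < j \<le> n\<close> are mutated, in the order \<open>ord r i\<close> of their second indices.
\<close>

definition row_steps :: "nat \<Rightarrow> (nat \<times> nat) list" where
  "row_steps n = [(r, i). r \<leftarrow> [1..<n], i \<leftarrow> rev [r..<n]]"

definition row_order :: "nat \<Rightarrow> (nat \<Rightarrow> nat \<Rightarrow> nat list) \<Rightarrow> bool" where
  "row_order n ord \<longleftrightarrow>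
     (\<forall>(r, i)\<in>set (row_steps n). distinct (ord r i) \<and> set (ord r i) = {i<..n})"

definition mutations :: "(nat \<Rightarrow> nat \<Rightarrow> nat list) \<Rightarrow> (nat \<times> nat) list \<Rightarrow> vertex list" where
  "mutations ord steps = concat (map (\<lambda>(r, i). map (X i) (ord r i)) steps)"

end

theory Submission
  imports Defs "Jordan_Normal_Form.Determinant" "HOL-Library.Multiset"
begin

text \<open>
  Every bracket is, up to sign, a minor of the matrix of symplectic pairings between the vectors of
  the three flags: the Hodge star of \<open>V\<^sub>b\<close> is the image of \<open>V\<^bsub>2n-b\<^esub>\<close> under the isomorphism of
  \<open>V\<close> with its dual. In this form the exchange relations are octahedron relations, that is,
  instances of the Desnanot--Jacobi identity for the functions \<open>[a, b; n, n; c, d]\<close>, once these are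
  related to the other brackets: at the ends of the range of \<open>t\<close> they are products of a bracket with
  a frozen function, on the diagonal \<open>i = j\<close> they factor, and a duality
  \<open>[a, b; n, n; c, d] = [2n - b, 2n - a; n, n; 2n - d, 2n - c]\<close> accounts for the doubled arrows at the
  white vertices. None of the functions vanishes identically, because all of them are positive at a
  triple of flags built from the totally positive matrix with entries \<open>1 / (a - r)!\<close>. The shape of the quiver during a round only
  depends on the distance of a row to the row that is mutated next.
\<close>

section \<open>The quiver\<close>

text \<open>What separates \<open>[a, b; n, n; c, d]\<close> from an ordinary Gram determinant is a
  zero block: the vectors of U_a enter only the third tensor factor and never meet the covectors
  that represent W_d in the first. The position of this block depends only on the flags of the
  labels, so changing a, b, c, d by one borders one and the same matrix, and a single determinantal
  identity serves every mutated vertex. The formula for the intermediate functions still makes sense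
  at t = 0, at t = i, on the diagonal and in column n + 1. The identity is proved by elimination,
  hence only where its core minor is nonzero, and mutation divides by the old function. Nonvanishing
  is therefore needed throughout. Positivity is computed directly for the initial functions only;
  the relations contain no subtraction and carry it to all others. One open set, where the product
  of all functions is nonzero, then serves for every equality of rational functions.\<close>

definition contribution :: "rat \<Rightarrow> rat \<Rightarrow> rat" where
  "contribution x y = (if x * y \<le> 0 then 0 else \<bar>x\<bar> * y)"

lemma contribution_zero [simp]: "contribution 0 y = 0" "contribution x 0 = 0"
  by (simp_all add: contribution_def)

lemma mutate_matrix_contribution:
  "mutate_matrix k b v w = (if k = v \<or> k = w then - b v w else b v w + contribution (b v k) (b k w))"
  by (simp add: mutate_matrix_def contribution_def)

text \<open>Mutation at one of several pairwise unconnected vertices leaves the rows and columns of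
  the others unchanged, so every contribution can be computed from the original matrix. In
  particular the result depends on the set of vertices only, not on their order.\<close>

lemma fold_mutate_matrix:
  assumes "distinct ks" "\<And>k k'. k \<in> set ks \<Longrightarrow> k' \<in> set ks \<Longrightarrow> b k k' = 0"
  shows "fold mutate_matrix ks b v w = (if v \<in> set ks \<or> w \<in> set ks then - b v w
    else b v w + (\<Sum>k\<in>set ks. contribution (b v k) (b k w)))"
  using assms
proof (induction ks arbitrary: b)
  case (Cons k ks)
  define B where "B = mutate_matrix k b"
  have B: "B x y = (if k = x \<or> k = y then - b x y else b x y + contribution (b x k) (b k y))" for x y
    unfolding B_def by (rule mutate_matrix_contribution)
  have fold: "fold mutate_matrix (k # ks) b v w = fold mutate_matrix ks B v w"
    by (simp add: B_def)
  have k: "k \<notin> set ks" "distinct ks" using Cons.prems(1) by auto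
  have z: "b l l' = 0" if "l \<in> insert k (set ks)" "l' \<in> insert k (set ks)" for l l' using Cons.prems(2) that by auto
  have b': "B l l' = 0" if "l \<in> set ks" "l' \<in> set ks" for l l'
    using z[of l l'] z[of l k] that by (simp add: B)
  have IH: "fold mutate_matrix ks B v w = (if v \<in> set ks \<or> w \<in> set ks then - B v w
    else B v w + (\<Sum>k\<in>set ks. contribution (B v k) (B k w)))"
    by (rule Cons.IH[OF k(2) b'])
  consider "v \<in> set ks" | "w \<in> set ks" "v \<notin> set ks" | "v \<notin> set ks" "w \<notin> set ks" "v = k" | "v \<notin> set ks" "w \<notin> set ks" "v \<noteq> k" "w = k"
    | "v \<notin> set ks" "w \<notin> set ks" "v \<noteq> k" "w \<noteq> k" by blast
  then have main: "(if v \<in> set ks \<or> w \<in> set ks then - B v w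
      else B v w + (\<Sum>k\<in>set ks. contribution (B v k) (B k w))) =
    (if v \<in> set (k # ks) \<or> w \<in> set (k # ks) then - b v w
      else b v w + (\<Sum>k\<in>set (k # ks). contribution (b v k) (b k w)))"
  proof cases
    case 1
    then show ?thesis using k z[of v k] z[of v w] by (auto simp: B)
  next
    case 2
    then show ?thesis using k z[of k w] by (auto simp: B)
  next
    case 3
    have "(\<Sum>l\<in>set ks. contribution (B v l) (B l w)) = 0"
      by (rule sum.neutral) (use 3 z in \<open>auto simp: B\<close>)
    then show ?thesis using 3 by (auto simp: B)
  next
    case 4
    have "(\<Sum>l\<in>set ks. contribution (B v l) (B l w)) = 0"
      by (rule sum.neutral) (use 4 z in \<open>auto simp: B\<close>)
    then show ?thesis using 4 by (auto simp: B)
  next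
    case 5
    have "(\<Sum>l\<in>set ks. contribution (B v l) (B l w)) = (\<Sum>l\<in>set ks. contribution (b v l) (b l w))"
      by (rule sum.cong[OF refl]) (use 5 z k in \<open>auto simp: B\<close>)
    then show ?thesis using 5 k by (auto simp: B)
  qed
  show ?case unfolding fold IH by (rule main)
qed simp

section \<open>Neighbours of a vertex in the course of a round\<close>

text \<open>\<open>ready_pos\<close> and \<open>ready_neg\<close> list the out- and in-neighbours of
  a vertex whose row has been mutated t times and is next in line, or is the top row. Multiplicities
  are the absolute values of the matrix entries, so the two multisets are the two monomials of the
  exchange relation.\<close>

definition ready_pos :: "nat \<Rightarrow> nat \<Rightarrow> nat \<Rightarrow> nat \<Rightarrow> vertex multiset" where
  "ready_pos n t i j = {#X (i - 1) j#} +
     (if j = i + 1 then {#X (i - t) (i - t), X (n - 1 - t) (n - 1 - t)#} else {#X (i + 1) j#})"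

definition ready_neg :: "nat \<Rightarrow> nat \<Rightarrow> nat \<Rightarrow> nat \<Rightarrow> vertex multiset" where
  "ready_neg n t i j = (if j = n
     then {#X (i - 1) (n - 1), X (i - 1) (n - 1)#} + (if t = 0 then {#X n n#} else {#}) + (if i = t + 1 then {#Y n#} else {#})
     else {#X (i - 1) (j - 1), X (i + 1) (j + 1)#})"

text \<open>The arrows of the initial quiver, except that the neighbours on the diagonal slide down
  by one with every mutation and that the arrow from \<open>Y n\<close> ends in row t + 1.\<close>

definition flat_pos :: "nat \<Rightarrow> nat \<Rightarrow> nat \<Rightarrow> nat \<Rightarrow> vertex multiset" where
  "flat_pos n t i j = (if j = n then {#X (i - 1) n, X i (n - 1), X i (n - 1)#}
     else {#X (i - 1) j, X (i + 1) (j + 1), (if j = i + 1 then X (i - t) (i - t) else X i (j - 1))#})"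

definition flat_neg :: "nat \<Rightarrow> nat \<Rightarrow> nat \<Rightarrow> nat \<Rightarrow> vertex multiset" where
  "flat_neg n t i j = (if j = n
     then {#X (i - 1) (n - 1), X (i - 1) (n - 1), X (i + 1) n#} + (if i = t + 1 then {#Y n#} else {#})
     else {#X (i - 1) (j - 1), X i (j + 1), (if j = i + 1 then X (i + 1 - t) (i + 1 - t) else X (i + 1) j)#})"

definition mcount :: "vertex multiset \<Rightarrow> vertex \<Rightarrow> rat" where
  "mcount M w = of_nat (count M w)"

definition kron :: "vertex \<Rightarrow> vertex \<Rightarrow> rat" where
  "kron v w = (if v = w then 1 else 0)"

lemma mcount_simps [simp]:
  "mcount {#} w = 0" "mcount (add_mset v M) w = kron v w + mcount M w" "mcount (M + M') w = mcount M w + mcount M' w"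
  by (auto simp: mcount_def kron_def)

lemma mcount_nonneg: "mcount M w \<ge> 0"
  by (simp add: mcount_def)

text \<open>Row s has just been mutated, so it carries the reverse of its arrows before the r-th
  mutation, whence \<open>r - 1\<close> in the first case. Any other row has been mutated
  \<open>r - 1\<close> or \<open>r\<close> times, according to whether round r has yet to reach it.
  For s = n no row of the triangle is the mutated one, which describes the start of a round.\<close>

definition arrows_at :: "nat \<Rightarrow> nat \<Rightarrow> nat \<Rightarrow> nat \<Rightarrow> nat \<Rightarrow> vertex \<Rightarrow> rat" where
  "arrows_at n r s i j w =
     (if i = s then mcount (ready_neg n (r - 1) i j) w - mcount (ready_pos n (r - 1) i j) w
      else let t = (if i < s then r - 1 else r) in
        if i + 1 = s \<or> i = n - 1 then mcount (ready_pos n t i j) w - mcount (ready_neg n t i j) w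
        else mcount (flat_pos n t i j) w - mcount (flat_neg n t i j) w)"

text \<open>The rows of the exchange matrix that still matter when, in the \<open>r\<close>-th round, the rows
  \<open>n - 1, \<dots>, s\<close> of the triangle have been mutated.\<close>

definition quiver_state :: "nat \<Rightarrow> nat \<Rightarrow> nat \<Rightarrow> exchange_matrix \<Rightarrow> bool" where
  "quiver_state n r s b \<longleftrightarrow> (\<forall>i j. r \<le> i \<and> i < j \<and> j \<le> n \<longrightarrow> (\<forall>w\<in>vertices n. b (X i j) w = arrows_at n r s i j w))"

section \<open>The arrows of the initial quiver\<close>

lemma X_in_vertices: "X i j \<in> vertices n \<longleftrightarrow> i \<le> n \<and> 1 \<le> j \<and> j \<le> n"
  by (auto simp: vertices_def)

lemma Y_in_vertices: "Y k \<in> vertices n \<longleftrightarrow> 1 \<le> k \<and> k \<le> n"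
  by (auto simp: vertices_def)

lemma solid_XX: "(X i j, X a b) \<in> solid_arrows n \<longleftrightarrow>
    (1 \<le> i \<and> i \<le> n \<and> 1 \<le> j \<and> j \<le> n \<and> a = i - 1 \<and> b = j) \<or>
    (1 \<le> i \<and> i \<le> n - 1 \<and> 2 \<le> j \<and> j \<le> n \<and> a = i \<and> b = j - 1) \<or>
    (i \<le> n - 1 \<and> 1 \<le> j \<and> j \<le> n - 1 \<and> a = i + 1 \<and> b = j + 1)"
  unfolding solid_arrows_def by auto

lemma solid_XY: "(X i j, Y k) \<in> solid_arrows n \<longleftrightarrow>
    (j = 1 \<and> 1 \<le> i \<and> i \<le> n - 1 \<and> k = n - i) \<or> (i = 0 \<and> j = n \<and> k = n)"
  unfolding solid_arrows_def by auto

lemma solid_YX: "(Y k, X i j) \<in> solid_arrows n \<longleftrightarrow>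
    (k = n \<and> i = 1 \<and> j = n) \<or> (1 \<le> k \<and> k \<le> n - 1 \<and> i = n - k + 1 \<and> j = 1)"
  unfolding solid_arrows_def by auto

lemma not_dotted: "1 \<le> i \<Longrightarrow> i < n \<Longrightarrow> (X i j, w) \<notin> dotted_arrows n \<and> (w, X i j) \<notin> dotted_arrows n"
  unfolding dotted_arrows_def by auto

lemma quiver_state_initial: "quiver_state n 1 n (initial_matrix n)"
  unfolding quiver_state_def
proof (intro allI impI ballI)
  fix i j w assume ij: "1 \<le> i \<and> i < j \<and> j \<le> n" and w: "w \<in> vertices n"
  have nd: "(X i j, w) \<notin> dotted_arrows n" "(w, X i j) \<notin> dotted_arrows n" using not_dotted[of i n] ij by auto
  obtain i' where i: "i = Suc i'" using ij by (cases i) auto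
  obtain j' where j: "j = Suc j'" using ij by (cases j) auto
  have n: "i' < j'" "j' < n" using ij i j by auto
  have s1: "(X i j, w) \<in> solid_arrows n \<longleftrightarrow> w = X i' j \<or> w = X i j' \<or> (w = X (Suc i) (Suc j) \<and> j < n)"
    using n w by (cases w) (auto simp: i j solid_XX solid_XY)
  have s2: "(w, X i j) \<in> solid_arrows n \<longleftrightarrow> w = X (Suc i) j \<or> (w = X i (Suc j) \<and> j < n) \<or> w = X i' j' \<or> (w = Y n \<and> i' = 0 \<and> j = n)"
    using n w by (cases w) (auto simp: i j solid_XX solid_YX X_in_vertices Y_in_vertices)
  \<comment> \<open>\<open>W\<close> contains every possible neighbour of the vertex; outside it
    both sides vanish.\<close>
  define W where "W = {X i' j, X i j', X (Suc i) (Suc j), X (Suc i) j, X i (Suc j), X i' j', Y n}"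
  have init: "initial_matrix n (X i j) w = (let c = (if j = n \<and> \<not> white n w then 2 else 1) in
     if w = X i' j \<or> w = X i j' \<or> (w = X (Suc i) (Suc j) \<and> j < n) then c
     else if w = X (Suc i) j \<or> (w = X i (Suc j) \<and> j < n) \<or> w = X i' j' \<or> (w = Y n \<and> i' = 0 \<and> j = n) then - c else 0)"
    unfolding initial_matrix_def s1 s2 using nd by (simp add: Let_def)
  have bounds: "w = X (Suc i) (Suc j) \<Longrightarrow> j < n" "w = X i (Suc j) \<Longrightarrow> j < n"
    using w by (auto simp: X_in_vertices)
  \<comment> \<open>A white or a black vertex, next to the diagonal or away from it. Only the first
    case concerns the top row, where the ready shape applies.\<close>
  consider "j = n" "i = n - 1" | "j = n" "i < n - 1" | "j < n" "j' = i" | "j < n" "j' > i" using n i j by linarith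
  then show "initial_matrix n (X i j) w = arrows_at n 1 n i j w"
  proof cases
    case 1
    then have e: "n = Suc (Suc i')" "j' = Suc i'" and f: "True" using n i j by auto
    have arr: "arrows_at n 1 n i j w = kron (X i' j) w + 2 * kron (X i j') w - 2 * kron (X i' j') w - kron (X (Suc i) j) w - (if i' = 0 then kron (Y n) w else 0)"
      using 1 i j by (auto simp: arrows_at_def ready_pos_def ready_neg_def)
    show ?thesis
    proof (cases "w \<in> W")
      case True
      then show ?thesis
        unfolding W_def init arr unfolding i j e by (elim insertE emptyE) (use f in \<open>simp_all add: kron_def\<close>)
    next
      case False
      then have "X i' j \<noteq> w" "X i j' \<noteq> w" "X (Suc i) (Suc j) \<noteq> w" "X (Suc i) j \<noteq> w" "X i (Suc j) \<noteq> w" "X i' j' \<noteq> w" "Y n \<noteq> w"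
        unfolding W_def by blast+
      note ne = this this[symmetric]
      show ?thesis unfolding init arr by (simp add: kron_def ne)
    qed
  next
    case 2
    then have e: "n = Suc j'" and f: "Suc i' < j'" using n i j by auto
    have arr: "arrows_at n 1 n i j w = kron (X i' j) w + 2 * kron (X i j') w - 2 * kron (X i' j') w - kron (X (Suc i) j) w - (if i' = 0 then kron (Y n) w else 0)"
      using 2 i j by (auto simp: arrows_at_def flat_pos_def flat_neg_def)
    show ?thesis
    proof (cases "w \<in> W")
      case True
      then show ?thesis
        unfolding W_def init arr unfolding i j e by (elim insertE emptyE) (use f in \<open>simp_all add: kron_def\<close>)
    next
      case False
      then have "X i' j \<noteq> w" "X i j' \<noteq> w" "X (Suc i) (Suc j) \<noteq> w" "X (Suc i) j \<noteq> w" "X i (Suc j) \<noteq> w" "X i' j' \<noteq> w" "Y n \<noteq> w"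
        unfolding W_def by blast+
      note ne = this this[symmetric]
      show ?thesis unfolding init arr by (simp add: kron_def ne)
    qed
  next
    case 3
    then have e: "j' = Suc i'" and f: "Suc (Suc i') < n" using n i j by auto
    have arr: "arrows_at n 1 n i j w = kron (X i' j) w + kron (X i j') w + kron (X (Suc i) (Suc j)) w - kron (X i' j') w - kron (X (Suc i) j) w - kron (X i (Suc j)) w"
      using 3 i j by (auto simp: arrows_at_def flat_pos_def flat_neg_def)
    show ?thesis
    proof (cases "w \<in> W")
      case True
      then show ?thesis
        unfolding W_def init arr unfolding i j e by (elim insertE emptyE) (use f in \<open>simp_all add: kron_def\<close>)
    next
      case False
      then have "X i' j \<noteq> w" "X i j' \<noteq> w" "X (Suc i) (Suc j) \<noteq> w" "X (Suc i) j \<noteq> w" "X i (Suc j) \<noteq> w" "X i' j' \<noteq> w" "Y n \<noteq> w"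
        unfolding W_def by blast+
      note ne = this this[symmetric]
      show ?thesis unfolding init arr by (simp add: kron_def ne)
    qed
  next
    case 4
    then have e: "i = Suc i'" and f: "Suc i' < j'" "Suc j' < n" using n i j by auto
    have arr: "arrows_at n 1 n i j w = kron (X i' j) w + kron (X i j') w + kron (X (Suc i) (Suc j)) w - kron (X i' j') w - kron (X (Suc i) j) w - kron (X i (Suc j)) w"
      using 4 i j by (auto simp: arrows_at_def flat_pos_def flat_neg_def)
    show ?thesis
    proof (cases "w \<in> W")
      case True
      then show ?thesis
        unfolding W_def init arr unfolding i j e by (elim insertE emptyE) (use f in \<open>simp_all add: kron_def\<close>)
    next
      case False
      then have "X i' j \<noteq> w" "X i j' \<noteq> w" "X (Suc i) (Suc j) \<noteq> w" "X (Suc i) j \<noteq> w" "X i (Suc j) \<noteq> w" "X i' j' \<noteq> w" "Y n \<noteq> w"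
        unfolding W_def by blast+
      note ne = this this[symmetric]
      show ?thesis unfolding init arr by (simp add: kron_def ne)
    qed
  qed
qed

text \<open>Row r is not mutated any more and is dropped. About the rows above it both states say
  the same: each has been mutated r times, row \<open>n - 1\<close> is ready and the others are
  flat.\<close>

lemma quiver_state_next_round: "quiver_state n r r b \<Longrightarrow> quiver_state n (Suc r) n b"
  unfolding quiver_state_def
proof (intro allI impI ballI)
  fix i j w assume q: "\<forall>i j. r \<le> i \<and> i < j \<and> j \<le> n \<longrightarrow> (\<forall>w\<in>vertices n. b (X i j) w = arrows_at n r r i j w)"
    and ij: "Suc r \<le> i \<and> i < j \<and> j \<le> n" and w: "w \<in> vertices n"
  then have "b (X i j) w = arrows_at n r r i j w" by auto
  also have "\<dots> = arrows_at n (Suc r) n i j w" using ij by (auto simp: arrows_at_def Let_def)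
  finally show "b (X i j) w = arrows_at n (Suc r) n i j w" .
qed

section \<open>Mutation of one row\<close>

text \<open>The positions of the two kinds of neighbours differ: the diagonal out-neighbours have
  index below n, whereas \<open>X n n\<close> is the only diagonal vertex among the in-neighbours.
  Hence nothing cancels when the matrix entries are written as differences of
  multiplicities.\<close>

lemma ready_disjoint:
  assumes "t < i" "i < j" "j \<le> n"
  shows "count (ready_pos n t i j) w = 0 \<or> count (ready_neg n t i j) w = 0"
proof (rule ccontr)
  assume "\<not> ?thesis"
  then have P: "w \<in># ready_pos n t i j" and Q: "w \<in># ready_neg n t i j" by simp_all
  show False
  proof (cases w)
    case (X a b)
    from P have "w = X (i - 1) j \<or> (j = i + 1 \<and> (w = X (i - t) (i - t) \<or> w = X (n - 1 - t) (n - 1 - t))) \<or> (j \<noteq> i + 1 \<and> w = X (i + 1) j)"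
      by (auto simp: ready_pos_def split: if_splits)
    moreover have "i - t < n" "n - 1 - t < n" using assms by auto
    ultimately have "(a = i - 1 \<and> b = j) \<or> (j = i + 1 \<and> a = b \<and> a < n) \<or> (j \<noteq> i + 1 \<and> a = i + 1 \<and> b = j)"
      unfolding X vertex.inject by metis
    moreover from Q have "(j = n \<and> (w = X (i - 1) (n - 1) \<or> w = X n n \<or> w = Y n)) \<or> (j \<noteq> n \<and> (w = X (i - 1) (j - 1) \<or> w = X (i + 1) (j + 1)))"
      by (auto simp: ready_neg_def split: if_splits)
    then have "(j = n \<and> a = i - 1 \<and> b = n - 1) \<or> (j = n \<and> a = n \<and> b = n) \<or> (j \<noteq> n \<and> a = i - 1 \<and> b = j - 1) \<or> (j \<noteq> n \<and> a = i + 1 \<and> b = j + 1)"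
      unfolding X by auto
    ultimately show False using assms by - (elim disjE conjE; linarith)
  next
    case (Y k)
    from P show False unfolding Y ready_pos_def by (auto split: if_splits)
  qed
qed

lemma contribution_pos: "a \<ge> 0 \<Longrightarrow> p \<ge> 0 \<Longrightarrow> q \<ge> 0 \<Longrightarrow> p = 0 \<or> q = 0 \<Longrightarrow> contribution a (p - q) = a * p"
  by (auto simp: contribution_def mult_le_0_iff zero_le_mult_iff)

lemma contribution_neg: "p \<ge> 0 \<Longrightarrow> q \<ge> 0 \<Longrightarrow> p = 0 \<or> q = 0 \<Longrightarrow> contribution (-1) (p - q) = - q"
  by (auto simp: contribution_def mult_le_0_iff zero_le_mult_iff)

text \<open>A vertex outside the mutated row has at most one out-neighbour \<open>j1\<close> and one
  in-neighbour \<open>j2\<close> in that row. Paths of length two through the row therefore lead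
  only to the out-neighbours of \<open>j1\<close>, with weight \<alpha>, or come only from the
  in-neighbours of \<open>j2\<close>.\<close>

lemma sum_contribution:
  assumes "finite J" "j1 \<noteq> j2" "\<alpha> \<ge> 0"
    and x: "\<And>j. j \<in> J \<Longrightarrow> x j = (if j = j1 then \<alpha> else 0) - (if j = j2 then 1 else 0)"
    and y: "\<And>j. j \<in> J \<Longrightarrow> y j = P j - Q j"
    and PQ: "\<And>j. j \<in> J \<Longrightarrow> P j \<ge> 0 \<and> Q j \<ge> 0 \<and> (P j = 0 \<or> Q j = 0)"
  shows "(\<Sum>j\<in>J. contribution (x j) (y j)) = (if j1 \<in> J then \<alpha> * P j1 else 0) - (if j2 \<in> J then Q j2 else 0)"
proof -
  have "(\<Sum>j\<in>J. contribution (x j) (y j)) = (\<Sum>j\<in>J. (if j = j1 then \<alpha> * P j else 0) - (if j = j2 then Q j else 0))"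
  proof (rule sum.cong[OF refl])
    fix j assume j: "j \<in> J"
    show "contribution (x j) (y j) = (if j = j1 then \<alpha> * P j else 0) - (if j = j2 then Q j else 0)"
      unfolding x[OF j] y[OF j] using PQ[OF j] assms(2,3) contribution_pos[of \<alpha> "P j" "Q j"] contribution_neg[of "P j" "Q j"] by auto
  qed
  then show ?thesis using assms(1) by (simp add: sum_subtractf)
qed

lemma kron_row: "a \<noteq> c \<Longrightarrow> kron (X a b) (X c d) = 0"
  by (simp add: kron_def)

lemma kron_col: "kron (X a b) (X a d) = (if b = d then 1 else 0)"
  by (simp add: kron_def)

lemma kron_diag: "c \<noteq> d \<Longrightarrow> kron (X a a) (X c d) = 0"
  by (auto simp: kron_def)

lemma kron_Y: "kron (Y k) (X c d) = 0"
  by (simp add: kron_def)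

lemmas kron_XX = kron_row kron_col kron_diag kron_Y

lemma ready_same_row:
  assumes "Suc h < l'" "Suc h < n"
  shows "mcount (ready_pos n t (Suc h) l) (X (Suc h) l') = 0" "mcount (ready_neg n t (Suc h) l) (X (Suc h) l') = 0"
  using assms by (simp_all add: ready_pos_def ready_neg_def kron_XX)

lemma mcount_far_row:
  assumes "i - 1 \<noteq> c" "i \<noteq> c" "Suc i \<noteq> c" "n \<noteq> c" "c \<noteq> d"
  shows "mcount (ready_pos n t i j) (X c d) = 0" "mcount (ready_neg n t i j) (X c d) = 0"
    "mcount (flat_pos n t i j) (X c d) = 0" "mcount (flat_neg n t i j) (X c d) = 0"
proof -
  have k: "kron (X (i - 1) b) (X c d) = 0" "kron (X i b) (X c d) = 0" "kron (X (i + 1) b) (X c d) = 0"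
    "kron (X n b) (X c d) = 0" "kron (X a a) (X c d) = 0" "kron (Y a) (X c d) = 0" for a b
    using assms by (auto simp: kron_def)
  show "mcount (ready_pos n t i j) (X c d) = 0" "mcount (ready_neg n t i j) (X c d) = 0"
    "mcount (flat_pos n t i j) (X c d) = 0" "mcount (flat_neg n t i j) (X c d) = 0"
    unfolding ready_pos_def ready_neg_def flat_pos_def flat_neg_def if_distrib[of mcount] by (simp_all only: k mcount_simps split: if_split) simp_all
qed

text \<open>The mutated row is reversed, row \<open>h\<close> turns from flat to ready, and row
  \<open>Suc (Suc h)\<close> turns from reversed to flat, or to ready if it is the top row. Rows
  further away do not see the mutation. White vertices are treated apart because their arrows are
  doubled.\<close>

lemma quiver_state_step:
  assumes q: "quiver_state n (Suc t) (Suc (Suc h)) b" and ri: "t \<le> h" "Suc h < n"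
    and js: "distinct js" "set js = {Suc h<..n}"
  shows "quiver_state n (Suc t) (Suc h) (fold mutate_matrix (map (X (Suc h)) js) b)"
  unfolding quiver_state_def
proof (intro allI impI ballI)
  fix p j w assume pj: "Suc t \<le> p \<and> p < j \<and> j \<le> n" and w: "w \<in> vertices n"
  let ?i = "Suc h"
  define P where "P = (\<lambda>l. mcount (ready_pos n t ?i l) w)"
  define Q where "Q = (\<lambda>l. mcount (ready_neg n t ?i l) w)"
  let ?J = "{?i<..n}"
  let ?S = "X ?i ` ?J"
  have b: "b (X p' j') w' = arrows_at n (Suc t) (Suc ?i) p' j' w'" if "Suc t \<le> p'" "p' < j'" "j' \<le> n" "w' \<in> vertices n" for p' j' w'
    using q that unfolding quiver_state_def by blast
  have SV: "X ?i l \<in> vertices n" if "l \<in> ?J" for l using that ri by (simp add: X_in_vertices)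
  have bi: "b (X ?i l) w' = mcount (ready_pos n t ?i l) w' - mcount (ready_neg n t ?i l) w'" if "l \<in> ?J" "w' \<in> vertices n" for l w'
  proof -
    have "b (X ?i l) w' = arrows_at n (Suc t) (Suc ?i) ?i l w'" by (rule b) (use that ri in auto)
    then show ?thesis by (simp add: arrows_at_def Let_def)
  qed
  \<comment> \<open>A ready row has no arrows within itself, so its vertices can be mutated
    simultaneously.\<close>
  have zero: "b (X ?i l) (X ?i l') = 0" if "l \<in> ?J" "l' \<in> ?J" for l l'
  proof -
    have "Suc h < l'" using that by simp
    then show ?thesis unfolding bi[OF that(1) SV[OF that(2)]] using ready_same_row[of h l' n t l] ri by simp
  qed
  have fold: "fold mutate_matrix (map (X ?i) js) b (X p j) w = (if X p j \<in> ?S \<or> w \<in> ?S then - b (X p j) w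
      else b (X p j) w + (\<Sum>l\<in>?J. contribution (b (X p j) (X ?i l)) (b (X ?i l) w)))"
  proof -
    have S: "set (map (X ?i) js) = ?S" using js(2) by simp
    have d: "distinct (map (X ?i) js)" using js(1) by (simp add: distinct_map inj_on_def)
    have z: "b k k' = 0" if "k \<in> set (map (X ?i) js)" "k' \<in> set (map (X ?i) js)" for k k'
      using that zero unfolding S by blast
    have "(\<Sum>k\<in>?S. contribution (b (X p j) k) (b k w)) = (\<Sum>l\<in>?J. contribution (b (X p j) (X ?i l)) (b (X ?i l) w))"
      by (rule sum.reindex_cong[of "X ?i"]) (simp_all add: inj_on_def)
    then show ?thesis using fold_mutate_matrix[of "map (X ?i) js" b "X p j" w, OF d z] unfolding S by simp
  qed
  have bp: "b (X p j) w = arrows_at n (Suc t) (Suc ?i) p j w" by (rule b) (use pj w in simp_all)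
  have bpl: "b (X p j) (X ?i l) = arrows_at n (Suc t) (Suc ?i) p j (X ?i l)" if "l \<in> ?J" for l
    by (rule b) (use pj SV[OF that] in simp_all)
  have PQ: "P l \<ge> 0 \<and> Q l \<ge> 0 \<and> (P l = 0 \<or> Q l = 0)" if "l \<in> ?J" for l
    using ready_disjoint[of t ?i l n w] that ri mcount_nonneg unfolding P_def Q_def mcount_def by simp
  have sumc: "(\<Sum>l\<in>?J. contribution (b (X p j) (X ?i l)) (b (X ?i l) w)) =
      (if j1 \<in> ?J then \<alpha> * P j1 else 0) - (if j2 \<in> ?J then Q j2 else 0)"
    if "j1 \<noteq> j2" "\<alpha> \<ge> 0" "\<And>l. l \<in> ?J \<Longrightarrow> arrows_at n (Suc t) (Suc ?i) p j (X ?i l) = (if l = j1 then \<alpha> else 0) - (if l = j2 then 1 else 0)" for j1 j2 \<alpha>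
  proof (rule sum_contribution[OF _ that(1,2)])
    show "b (X p j) (X ?i l) = (if l = j1 then \<alpha> else 0) - (if l = j2 then 1 else 0)" if "l \<in> ?J" for l
      unfolding bpl[OF that] by (rule \<open>\<And>l. l \<in> ?J \<Longrightarrow> arrows_at n (Suc t) (Suc ?i) p j (X ?i l) = (if l = j1 then \<alpha> else 0) - (if l = j2 then 1 else 0)\<close>[OF that])
    show "b (X ?i l) w = P l - Q l" if "l \<in> ?J" for l
      unfolding bi[OF that w] P_def Q_def ..
  qed (use PQ in auto)
  have K: "kron (X ?i l) w = 0" if "w \<notin> ?S" "?i < l" "l \<le> n" for l
    using that by (auto simp: kron_def)
  have hn: "h \<noteq> n - 1" "h \<noteq> n - Suc 0" using ri by auto
  consider "p = ?i" | "p + 1 < ?i \<or> ?i + 1 < p" | "p = h" "j = n" | "p = h" "j < n" | "p = Suc ?i" "j = n" | "p = Suc ?i" "j < n"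
    using pj by linarith
  then show "fold mutate_matrix (map (X ?i) js) b (X p j) w = arrows_at n (Suc t) ?i p j w"
  proof cases
    case 1
    then have "X p j \<in> ?S" using pj by simp
    then show ?thesis unfolding fold bp using 1 by (simp add: arrows_at_def Let_def)
  next
    case 2
    have a: "arrows_at n (Suc t) (Suc ?i) p j (X ?i l) = 0" if "l \<in> ?J" for l
    proof -
      have "p - 1 \<noteq> ?i" "p \<noteq> ?i" "Suc p \<noteq> ?i" "n \<noteq> ?i" "?i \<noteq> l" using 2 that ri pj by auto
      note z = mcount_far_row[OF this]
      show ?thesis unfolding arrows_at_def Let_def z by simp
    qed
    have e: "arrows_at n (Suc t) (Suc ?i) p j w = arrows_at n (Suc t) ?i p j w"
    proof -
      have "(p = Suc ?i) = False" "(p = ?i) = False" "(p < Suc ?i) = (p < ?i)" "(p + 1 = Suc ?i) = False" "(p + 1 = ?i) = False"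
        using 2 by auto
      then show ?thesis by (simp only: arrows_at_def if_False)
    qed
    have "(\<Sum>l\<in>?J. contribution (b (X p j) (X ?i l)) (b (X ?i l) w)) = 0"
      by (rule sum.neutral) (simp add: bpl a)
    moreover have "arrows_at n (Suc t) (Suc ?i) p j w = 0" if "w \<in> ?S" using that a by blast
    moreover have "X p j \<notin> ?S" using 2 by auto
    ultimately show ?thesis unfolding fold bp e[symmetric] by simp
  next
    case 3
    have ar: "arrows_at n (Suc t) (Suc ?i) p j w' = mcount (flat_pos n t h n) w' - mcount (flat_neg n t h n) w'"
      "arrows_at n (Suc t) ?i p j w' = mcount (ready_pos n t h n) w' - mcount (ready_neg n t h n) w'" for w'
      using 3 ri hn by (simp_all add: arrows_at_def Let_def)
    have pS: "X p j \<notin> ?S" using 3 by auto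
    show ?thesis
    proof (cases "w \<in> ?S")
      case True
      then obtain l where l: "w = X ?i l" "?i < l" "l \<le> n" by auto
      have "h - 1 \<noteq> Suc h" by simp
      then show ?thesis unfolding fold bp ar using True ri l(2,3) unfolding l(1)
        by (simp add: flat_pos_def flat_neg_def ready_pos_def ready_neg_def kron_XX)
    next
      case False
      \<comment> \<open>A white vertex of row \<open>h\<close> has no outgoing arrow into the
        mutated row; the column \<open>n + 1\<close>, which lies outside the row, stands in for the
        missing \<open>j1\<close>.\<close>
      have "(\<Sum>l\<in>?J. contribution (b (X p j) (X ?i l)) (b (X ?i l) w)) =
          (if n + 1 \<in> ?J then 0 * P (n + 1) else 0) - (if n \<in> ?J then Q n else 0)"
      proof (rule sumc)
        fix l assume "l \<in> ?J"
        moreover have "h - 1 \<noteq> Suc h" by simp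
        ultimately show "arrows_at n (Suc t) (Suc ?i) p j (X ?i l) = (if l = n + 1 then 0 else 0) - (if l = n then 1 else 0)"
          unfolding ar by (simp add: flat_pos_def flat_neg_def kron_XX)
      qed simp_all
      then have "fold mutate_matrix (map (X ?i) js) b (X p j) w = mcount (flat_pos n t h n) w - mcount (flat_neg n t h n) w - Q n"
        unfolding fold bp ar using False pS ri by simp
      then show ?thesis unfolding ar using K[OF False] ri pj 3
        by (simp add: Q_def flat_pos_def flat_neg_def ready_pos_def ready_neg_def)
    qed
  next
    case 4
    have ar: "arrows_at n (Suc t) (Suc ?i) p j w' = mcount (flat_pos n t h j) w' - mcount (flat_neg n t h j) w'"
      "arrows_at n (Suc t) ?i p j w' = mcount (ready_pos n t h j) w' - mcount (ready_neg n t h j) w'" for w'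
      using 4 ri hn by (simp_all add: arrows_at_def Let_def)
    have pS: "X p j \<notin> ?S" using 4 by auto
    have hj: "h < j" "j \<noteq> n" "j < n" using 4 pj by auto
    show ?thesis
    proof (cases "w \<in> ?S")
      case True
      then obtain l where l: "w = X ?i l" "?i < l" "l \<le> n" by auto
      have "h - 1 \<noteq> Suc h" "l \<noteq> Suc h" using l by simp_all
      then show ?thesis unfolding fold bp ar using True ri hj l(2,3) unfolding l(1)
        by (cases "j = Suc h") (simp_all add: flat_pos_def flat_neg_def ready_pos_def ready_neg_def kron_XX)
    next
      case False
      have "(\<Sum>l\<in>?J. contribution (b (X p j) (X ?i l)) (b (X ?i l) w)) =
          (if j + 1 \<in> ?J then 1 * P (j + 1) else 0) - (if j \<in> ?J then Q j else 0)"
      proof (rule sumc)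
        fix l assume "l \<in> ?J"
        moreover have "h - 1 \<noteq> Suc h" by simp
        ultimately show "arrows_at n (Suc t) (Suc ?i) p j (X ?i l) = (if l = j + 1 then 1 else 0) - (if l = j then 1 else 0)"
          unfolding ar using hj by (cases "j = Suc h") (simp_all add: flat_pos_def flat_neg_def kron_XX)
      qed simp_all
      then have "fold mutate_matrix (map (X ?i) js) b (X p j) w = mcount (flat_pos n t h j) w - mcount (flat_neg n t h j) w
          + P (j + 1) - (if j = Suc h then 0 else Q j)"
        unfolding fold bp ar using False pS ri hj by simp
      then show ?thesis unfolding ar using K[OF False] ri hj
        by (cases "j = Suc h") (simp_all add: P_def Q_def flat_pos_def flat_neg_def ready_pos_def ready_neg_def)
    qed
  next
    case 5
    have ar: "arrows_at n (Suc t) (Suc ?i) p j w' = mcount (ready_neg n t (Suc ?i) n) w' - mcount (ready_pos n t (Suc ?i) n) w'"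
      "arrows_at n (Suc t) ?i p j w' = (if n = Suc (Suc ?i) then mcount (ready_pos n (Suc t) (Suc ?i) n) w' - mcount (ready_neg n (Suc t) (Suc ?i) n) w'
         else mcount (flat_pos n (Suc t) (Suc ?i) n) w' - mcount (flat_neg n (Suc t) (Suc ?i) n) w')" for w'
      using 5 pj by (auto simp: arrows_at_def Let_def)
    have pS: "X p j \<notin> ?S" using 5 by auto
    have pn: "Suc ?i < n" "?i < n - 1" using 5 pj by auto
    show ?thesis
    proof (cases "w \<in> ?S")
      case True
      then obtain l where l: "w = X ?i l" "?i < l" "l \<le> n" by auto
      then have "l \<noteq> Suc h" "n \<noteq> Suc h" using ri by simp_all
      then show ?thesis unfolding fold bp ar using True ri pn l(2,3) unfolding l(1)
        by (cases "n = Suc (Suc ?i)") (simp_all add: flat_pos_def flat_neg_def ready_pos_def ready_neg_def kron_XX)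
    next
      case False
      \<comment> \<open>The doubled arrow from the white vertex to its black neighbour in column
        \<open>n - 1\<close> gives the paths through that neighbour weight 2.\<close>
      have "(\<Sum>l\<in>?J. contribution (b (X p j) (X ?i l)) (b (X ?i l) w)) =
          (if n - 1 \<in> ?J then 2 * P (n - 1) else 0) - (if n \<in> ?J then Q n else 0)"
      proof (rule sumc)
        fix l assume "l \<in> ?J"
        moreover have "n \<noteq> Suc h" using ri by simp
        ultimately show "arrows_at n (Suc t) (Suc ?i) p j (X ?i l) = (if l = n - 1 then 2 else 0) - (if l = n then 1 else 0)"
          unfolding ar using pn by (cases "n = Suc (Suc ?i)") (auto simp: ready_pos_def ready_neg_def kron_XX)
      qed (use pn in simp_all)
      then have fo: "fold mutate_matrix (map (X ?i) js) b (X p j) w = mcount (ready_neg n t (Suc ?i) n) w - mcount (ready_pos n t (Suc ?i) n) w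
          + 2 * P (n - 1) - Q n"
        unfolding fold bp ar using False pS pn by simp
      show ?thesis
      proof (cases "n = Suc (Suc ?i)")
        \<comment> \<open>Here row \<open>Suc (Suc h)\<close> is the top row. Its only vertex in the
          triangle is white and next to the diagonal, and it becomes ready at once.\<close>
        case nn: True
        have k: "kron (X (Suc h) (Suc (Suc (Suc h)))) w = 0" "kron (X (Suc h) (Suc (Suc h))) w = 0"
          using K[OF False, of n] K[OF False, of "Suc ?i"] unfolding nn by simp_all
        show ?thesis unfolding fo ar P_def Q_def ready_pos_def ready_neg_def
          unfolding nn using ri(1) by (simp add: k)
      next
        case nn: False
        then have "n - 1 \<noteq> Suc ?i" "n - 1 \<noteq> n" using pn by auto
        then show ?thesis unfolding fo ar using K[OF False] ri pn nn
          by (simp add: P_def Q_def flat_pos_def flat_neg_def ready_pos_def ready_neg_def)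
      qed
    qed
  next
    case 6
    obtain j0 where j0: "j = Suc j0" using pj by (cases j) auto
    have pn: "Suc ?i < n" "n \<noteq> Suc (Suc ?i)" "Suc ?i \<le> j0" "Suc j0 < n" "j0 \<noteq> n" "Suc j0 \<noteq> n" using 6 pj j0 by auto
    have ar: "arrows_at n (Suc t) (Suc ?i) p j w' = mcount (ready_neg n t (Suc ?i) j) w' - mcount (ready_pos n t (Suc ?i) j) w'"
      "arrows_at n (Suc t) ?i p j w' = mcount (flat_pos n (Suc t) (Suc ?i) j) w' - mcount (flat_neg n (Suc t) (Suc ?i) j) w'" for w'
      using 6 pn by (auto simp: arrows_at_def Let_def)
    have pS: "X p j \<notin> ?S" using 6 by auto
    show ?thesis
    proof (cases "w \<in> ?S")
      case True
      then obtain l where l: "w = X ?i l" "?i < l" "l \<le> n" by auto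
      then have "l \<noteq> Suc h" by simp
      then show ?thesis unfolding fold bp ar unfolding j0 using True ri pn l(2,3) unfolding l(1)
        by (cases "j0 = Suc ?i") (simp_all add: flat_pos_def flat_neg_def ready_pos_def ready_neg_def kron_XX)
    next
      case False
      have "(\<Sum>l\<in>?J. contribution (b (X p j) (X ?i l)) (b (X ?i l) w)) =
          (if j0 \<in> ?J then 1 * P j0 else 0) - (if Suc j0 \<in> ?J then Q (Suc j0) else 0)"
      proof (rule sumc)
        fix l assume "l \<in> ?J"
        then show "arrows_at n (Suc t) (Suc ?i) p j (X ?i l) = (if l = j0 then 1 else 0) - (if l = Suc j0 then 1 else 0)"
          unfolding ar unfolding j0 using pn by (cases "j0 = Suc ?i") (auto simp: ready_pos_def ready_neg_def kron_XX)
      qed simp_all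
      then have fo: "fold mutate_matrix (map (X ?i) js) b (X p j) w = mcount (ready_neg n t (Suc ?i) j) w - mcount (ready_pos n t (Suc ?i) j) w
          + P j0 - Q (Suc j0)"
        unfolding fold bp ar using False pS pn by simp
      show ?thesis unfolding fo ar unfolding j0 using K[OF False] ri pn
        by (cases "j0 = Suc ?i") (simp_all add: P_def Q_def flat_pos_def flat_neg_def ready_pos_def ready_neg_def)
    qed
  qed
qed

text \<open>As no vertex lies in both multisets, a matrix entry is plus or minus a multiplicity. The
  sign conditions then select exactly the two supports, and rounding the exponents loses
  nothing.\<close>

lemma exchange_rhs_multiset:
  assumes b: "\<And>w. w \<in> vertices n \<Longrightarrow> fst s k w = mcount P w - mcount Q w"
    and disj: "\<And>w. count P w = 0 \<or> count Q w = 0"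
    and sub: "set_mset P \<subseteq> vertices n" "set_mset Q \<subseteq> vertices n"
  shows "exchange_rhs n k s Z = (\<Prod>v\<in>#P. snd s v Z) + (\<Prod>v\<in>#Q. snd s v Z)"
proof -
  have P: "{j. j \<in> vertices n \<and> fst s k j > 0} = set_mset P"
  proof (intro Set.set_eqI iffI)
    fix w assume "w \<in> {j. j \<in> vertices n \<and> fst s k j > 0}"
    then have "mcount P w - mcount Q w > 0" using b by auto
    then have "mcount P w > 0" using mcount_nonneg[of Q w] by linarith
    then show "w \<in># P" by (simp add: mcount_def)
  next
    fix w assume w: "w \<in># P"
    then have "count Q w = 0" using disj[of w] by (metis count_eq_zero_iff)
    then show "w \<in> {j. j \<in> vertices n \<and> fst s k j > 0}" using w sub b by (auto simp: mcount_def)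
  qed
  have Q: "{j. j \<in> vertices n \<and> fst s k j < 0} = set_mset Q"
  proof (intro Set.set_eqI iffI)
    fix w assume "w \<in> {j. j \<in> vertices n \<and> fst s k j < 0}"
    then have "mcount P w - mcount Q w < 0" using b by auto
    then have "mcount Q w > 0" using mcount_nonneg[of P w] by linarith
    then show "w \<in># Q" by (simp add: mcount_def)
  next
    fix w assume w: "w \<in># Q"
    then have "count P w = 0" using disj[of w] by (metis count_eq_zero_iff)
    then show "w \<in> {j. j \<in> vertices n \<and> fst s k j < 0}" using w sub b by (auto simp: mcount_def)
  qed
  have "(\<Prod>v\<in>set_mset P. snd s v Z ^ nat \<lfloor>fst s k v\<rfloor>) = (\<Prod>v\<in>set_mset P. snd s v Z ^ count P v)"
  proof (rule prod.cong[OF refl])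
    fix v assume v: "v \<in># P"
    then have "count Q v = 0" using disj[of v] by (metis count_eq_zero_iff)
    then have "fst s k v = of_nat (count P v)" using b[of v] v sub by (auto simp: mcount_def)
    then show "snd s v Z ^ nat \<lfloor>fst s k v\<rfloor> = snd s v Z ^ count P v" by simp
  qed
  moreover have "(\<Prod>v\<in>set_mset Q. snd s v Z ^ nat \<lfloor>- fst s k v\<rfloor>) = (\<Prod>v\<in>set_mset Q. snd s v Z ^ count Q v)"
  proof (rule prod.cong[OF refl])
    fix v assume v: "v \<in># Q"
    then have "count P v = 0" using disj[of v] by (metis count_eq_zero_iff)
    then have "- fst s k v = of_nat (count Q v)" using b[of v] v sub by (auto simp: mcount_def)
    then show "snd s v Z ^ nat \<lfloor>- fst s k v\<rfloor> = snd s v Z ^ count Q v" by simp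
  qed
  ultimately show ?thesis
    unfolding exchange_rhs_def P Q by (simp add: image_prod_mset_multiplicity)
qed

section \<open>Regular functions\<close>

lemma regular_sum: "(\<And>x. x \<in> S \<Longrightarrow> f x \<in> regular_functions n) \<Longrightarrow> (\<lambda>Z. \<Sum>x\<in>S. f x Z) \<in> regular_functions n"
proof (induction S rule: infinite_finite_induct)
  case (insert x S)
  then show ?case using regular_functions.add[of "f x" n "\<lambda>Z. \<Sum>x\<in>S. f x Z"] by simp
qed (simp_all add: regular_functions.const)

lemma regular_prod: "(\<And>x. x \<in> S \<Longrightarrow> f x \<in> regular_functions n) \<Longrightarrow> (\<lambda>Z. \<Prod>x\<in>S. f x Z) \<in> regular_functions n"
proof (induction S rule: infinite_finite_induct)
  case (insert x S)
  then show ?case using regular_functions.mult[of "f x" n "\<lambda>Z. \<Prod>x\<in>S. f x Z"] by simp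
qed (simp_all add: regular_functions.const)

lemma regular_scale: "f \<in> regular_functions n \<Longrightarrow> (\<lambda>Z. c * f Z) \<in> regular_functions n"
  using regular_functions.mult[OF regular_functions.const[of c n]] by simp

section \<open>Forms and flags with regular coordinates\<close>

definition regular_form :: "nat \<Rightarrow> (flags \<Rightarrow> form) \<Rightarrow> bool" where
  "regular_form n \<alpha> \<longleftrightarrow> (\<forall>K. (\<lambda>Z. \<alpha> Z K) \<in> regular_functions n)"

definition regular_flag :: "nat \<Rightarrow> (flags \<Rightarrow> flag) \<Rightarrow> bool" where
  "regular_flag n v \<longleftrightarrow> (\<forall>i a. (\<lambda>Z. v Z i a) \<in> regular_functions n)"

lemma regular_form_const: "regular_form n (\<lambda>_. \<alpha>)"
  by (simp add: regular_form_def regular_functions.const)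

lemma regular_form_wedge: "regular_form n \<alpha> \<Longrightarrow> regular_form n \<beta> \<Longrightarrow> regular_form n (\<lambda>Z. \<alpha> Z \<and>\<^sub>e \<beta> Z)"
  unfolding regular_form_def wedge_def
  by (intro allI regular_sum regular_functions.mult regular_functions.const) auto

lemma regular_form_flag: "regular_flag n v \<Longrightarrow> regular_form n (\<lambda>Z. flag_form (v Z) a)"
proof (induction a)
  case (Suc a)
  have "regular_form n (\<lambda>Z. vec_form (v Z (Suc a)))"
    unfolding regular_form_def
  proof
    fix K
    show "(\<lambda>Z. vec_form (v Z (Suc a)) K) \<in> regular_functions n"
      using Suc.prems by (cases "card K = 1") (simp_all add: vec_form_def regular_flag_def regular_functions.const)
  qed
  from regular_form_wedge[OF Suc.IH[OF Suc.prems] this] show ?case by simp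
qed (simp add: regular_form_const)

lemma regular_top_coeff: "regular_form n \<alpha> \<Longrightarrow> (\<lambda>Z. top_coeff n (\<alpha> Z)) \<in> regular_functions n"
  by (simp add: top_coeff_def regular_form_def)

lemma regular_contract:
  assumes "regular_form n \<alpha>" "\<And>l \<xi>. l \<in> set ls \<Longrightarrow> (\<lambda>Z. l Z \<xi>) \<in> regular_functions n"
  shows "(\<lambda>Z. contract n (map (\<lambda>l. l Z) ls) (comult ps (\<alpha> Z))) \<in> regular_functions n"
proof -
  have c: "(\<lambda>Z. comult ps (\<alpha> Z) Is) \<in> regular_functions n" for Is
  proof (cases "map card Is = ps \<and> sorted_wrt (\<lambda>I J. I \<inter> J = {}) Is")
    case True
    show ?thesis unfolding comult_def if_P[OF True]
      using assms(1) by (simp add: regular_form_def regular_scale)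
  next
    case False
    show ?thesis unfolding comult_def if_not_P[OF False] by (rule regular_functions.const)
  qed
  have "(\<lambda>Z. \<Prod>k<length ls. (map (\<lambda>l. l Z) ls ! k) (basis_form (Is ! k))) \<in> regular_functions n" for Is
    by (rule regular_prod) (simp add: assms(2))
  then show ?thesis unfolding contract_def length_map
    by (intro regular_sum regular_functions.mult c)
qed

lemma regular_coordinate_flags:
  "regular_flag n fst" "regular_flag n (\<lambda>Z. fst (snd Z))" "regular_flag n (\<lambda>Z. snd (snd Z))"
  unfolding regular_flag_def
  using regular_functions.coord1[of _ _ n] regular_functions.coord2[of _ _ n] regular_functions.coord3[of _ _ n]
  by (simp_all add: case_prod_unfold)

lemma regular_neg_flag: "regular_flag n v \<Longrightarrow> regular_flag n (\<lambda>Z. neg_flag (v Z))"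
  unfolding regular_flag_def neg_flag_def using regular_scale[of _ n "-1"] by fastforce

lemmas regular_form_intros = regular_form_wedge regular_form_flag regular_form_const regular_coordinate_flags

lemma regular_br111: "br111 n a b c \<in> regular_functions n"
  unfolding br111_def case_prod_unfold by (intro regular_top_coeff regular_form_intros)

lemma regular_br211_flags:
  assumes "regular_flag n u" "regular_flag n v" "regular_flag n w"
  shows "(\<lambda>Z. br211 n a b c d (u Z, v Z, w Z)) \<in> regular_functions n"
proof -
  let ?ls = "[\<lambda>Z \<xi>. top_coeff n (flag_form (u Z) (min a b) \<and>\<^sub>e \<xi> \<and>\<^sub>e flag_form (w Z) d), \<lambda>Z \<xi>. top_coeff n (flag_form (u Z) (max a b) \<and>\<^sub>e \<xi>)]"
  have "(\<lambda>Z. contract n (map (\<lambda>l. l Z) ?ls) (comult [max a b + c - 2 * n, 2 * n - max a b] (flag_form (v Z) c))) \<in> regular_functions n"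
  proof (rule regular_contract)
    fix l \<xi> assume "l \<in> set ?ls"
    then consider "l = (\<lambda>Z \<xi>. top_coeff n (flag_form (u Z) (min a b) \<and>\<^sub>e \<xi> \<and>\<^sub>e flag_form (w Z) d))"
      | "l = (\<lambda>Z \<xi>. top_coeff n (flag_form (u Z) (max a b) \<and>\<^sub>e \<xi>))" by (auto simp only: list.set insert_iff empty_iff)
    then show "(\<lambda>Z. l Z \<xi>) \<in> regular_functions n"
      by cases (auto simp only: intro!: regular_top_coeff regular_form_intros assms)
  qed (intro regular_form_intros assms)
  then show ?thesis by (simp add: br211_def Let_def)
qed

lemma regular_br211: "br211 n a b c d \<in> regular_functions n"
  using regular_br211_flags[OF regular_coordinate_flags] by simp

lemma regular_br112: "br112 n a b c d \<in> regular_functions n"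
  using regular_br211_flags[OF regular_neg_flag[OF regular_coordinate_flags(3)] regular_coordinate_flags(1,2), of n c d a b]
  by (simp add: br112_def case_prod_unfold)

lemma regular_br222: "br222 n a b c d \<in> regular_functions n"
proof -
  let ?ls = "[\<lambda>Z \<xi>. top_coeff n (\<xi> \<and>\<^sub>e flag_form (snd (snd Z)) d), \<lambda>Z \<xi>. top_coeff n (flag_form (fst Z) b \<and>\<^sub>e \<xi>),
    \<lambda>Z \<xi>. top_coeff n (flag_form (fst Z) a \<and>\<^sub>e flag_form (fst (snd Z)) n \<and>\<^sub>e \<xi>)] :: (flags \<Rightarrow> form \<Rightarrow> complex) list"
  have "(\<lambda>Z. contract n (map (\<lambda>l. l Z) ?ls) (comult [2 * n - d, 2 * n - b, n - a] (flag_form (fst (snd Z)) n \<and>\<^sub>e flag_form (snd (snd Z)) c))) \<in> regular_functions n"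
  proof (rule regular_contract)
    fix l :: "flags \<Rightarrow> form \<Rightarrow> complex" and \<xi> assume "l \<in> set ?ls"
    then consider "l = (\<lambda>Z \<xi>. top_coeff n (\<xi> \<and>\<^sub>e flag_form (snd (snd Z)) d))"
      | "l = (\<lambda>Z \<xi>. top_coeff n (flag_form (fst Z) b \<and>\<^sub>e \<xi>))"
      | "l = (\<lambda>Z \<xi>. top_coeff n (flag_form (fst Z) a \<and>\<^sub>e flag_form (fst (snd Z)) n \<and>\<^sub>e \<xi>))"
      by (auto simp only: list.set insert_iff empty_iff)
    then show "(\<lambda>Z. l Z \<xi>) \<in> regular_functions n"
      by cases (auto simp only: intro!: regular_top_coeff regular_form_intros)
  qed (intro regular_form_intros)
  then show ?thesis by (simp add: br222_def case_prod_unfold)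
qed

lemma regular_initial_functions: "initial_functions n v \<in> regular_functions n"
proof (cases v)
  case (X i j)
  then show ?thesis by (simp add: regular_br111 regular_br211)
next
  case (Y k)
  show ?thesis unfolding Y initial_functions.simps case_prod_unfold by (intro regular_top_coeff regular_form_intros)
qed

section \<open>The exterior algebra\<close>

lemma shuffle_sign_empty [simp]: "shuffle_sign {} J = 1" "shuffle_sign I {} = 1"
  by (simp_all add: shuffle_sign_def)

lemma finite_inversions: "finite I \<Longrightarrow> finite J \<Longrightarrow> finite {(i, j). i \<in> I \<and> j \<in> J \<and> j < (i::nat)}"
  by (rule finite_subset[of _ "I \<times> J"]) auto

lemma shuffle_sign_Un_left:
  assumes "finite I" "finite I'" "finite J" "I \<inter> I' = {}"
  shows "shuffle_sign (I \<union> I') J = shuffle_sign I J * shuffle_sign I' J"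
proof -
  have "{(i, j). i \<in> I \<union> I' \<and> j \<in> J \<and> j < i} =
      {(i, j). i \<in> I \<and> j \<in> J \<and> j < i} \<union> {(i, j). i \<in> I' \<and> j \<in> J \<and> j < i}"
    by auto
  moreover have "{(i, j). i \<in> I \<and> j \<in> J \<and> j < i} \<inter> {(i, j). i \<in> I' \<and> j \<in> J \<and> j < i} = {}"
    using assms by auto
  ultimately show ?thesis
    unfolding shuffle_sign_def using assms
    by (simp add: card_Un_disjoint finite_inversions power_add)
qed

lemma shuffle_sign_Un_right:
  assumes "finite I" "finite J" "finite J'" "J \<inter> J' = {}"
  shows "shuffle_sign I (J \<union> J') = shuffle_sign I J * shuffle_sign I J'"
proof -
  have "{(i, j). i \<in> I \<and> j \<in> J \<union> J' \<and> j < i} =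
      {(i, j). i \<in> I \<and> j \<in> J \<and> j < i} \<union> {(i, j). i \<in> I \<and> j \<in> J' \<and> j < i}"
    by auto
  moreover have "{(i, j). i \<in> I \<and> j \<in> J \<and> j < i} \<inter> {(i, j). i \<in> I \<and> j \<in> J' \<and> j < i} = {}"
    using assms by auto
  ultimately show ?thesis
    unfolding shuffle_sign_def using assms
    by (simp add: card_Un_disjoint finite_inversions power_add)
qed

lemma shuffle_sign_square [simp]: "shuffle_sign I J * shuffle_sign I J = 1"
  by (simp add: shuffle_sign_def)

lemma shuffle_sign_square_left [simp]: "shuffle_sign I J * (shuffle_sign I J * z) = z"
  by (simp flip: mult.assoc)

text \<open>Every pair in \<open>I \<times> J\<close> is an inversion for exactly one of the two
  orders.\<close>

lemma shuffle_sign_swap: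
  assumes "finite I" "finite J" "I \<inter> J = {}"
  shows "shuffle_sign J I = (-1) ^ (card I * card J) * shuffle_sign I J"
proof -
  let ?A = "{(i, j). i \<in> I \<and> j \<in> J \<and> j < i}" and ?B = "{(i, j). i \<in> I \<and> j \<in> J \<and> i < j}"
  have fin: "finite ?A" "finite ?B"
    using assms(1,2) by (auto intro!: finite_inversions intro: finite_subset[of _ "I \<times> J"])
  have "?A \<union> ?B = I \<times> J" "?A \<inter> ?B = {}"
    using assms(3) by auto
  then have "card I * card J = card ?A + card ?B"
    using card_Un_disjoint[OF fin] by (simp add: card_cartesian_product)
  moreover have "card {(i, j). i \<in> J \<and> j \<in> I \<and> j < i} = card ?B"
    by (rule bij_betw_same_card[of prod.swap]) (auto simp: bij_betw_def inj_on_def image_def)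
  ultimately show ?thesis
    unfolding shuffle_sign_def
    by (metis (no_types, lifting) left_minus_one_mult_self mult.commute power_add)
qed

lemma wedge_infinite [simp]: "infinite K \<Longrightarrow> (\<alpha> \<and>\<^sub>e \<beta>) K = 0"
  by (simp add: wedge_def)

text \<open>Both sides sum over the ordered partitions of K into three parts, and either sign is the
  product of the three pairwise shuffle signs. On infinite K a wedge product is zero by the
  convention for infinite sums.\<close>

lemma wedge_assoc: "\<alpha> \<and>\<^sub>e \<beta> \<and>\<^sub>e \<gamma> = \<alpha> \<and>\<^sub>e (\<beta> \<and>\<^sub>e \<gamma>)"
proof
  fix K :: "nat set"
  show "(\<alpha> \<and>\<^sub>e \<beta> \<and>\<^sub>e \<gamma>) K = (\<alpha> \<and>\<^sub>e (\<beta> \<and>\<^sub>e \<gamma>)) K"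
  proof (cases "finite K")
    case True
    have "(\<alpha> \<and>\<^sub>e \<beta> \<and>\<^sub>e \<gamma>) K = (\<Sum>I\<in>Pow K. \<Sum>I'\<in>Pow I.
        shuffle_sign I (K - I) * (shuffle_sign I' (I - I') * \<alpha> I' * \<beta> (I - I')) * \<gamma> (K - I))"
      unfolding wedge_def sum_distrib_left sum_distrib_right ..
    also have "\<dots> = (\<Sum>(I, I')\<in>Sigma (Pow K) Pow.
        shuffle_sign I (K - I) * (shuffle_sign I' (I - I') * \<alpha> I' * \<beta> (I - I')) * \<gamma> (K - I))"
      by (rule sum.Sigma) (use True finite_subset[OF _ True] in auto)
    also have "\<dots> = (\<Sum>(I, J)\<in>Sigma (Pow K) (\<lambda>I. Pow (K - I)).
        shuffle_sign I (K - I) * \<alpha> I * (shuffle_sign J (K - I - J) * \<beta> J * \<gamma> (K - I - J)))"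
    proof (rule sum.reindex_bij_witness[of _ "\<lambda>(I, J). (I \<union> J, I)" "\<lambda>(I, I'). (I', I - I')"])
      fix x assume "x \<in> Sigma (Pow K) Pow"
      then obtain I J where x: "x = (I, J)" and IJ: "I \<subseteq> K" "J \<subseteq> I" by auto
      have fin: "finite I" "finite J" "finite (K - I)" "finite (I - J)"
        using IJ True finite_subset[of I K] finite_subset[of J I] by auto
      have "shuffle_sign J ((I - J) \<union> (K - I)) = shuffle_sign J (I - J) * shuffle_sign J (K - I)"
        by (rule shuffle_sign_Un_right) (use fin in auto)
      moreover have "(I - J) \<union> (K - I) = K - J" using IJ by auto
      ultimately have l: "shuffle_sign J (K - J) = shuffle_sign J (I - J) * shuffle_sign J (K - I)" by simp
      have "shuffle_sign (J \<union> (I - J)) (K - I) = shuffle_sign J (K - I) * shuffle_sign (I - J) (K - I)"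
        by (rule shuffle_sign_Un_left) (use fin in auto)
      moreover have "J \<union> (I - J) = I" using IJ by auto
      ultimately have r: "shuffle_sign I (K - I) = shuffle_sign J (K - I) * shuffle_sign (I - J) (K - I)" by simp
      have e: "K - J - (I - J) = K - I" using IJ by auto
      show "(case case x of (I, I') \<Rightarrow> (I', I - I') of (I, J) \<Rightarrow>
          shuffle_sign I (K - I) * \<alpha> I * (shuffle_sign J (K - I - J) * \<beta> J * \<gamma> (K - I - J))) =
        (case x of (I, I') \<Rightarrow> shuffle_sign I (K - I) * (shuffle_sign I' (I - I') * \<alpha> I' * \<beta> (I - I')) * \<gamma> (K - I))"
        unfolding x prod.case e l r by (simp only: mult_ac)
    qed auto
    also have "\<dots> = (\<Sum>I\<in>Pow K. \<Sum>J\<in>Pow (K - I).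
        shuffle_sign I (K - I) * \<alpha> I * (shuffle_sign J (K - I - J) * \<beta> J * \<gamma> (K - I - J)))"
      by (rule sum.Sigma[symmetric]) (use True in auto)
    also have "\<dots> = (\<alpha> \<and>\<^sub>e (\<beta> \<and>\<^sub>e \<gamma>)) K"
      unfolding wedge_def sum_distrib_left ..
    finally show ?thesis .
  qed simp
qed

lemma wedge_add_left: "(\<lambda>K. \<alpha> K + \<alpha>' K) \<and>\<^sub>e \<beta> = (\<lambda>K. (\<alpha> \<and>\<^sub>e \<beta>) K + (\<alpha>' \<and>\<^sub>e \<beta>) K)"
  by (simp add: wedge_def algebra_simps sum.distrib)

lemma wedge_add_right: "\<alpha> \<and>\<^sub>e (\<lambda>K. \<beta> K + \<beta>' K) = (\<lambda>K. (\<alpha> \<and>\<^sub>e \<beta>) K + (\<alpha> \<and>\<^sub>e \<beta>') K)"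
  by (simp add: wedge_def algebra_simps sum.distrib)

lemma wedge_scale_left: "(\<lambda>K. c * \<alpha> K) \<and>\<^sub>e \<beta> = (\<lambda>K. c * (\<alpha> \<and>\<^sub>e \<beta>) K)"
  by (simp add: wedge_def algebra_simps sum_distrib_left)

lemma wedge_scale_right: "\<alpha> \<and>\<^sub>e (\<lambda>K. c * \<beta> K) = (\<lambda>K. c * (\<alpha> \<and>\<^sub>e \<beta>) K)"
  by (simp add: wedge_def algebra_simps sum_distrib_left)

lemma wedge_zero [simp]: "(\<lambda>_. 0) \<and>\<^sub>e \<beta> = (\<lambda>_. 0)" "\<alpha> \<and>\<^sub>e (\<lambda>_. 0) = (\<lambda>_. 0)"
  by (simp_all add: wedge_def)

lemma wedge_sum_left: "(\<lambda>K. \<Sum>i\<in>A. f i K) \<and>\<^sub>e \<beta> = (\<lambda>K. \<Sum>i\<in>A. (f i \<and>\<^sub>e \<beta>) K)"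
  by (induction A rule: infinite_finite_induct) (simp_all add: wedge_add_left)

lemma wedge_sum_right: "\<alpha> \<and>\<^sub>e (\<lambda>K. \<Sum>i\<in>A. f i K) = (\<lambda>K. \<Sum>i\<in>A. (\<alpha> \<and>\<^sub>e f i) K)"
  by (induction A rule: infinite_finite_induct) (simp_all add: wedge_add_right)

text \<open>The type \<open>form\<close> also contains functions supported on infinite sets or on
  indices beyond 2n; this predicate singles out the genuine p-forms.\<close>

definition homog :: "nat \<Rightarrow> nat \<Rightarrow> form \<Rightarrow> bool" where
  "homog n p \<alpha> \<longleftrightarrow> (\<forall>K. \<alpha> K \<noteq> 0 \<longrightarrow> K \<subseteq> {1..2 * n} \<and> card K = p)"

lemma homogD: "homog n p \<alpha> \<Longrightarrow> \<alpha> K \<noteq> 0 \<Longrightarrow> K \<subseteq> {1..2 * n} \<and> card K = p \<and> finite K"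
  unfolding homog_def using finite_subset by blast

lemma homog_basis_form: "I \<subseteq> {1..2 * n} \<Longrightarrow> card I = p \<Longrightarrow> homog n p (basis_form I)"
  by (auto simp: homog_def basis_form_def split: if_splits)

lemma homog_empty [simp]: "homog n 0 (basis_form {})"
  by (simp add: homog_basis_form)

lemma homog_vec_form: "(\<And>a. x a \<noteq> 0 \<Longrightarrow> a \<in> {1..2 * n}) \<Longrightarrow> homog n 1 (vec_form x)"
  by (auto simp: homog_def vec_form_def card_1_singleton_iff split: if_splits)

lemma homog_wedge:
  assumes "homog n p \<alpha>" "homog n q \<beta>"
  shows "homog n (p + q) (\<alpha> \<and>\<^sub>e \<beta>)"
  unfolding homog_def
proof (intro allI impI)
  fix K assume "(\<alpha> \<and>\<^sub>e \<beta>) K \<noteq> 0"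
  then obtain I where I: "I \<subseteq> K" "\<alpha> I \<noteq> 0" "\<beta> (K - I) \<noteq> 0"
    unfolding wedge_def by (metis (no_types, lifting) PowD mult_eq_0_iff sum.neutral)
  then have "I \<subseteq> {1..2 * n}" "card I = p" "finite I" "K - I \<subseteq> {1..2 * n}" "card (K - I) = q" "finite (K - I)"
    using assms homogD by blast+
  then show "K \<subseteq> {1..2 * n} \<and> card K = p + q"
    using I(1) by (metis Un_Diff_cancel Un_absorb1 Un_least card_Un_disjoint Diff_disjoint)
qed

lemma wedge_unit_left: "homog n p \<alpha> \<Longrightarrow> basis_form {} \<and>\<^sub>e \<alpha> = \<alpha>"
proof
  fix K assume h: "homog n p \<alpha>"
  show "(basis_form {} \<and>\<^sub>e \<alpha>) K = \<alpha> K"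
  proof (cases "finite K")
    case True
    have "(basis_form {} \<and>\<^sub>e \<alpha>) K = (\<Sum>I\<in>Pow K. if I = {} then \<alpha> K else 0)"
      unfolding wedge_def basis_form_def by (intro sum.cong) auto
    then show ?thesis using True by (simp add: sum.delta)
  next
    case False
    then show ?thesis using h homogD[of n p \<alpha> K] by auto
  qed
qed

lemma wedge_commute:
  assumes "homog n p \<alpha>" "homog n q \<beta>"
  shows "\<beta> \<and>\<^sub>e \<alpha> = (\<lambda>K. (-1) ^ (p * q) * (\<alpha> \<and>\<^sub>e \<beta>) K)"
proof
  fix K :: "nat set"
  show "(\<beta> \<and>\<^sub>e \<alpha>) K = (-1) ^ (p * q) * (\<alpha> \<and>\<^sub>e \<beta>) K"
  proof (cases "finite K")
    case True
    have "(\<beta> \<and>\<^sub>e \<alpha>) K = (\<Sum>I\<in>Pow K. shuffle_sign (K - I) I * \<beta> (K - I) * \<alpha> I)"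
      unfolding wedge_def
      by (rule sum.reindex_bij_witness[of _ "\<lambda>I. K - I" "\<lambda>I. K - I"]) (auto simp: double_diff)
    also have "\<dots> = (\<Sum>I\<in>Pow K. (-1) ^ (p * q) * (shuffle_sign I (K - I) * \<alpha> I * \<beta> (K - I)))"
    proof (rule sum.cong[OF refl], safe)
      fix I assume "I \<subseteq> K"
      then have fin: "finite I" "finite (K - I)" using True finite_subset by blast+
      show "shuffle_sign (K - I) I * \<beta> (K - I) * \<alpha> I = (-1) ^ (p * q) * (shuffle_sign I (K - I) * \<alpha> I * \<beta> (K - I))"
      proof (cases "\<alpha> I = 0 \<or> \<beta> (K - I) = 0")
        case False
        then have "card I = p" "card (K - I) = q" using assms homogD by blast+
        then show ?thesis using shuffle_sign_swap[OF fin] by simp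
      qed auto
    qed
    finally show ?thesis by (simp add: wedge_def sum_distrib_left)
  qed simp
qed

section \<open>Interior products\<close>

definition ev :: "nat \<Rightarrow> (nat \<Rightarrow> complex) \<Rightarrow> (nat \<Rightarrow> complex) \<Rightarrow> complex" where
  "ev n y x = (\<Sum>a=1..2 * n. y a * x a)"

definition interior :: "nat \<Rightarrow> (nat \<Rightarrow> complex) \<Rightarrow> form \<Rightarrow> form" where
  "interior n y \<alpha> = (\<lambda>K. \<Sum>a\<in>{1..2 * n} - K. y a * shuffle_sign {a} K * \<alpha> (insert a K))"

text \<open>The bilinear pairing for which the basis forms are orthonormal. It lets covectors, and
  more generally forms on the dual space, be represented by the same type as vectors and their wedge
  products.\<close>

definition pr :: "nat \<Rightarrow> form \<Rightarrow> form \<Rightarrow> complex" where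
  "pr n \<alpha> \<beta> = (\<Sum>I\<in>Pow {1..2 * n}. \<alpha> I * \<beta> I)"

lemma pr_commute: "pr n \<alpha> \<beta> = pr n \<beta> \<alpha>"
  by (simp add: pr_def mult.commute)

text \<open>Contraction is adjoint to multiplication from the left; the terms are matched by moving
  the index \<open>a\<close> into or out of the index set.\<close>

lemma pr_interior: 
  shows "pr n \<alpha> (vec_form y \<and>\<^sub>e \<beta>) = pr n (interior n y \<alpha>) \<beta>"
proof -
  have *: "(vec_form y \<and>\<^sub>e \<beta>) K = (\<Sum>a\<in>K. y a * shuffle_sign {a} (K - {a}) * \<beta> (K - {a}))" if "finite K" for K
  proof -
    have "(vec_form y \<and>\<^sub>e \<beta>) K = (\<Sum>I\<in>(\<lambda>a. {a}) ` K. shuffle_sign I (K - I) * vec_form y I * \<beta> (K - I))"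
      unfolding wedge_def using that
      by (intro sum.mono_neutral_right) (auto simp: vec_form_def card_1_singleton_iff)
    also have "\<dots> = (\<Sum>a\<in>K. y a * shuffle_sign {a} (K - {a}) * \<beta> (K - {a}))"
      by (subst sum.reindex) (auto simp: vec_form_def mult_ac)
    finally show ?thesis .
  qed
  have "pr n \<alpha> (vec_form y \<and>\<^sub>e \<beta>) =
      (\<Sum>(K, a)\<in>Sigma (Pow {1..2 * n}) (\<lambda>K. K). \<alpha> K * (y a * shuffle_sign {a} (K - {a}) * \<beta> (K - {a})))"
    unfolding pr_def
    by (subst sum.Sigma[symmetric]) (auto simp: * sum_distrib_left finite_subset intro!: sum.cong)
  also have "\<dots> = (\<Sum>(K, a)\<in>Sigma (Pow {1..2 * n}) (\<lambda>K. {1..2 * n} - K). y a * shuffle_sign {a} K * \<alpha> (insert a K) * \<beta> K)"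
    by (rule sum.reindex_bij_witness[of _ "\<lambda>(K, a). (insert a K, a)" "\<lambda>(K, a). (K - {a}, a)"])
      (auto simp: insert_absorb mult_ac)
  also have "\<dots> = pr n (interior n y \<alpha>) \<beta>"
    unfolding pr_def interior_def by (subst sum.Sigma[symmetric]) (auto simp: sum_distrib_right)
  finally show ?thesis .
qed

text \<open>The antiderivation rule. Terms whose contracted index already lies in K occur in both
  products on the right with opposite signs and cancel, which is \<open>3\<close>. The terms with
  index outside K, sorted by the factor that receives it, make up the left side.\<close>

lemma interior_wedge:
  assumes \<alpha>: "homog n p \<alpha>" and K: "K \<subseteq> {1..2 * n}"
  shows "interior n y (\<alpha> \<and>\<^sub>e \<beta>) K = (interior n y \<alpha> \<and>\<^sub>e \<beta>) K + (-1) ^ p * (\<alpha> \<and>\<^sub>e interior n y \<beta>) K"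
proof -
  define A where "A = {1..2 * n}"
  have fin [simp]: "finite K" "finite A" and KA: "K \<subseteq> A"
    using K finite_subset by (auto simp: A_def)
  have finI [simp]: "finite I" "finite (K - I)" if "I \<in> Pow K" for I
    using that fin(1) finite_subset[of I K] by auto
  \<comment> \<open>\<open>t\<close> and \<open>u\<close> are the terms in which the contraction
    hits the first and the second factor, without the sign \<open>(-1) ^ p\<close>.\<close>
  define t where "t = (\<lambda>I a. shuffle_sign I (K - I) * (y a * shuffle_sign {a} I * \<alpha> (insert a I)) * \<beta> (K - I))"
  define u where "u = (\<lambda>I a. shuffle_sign I (K - I) * \<alpha> I * (y a * shuffle_sign {a} (K - I) * \<beta> (insert a (K - I))))"
  have "(interior n y \<alpha> \<and>\<^sub>e \<beta>) K = (\<Sum>I\<in>Pow K. \<Sum>a\<in>A - I. t I a)"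
    unfolding wedge_def interior_def t_def A_def by (simp add: sum_distrib_left sum_distrib_right)
  also have "\<dots> = (\<Sum>I\<in>Pow K. (\<Sum>a\<in>A - K. t I a) + (\<Sum>a\<in>K - I. t I a))"
  proof (rule sum.cong[OF refl])
    fix I assume "I \<in> Pow K"
    then have "A - I = (A - K) \<union> (K - I)" using KA by auto
    then show "(\<Sum>a\<in>A - I. t I a) = (\<Sum>a\<in>A - K. t I a) + (\<Sum>a\<in>K - I. t I a)"
      by (simp only:) (rule sum.union_disjoint, auto)
  qed
  finally have 1: "(interior n y \<alpha> \<and>\<^sub>e \<beta>) K =
      (\<Sum>I\<in>Pow K. \<Sum>a\<in>A - K. t I a) + (\<Sum>I\<in>Pow K. \<Sum>a\<in>K - I. t I a)"
    by (simp add: sum.distrib)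
  have "(\<alpha> \<and>\<^sub>e interior n y \<beta>) K = (\<Sum>I\<in>Pow K. \<Sum>a\<in>A - (K - I). u I a)"
    unfolding wedge_def interior_def u_def A_def by (simp add: sum_distrib_left sum_distrib_right)
  also have "\<dots> = (\<Sum>I\<in>Pow K. (\<Sum>a\<in>A - K. u I a) + (\<Sum>a\<in>I. u I a))"
  proof (rule sum.cong[OF refl])
    fix I assume "I \<in> Pow K"
    then have "A - (K - I) = (A - K) \<union> I" "(A - K) \<inter> I = {}" "finite I" using KA by auto
    then show "(\<Sum>a\<in>A - (K - I). u I a) = (\<Sum>a\<in>A - K. u I a) + (\<Sum>a\<in>I. u I a)"
      by (simp add: sum.union_disjoint)
  qed
  finally have 2: "(\<alpha> \<and>\<^sub>e interior n y \<beta>) K =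
      (\<Sum>I\<in>Pow K. \<Sum>a\<in>A - K. u I a) + (\<Sum>I\<in>Pow K. \<Sum>a\<in>I. u I a)"
    by (simp add: sum.distrib)
  have "(\<Sum>I\<in>Pow K. \<Sum>a\<in>K - I. t I a) = (\<Sum>(I, a)\<in>Sigma (Pow K) (\<lambda>I. K - I). t I a)"
    by (simp add: sum.Sigma)
  also have "\<dots> = (\<Sum>(I, a)\<in>Sigma (Pow K) (\<lambda>I. I). - ((-1) ^ p * u I a))"
  proof (rule sum.reindex_bij_witness[of _ "\<lambda>(I, a). (I - {a}, a)" "\<lambda>(I, a). (insert a I, a)"], safe)
    fix I a assume I: "I \<subseteq> K" and a: "a \<in> K" "a \<notin> I"
    define J where "J = K - insert a I"
    have e: "K - I = insert a J" "a \<notin> J" "I \<inter> J = {}" "finite I" "finite J" "K - insert a I = J"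
      using I a finite_subset[OF I] by (auto simp: J_def)
    show "- ((-1) ^ p * u (insert a I) a) = t I a"
    proof (cases "\<alpha> (insert a I) = 0")
      case False
      then have p: "p = Suc (card I)" using homogD[OF \<alpha> False] a e(4) by simp
      have sw: "shuffle_sign I {a} = (-1) ^ card I * shuffle_sign {a} I"
        using shuffle_sign_swap[of "{a}" I] a e(4) by simp
      have l: "shuffle_sign (insert a I) J = shuffle_sign {a} J * shuffle_sign I J"
        using a e shuffle_sign_Un_left[of "{a}" I J] by simp
      have r: "shuffle_sign I (insert a J) = shuffle_sign I {a} * shuffle_sign I J"
        using a e shuffle_sign_Un_right[of I "{a}" J] by simp
      have "- ((-1) ^ p) * (shuffle_sign (insert a I) J * shuffle_sign {a} J) = shuffle_sign I (insert a J) * shuffle_sign {a} I"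
        unfolding p sw l r by (simp add: mult_ac)
      then have "- ((-1) ^ p) * (shuffle_sign (insert a I) J * shuffle_sign {a} J) * z = shuffle_sign I (insert a J) * shuffle_sign {a} I * z" for z
        by simp
      from this[of "y a * \<alpha> (insert a I) * \<beta> (insert a J)"] show ?thesis
        unfolding u_def t_def e(1,6) by (simp add: mult_ac)
    qed (simp add: u_def t_def)
  qed auto
  also have "\<dots> = - ((-1) ^ p * (\<Sum>I\<in>Pow K. \<Sum>a\<in>I. u I a))"
    by (subst sum.Sigma[symmetric]) (auto simp: sum_negf sum_distrib_left)
  finally have 3: "(\<Sum>I\<in>Pow K. \<Sum>a\<in>K - I. t I a) = - ((-1) ^ p * (\<Sum>I\<in>Pow K. \<Sum>a\<in>I. u I a))" .
  let ?t = "\<lambda>a I. y a * shuffle_sign {a} K * (shuffle_sign I (insert a K - I) * \<alpha> I * \<beta> (insert a K - I))"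
  have "interior n y (\<alpha> \<and>\<^sub>e \<beta>) K = (\<Sum>a\<in>A - K. \<Sum>I\<in>Pow (insert a K). ?t a I)"
    unfolding interior_def wedge_def A_def by (simp add: sum_distrib_left)
  also have "\<dots> = (\<Sum>a\<in>A - K. (\<Sum>I\<in>Pow K. t I a) + (\<Sum>I\<in>Pow K. (-1) ^ p * u I a))"
  proof (rule sum.cong[OF refl])
    fix a assume a: "a \<in> A - K"
    have "inj_on (insert a) (Pow K)" using a by (auto simp: inj_on_def)
    then have "(\<Sum>I\<in>Pow (insert a K). ?t a I) = (\<Sum>I\<in>Pow K. ?t a I) + (\<Sum>I\<in>Pow K. ?t a (insert a I))"
      unfolding Pow_insert using a by (subst sum.union_disjoint) (auto simp: sum.reindex)
    also have "(\<Sum>I\<in>Pow K. ?t a (insert a I)) = (\<Sum>I\<in>Pow K. t I a)"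
    proof (rule sum.cong[OF refl])
      fix I assume I: "I \<in> Pow K"
      have e: "insert a K - insert a I = K - I" and aI: "a \<notin> I" "a \<notin> K - I" using a I by auto
      have "shuffle_sign {a} (I \<union> (K - I)) = shuffle_sign {a} I * shuffle_sign {a} (K - I)"
        by (rule shuffle_sign_Un_right) (use finI I in auto)
      moreover have "I \<union> (K - I) = K" using I by auto
      ultimately have l: "shuffle_sign {a} K = shuffle_sign {a} I * shuffle_sign {a} (K - I)" by simp
      have r: "shuffle_sign (insert a I) (K - I) = shuffle_sign {a} (K - I) * shuffle_sign I (K - I)"
        using shuffle_sign_Un_left[of "{a}" I "K - I"] finI[OF I] aI by simp
      have "shuffle_sign {a} K * shuffle_sign (insert a I) (K - I) = shuffle_sign {a} I * shuffle_sign I (K - I)"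
        unfolding l r by (simp add: mult_ac)
      then have "shuffle_sign {a} K * shuffle_sign (insert a I) (K - I) * z = shuffle_sign {a} I * shuffle_sign I (K - I) * z" for z
        by simp
      from this[of "y a * \<alpha> (insert a I) * \<beta> (K - I)"] show "?t a (insert a I) = t I a"
        unfolding e t_def by (simp add: mult_ac)
    qed
    also have "(\<Sum>I\<in>Pow K. ?t a I) = (\<Sum>I\<in>Pow K. (-1) ^ p * u I a)"
    proof (rule sum.cong[OF refl])
      fix I assume I: "I \<in> Pow K"
      show "?t a I = (-1) ^ p * u I a"
      proof (cases "\<alpha> I = 0")
        case False
        then have p: "card I = p" using homogD[OF \<alpha>] by blast
        have e: "insert a K - I = insert a (K - I)" and aI: "a \<notin> I" "a \<notin> K - I" using a I by auto
        have "shuffle_sign {a} (I \<union> (K - I)) = shuffle_sign {a} I * shuffle_sign {a} (K - I)"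
          by (rule shuffle_sign_Un_right) (use finI I in auto)
        moreover have "I \<union> (K - I) = K" using I by auto
        ultimately have l: "shuffle_sign {a} K = shuffle_sign {a} I * shuffle_sign {a} (K - I)" by simp
        have sw: "shuffle_sign I {a} = (-1) ^ p * shuffle_sign {a} I"
          using shuffle_sign_swap[of "{a}" I] aI finI[OF I] p by simp
        have r: "shuffle_sign I (insert a (K - I)) = shuffle_sign I {a} * shuffle_sign I (K - I)"
          using shuffle_sign_Un_right[of I "{a}" "K - I"] aI finI[OF I] by simp
        have "shuffle_sign {a} K * shuffle_sign I (insert a (K - I)) = (-1) ^ p * shuffle_sign I (K - I) * shuffle_sign {a} (K - I)"
          unfolding l r sw by (simp add: mult_ac)
        then have "shuffle_sign {a} K * shuffle_sign I (insert a (K - I)) * z = (-1) ^ p * shuffle_sign I (K - I) * shuffle_sign {a} (K - I) * z" for z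
          by simp
        from this[of "y a * \<alpha> I * \<beta> (insert a (K - I))"] show ?thesis
          unfolding u_def e by (simp add: mult_ac)
      qed (simp add: u_def)
    qed
    finally show "(\<Sum>I\<in>Pow (insert a K). ?t a I) = (\<Sum>I\<in>Pow K. t I a) + (\<Sum>I\<in>Pow K. (-1) ^ p * u I a)"
      by (simp add: add.commute)
  qed
  also have "\<dots> = (\<Sum>I\<in>Pow K. \<Sum>a\<in>A - K. t I a) + (-1) ^ p * (\<Sum>I\<in>Pow K. \<Sum>a\<in>A - K. u I a)"
    unfolding sum.distrib sum_distrib_left
    by (rule arg_cong2[of _ _ _ _ "(+)"]) (rule sum.swap)+
  finally show ?thesis
    unfolding 1 2 3 by (simp add: distrib_left)
qed

section \<open>Wedge products of vectors\<close>

definition in_space :: "nat \<Rightarrow> (nat \<Rightarrow> complex) \<Rightarrow> bool" where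
  "in_space n x \<longleftrightarrow> (\<forall>a. x a \<noteq> 0 \<longrightarrow> a \<in> {1..2 * n})"

text \<open>Nested to the right, in contrast to \<open>flag_form\<close>, so that contraction and
  the Laplace expansion of a determinant recurse along the list in the same way.\<close>

fun vwedge :: "(nat \<Rightarrow> complex) list \<Rightarrow> form" where
  "vwedge [] = basis_form {}"
| "vwedge (x # xs) = vec_form x \<and>\<^sub>e vwedge xs"

lemma homog_vec: "in_space n x \<Longrightarrow> homog n (Suc 0) (vec_form x)"
  using homog_vec_form[of x n] by (auto simp: in_space_def)

lemma homog_vwedge: "(\<And>x. x \<in> set xs \<Longrightarrow> in_space n x) \<Longrightarrow> homog n (length xs) (vwedge xs)"
proof (induction xs)
  case (Cons x xs)
  then show ?case using homog_wedge[OF homog_vec[of n x], of "length xs" "vwedge xs"] by simp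
qed simp

lemma vwedge_append:
  assumes "\<And>y. y \<in> set ys \<Longrightarrow> in_space n y"
  shows "vwedge (xs @ ys) = vwedge xs \<and>\<^sub>e vwedge ys"
  using homog_vwedge[of ys n] assms by (induction xs) (simp_all add: wedge_unit_left wedge_assoc)

lemma vwedge_single: "in_space n x \<Longrightarrow> vwedge [x] = vec_form x"
  using wedge_commute[OF homog_empty homog_vec] wedge_unit_left[OF homog_vec]
  by (metis (no_types, lifting) ext mult_1 mult_zero_left power_0 vwedge.simps)

lemma flag_form_vwedge:
  assumes "\<And>i. in_space n (v i)"
  shows "flag_form v a = vwedge (map v [1..<Suc a])"
proof (induction a)
  case (Suc a)
  have "vwedge (map v [1..<Suc a] @ [v (Suc a)]) = vwedge (map v [1..<Suc a]) \<and>\<^sub>e vwedge [v (Suc a)]"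
    by (rule vwedge_append[of _ n]) (use assms in auto)
  then show ?case
    unfolding flag_form.simps Suc.IH vwedge_single[OF assms] by simp
qed simp

lemma homog_flag_form:
  assumes "\<And>i. in_space n (v i)"
  shows "homog n a (flag_form v a)"
proof -
  have "homog n (length (map v [1..<Suc a])) (vwedge (map v [1..<Suc a]))"
    by (rule homog_vwedge) (use assms in auto)
  then show ?thesis unfolding flag_form_vwedge[OF assms] by (simp del: upt_Suc)
qed

lemma homog_eqI:
  assumes "homog n p \<alpha>" "homog n p \<beta>" "\<And>K. K \<subseteq> {1..2 * n} \<Longrightarrow> \<alpha> K = \<beta> K"
  shows "\<alpha> = \<beta>"
  using assms unfolding homog_def by (metis ext)

lemma homog_add: "homog n p \<alpha> \<Longrightarrow> homog n p \<beta> \<Longrightarrow> homog n p (\<lambda>K. \<alpha> K + \<beta> K)"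
  unfolding homog_def by (metis add_0)

lemma homog_scale: "homog n p \<alpha> \<Longrightarrow> homog n p (\<lambda>K. c * \<alpha> K)"
  unfolding homog_def by (metis mult_zero_right)

lemma homog_zero [simp]: "homog n p (\<lambda>_. 0)"
  by (simp add: homog_def)

lemma homog_sum: "(\<And>i. i \<in> A \<Longrightarrow> homog n p (f i)) \<Longrightarrow> homog n p (\<lambda>K. \<Sum>i\<in>A. f i K)"
  by (induction A rule: infinite_finite_induct) (simp_all add: homog_add)

lemma homog_interior: "homog n (Suc p) \<alpha> \<Longrightarrow> homog n p (interior n y \<alpha>)"
  unfolding homog_def[of n p]
proof (intro allI impI)
  fix K assume h: "homog n (Suc p) \<alpha>" and "interior n y \<alpha> K \<noteq> 0"
  then obtain a where a: "a \<in> {1..2 * n} - K" "\<alpha> (insert a K) \<noteq> 0"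
    unfolding interior_def by (metis (no_types, lifting) mult_eq_0_iff sum.neutral)
  then show "K \<subseteq> {1..2 * n} \<and> card K = p"
    using homogD[OF h a(2)] by auto
qed

lemma interior_scalar [simp]: "interior n y (basis_form {}) = (\<lambda>_. 0)"
  by (auto simp: interior_def basis_form_def)

lemma interior_vec: "in_space n x \<Longrightarrow> interior n y (vec_form x) = (\<lambda>K. ev n y x * basis_form {} K)"
proof (rule homog_eqI[of n 0])
  assume x: "in_space n x"
  show "homog n 0 (interior n y (vec_form x))" by (rule homog_interior[OF homog_vec[OF x]])
  show "homog n 0 (\<lambda>K. ev n y x * basis_form {} K)" by (rule homog_scale) simp
  fix K assume "K \<subseteq> {1..2 * n}"
  show "interior n y (vec_form x) K = ev n y x * basis_form {} K"
  proof (cases "K = {}")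
    case False
    have "card (insert a K) \<noteq> 1" if "a \<notin> K" for a
    proof
      assume "card (insert a K) = 1"
      then obtain b where "insert a K = {b}" by (auto simp: card_1_singleton_iff)
      then show False using False that by blast
    qed
    then show ?thesis using False by (auto simp: interior_def vec_form_def basis_form_def intro!: sum.neutral)
  qed (simp add: interior_def vec_form_def basis_form_def ev_def)
qed

text \<open>The antiderivation rule peels off the first vector; iterating it yields an alternating
  sum of the shape of a Laplace expansion.\<close>

lemma interior_vwedge:
  assumes "\<And>x. x \<in> set xs \<Longrightarrow> in_space n x"
  shows "interior n y (vwedge xs) =
    (\<lambda>K. \<Sum>i<length xs. (-1) ^ i * ev n y (xs ! i) * vwedge (take i xs @ drop (Suc i) xs) K)"
  using assms
proof (induction xs)
  case (Cons x xs)
  have x: "in_space n x" and xs: "\<And>z. z \<in> set xs \<Longrightarrow> in_space n z" using Cons.prems by auto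
  note IH = Cons.IH[OF xs]
  have "interior n y (vwedge (x # xs)) =
     (\<lambda>K. ev n y x * vwedge xs K + - (vec_form x \<and>\<^sub>e interior n y (vwedge xs)) K)"
  proof (rule homog_eqI[of n "length xs"])
    show "homog n (length xs) (interior n y (vwedge (x # xs)))"
      using homog_interior homog_vwedge[of "x # xs" n] Cons.prems by auto
    have "homog n (length xs) (vec_form x \<and>\<^sub>e interior n y (vwedge xs))"
    proof (cases xs)
      case (Cons z zs)
      then have "homog n (length zs) (interior n y (vwedge xs))"
        using homog_vwedge[of xs n] xs by (auto intro!: homog_interior)
      from homog_wedge[OF homog_vec[OF x] this] show ?thesis by (simp add: Cons)
    qed simp
    from homog_scale[OF this, of "-1"]
    show "homog n (length xs) (\<lambda>K. ev n y x * vwedge xs K + - (vec_form x \<and>\<^sub>e interior n y (vwedge xs)) K)"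
      by (intro homog_add homog_scale homog_vwedge xs) auto
    fix K assume "K \<subseteq> {1..2 * n}"
    from interior_wedge[OF homog_vec[OF x] this]
    show "interior n y (vwedge (x # xs)) K = ev n y x * vwedge xs K + - (vec_form x \<and>\<^sub>e interior n y (vwedge xs)) K"
      using interior_vec[OF x] wedge_unit_left[OF homog_vwedge[OF xs]] by (simp add: wedge_scale_left)
  qed
  also have "\<dots> = (\<lambda>K. \<Sum>i<length (x # xs). (-1) ^ i * ev n y ((x # xs) ! i) * vwedge (take i (x # xs) @ drop (Suc i) (x # xs)) K)"
  proof -
    have "vec_form x \<and>\<^sub>e interior n y (vwedge xs) =
        (\<lambda>K. \<Sum>i<length xs. (-1) ^ i * ev n y (xs ! i) * (vec_form x \<and>\<^sub>e vwedge (take i xs @ drop (Suc i) xs)) K)"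
      by (simp only: IH wedge_sum_right wedge_scale_right)
    then show ?thesis
      by (simp add: sum.lessThan_Suc_shift sum_negf del: sum.lessThan_Suc)
  qed
  finally show ?case .
qed simp

lemma pr_sum_left: "pr n (\<lambda>K. \<Sum>i\<in>A. f i K) \<beta> = (\<Sum>i\<in>A. pr n (f i) \<beta>)"
  unfolding pr_def sum_distrib_right by (rule sum.swap)

lemma pr_scale_left: "pr n (\<lambda>K. c * \<alpha> K) \<beta> = c * pr n \<alpha> \<beta>"
  by (simp add: pr_def sum_distrib_left mult.assoc)

lemma pr_vwedge_Cons:
  assumes "\<And>x. x \<in> set xs \<Longrightarrow> in_space n x"
  shows "pr n (vwedge xs) (vec_form y \<and>\<^sub>e \<beta>) =
    (\<Sum>i<length xs. (-1) ^ i * ev n y (xs ! i) * pr n (vwedge (take i xs @ drop (Suc i) xs)) \<beta>)"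
  by (simp add: pr_interior interior_vwedge[OF assms] pr_sum_left pr_scale_left)

lemma ev_commute: "ev n x y = ev n y x"
  by (simp add: ev_def mult.commute)

section \<open>The symplectic form and the Hodge star\<close>

text \<open>The covector \<open><x, ->\<close> in coordinates; reversed index and alternating sign
  come from the Gram matrix of the standard basis.\<close>

definition flat :: "nat \<Rightarrow> (nat \<Rightarrow> complex) \<Rightarrow> (nat \<Rightarrow> complex)" where
  "flat n x = (\<lambda>b. (-1) ^ b * x (2 * n + 1 - b))"

lemma in_space_flat: "in_space n x \<Longrightarrow> in_space n (flat n x)"
  unfolding in_space_def
proof (intro allI impI)
  fix b assume x: "\<forall>a. x a \<noteq> 0 \<longrightarrow> a \<in> {1..2 * n}" and "flat n x b \<noteq> 0"
  then have "2 * n + 1 - b \<in> {1..2 * n}" by (auto simp: flat_def)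
  then show "b \<in> {1..2 * n}" by auto
qed

lemma ev_flat: "ev n (flat n x) y = symplectic_form n x y"
proof -
  have "{1..2 * n} = {1..n} \<union> {n + 1..2 * n}" "{1..n} \<inter> {n + 1..2 * n} = {}" by auto
  then have "ev n (flat n x) y = (\<Sum>b=1..n. (-1) ^ b * x (2 * n + 1 - b) * y b) + (\<Sum>b=n + 1..2 * n. (-1) ^ b * x (2 * n + 1 - b) * y b)"
    unfolding ev_def flat_def by (simp add: sum.union_disjoint)
  also have "(\<Sum>b=n + 1..2 * n. (-1) ^ b * x (2 * n + 1 - b) * y b) = (\<Sum>b=1..n. (-1) ^ (b - 1) * x b * y (2 * n + 1 - b))"
  proof (rule sum.reindex_bij_witness[of _ "\<lambda>b. 2 * n + 1 - b" "\<lambda>b. 2 * n + 1 - b"])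
    fix b assume "b \<in> {n + 1..2 * n}"
    then obtain k where "2 * n = b + k" by (metis atLeastAtMost_iff le_Suc_ex)
    moreover have "(-1) ^ b = ((-1) ^ k :: complex)"
      using \<open>2 * n = b + k\<close> by (metis even_add even_mult_iff even_numeral neg_one_even_power neg_one_odd_power)
    ultimately show "(- 1) ^ (2 * n + 1 - b - 1) * x (2 * n + 1 - b) * y (2 * n + 1 - (2 * n + 1 - b)) =
       (- 1) ^ b * x (2 * n + 1 - b) * y b" by simp
  qed auto
  also have "(\<Sum>b=1..n. (-1) ^ b * x (2 * n + 1 - b) * y b) + \<dots> = symplectic_form n x y"
    unfolding symplectic_form_def sum.distrib[symmetric]
  proof (rule sum.cong[OF refl])
    fix b assume "b \<in> {1..n}"
    then obtain k where "b = Suc k" by (metis Suc_le_D atLeastAtMost_iff One_nat_def)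
    then show "(-1) ^ b * x (2 * n + 1 - b) * y b + (-1) ^ (b - 1) * x b * y (2 * n + 1 - b) =
       (-1) ^ (b - 1) * (x b * y (2 * n + 1 - b) - x (2 * n + 1 - b) * y b)"
      by (simp add: algebra_simps)
  qed
  finally show ?thesis .
qed

lemma symplectic_form_swap: "symplectic_form n y x = - symplectic_form n x y"
  unfolding symplectic_form_def by (simp add: sum_negf[symmetric] algebra_simps)

lemma symplectic_basis_in_space: "symplectic_basis n v \<Longrightarrow> in_space n (v i)"
  unfolding symplectic_basis_def in_space_def by blast

text \<open>Symplectic bases are defined by their pairings for i < j only. If
  \<open>i + j = 2 * n + 1\<close>, the indices have different parity, so skew-symmetry reproduces
  the same formula for i > j.\<close>

lemma symplectic_basis_pairing:
  assumes "symplectic_basis n v" "i \<in> {1..2 * n}" "j \<in> {1..2 * n}"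
  shows "symplectic_form n (v i) (v j) = (if i + j = 2 * n + 1 then (-1) ^ (i - 1) else 0)"
proof (cases i j rule: linorder_cases)
  case less
  then show ?thesis using assms unfolding symplectic_basis_def by blast
next
  case equal
  then show ?thesis using symplectic_form_swap[of n "v i" "v i"] by simp presburger
next
  case greater
  then have "symplectic_form n (v j) (v i) = (if i + j = 2 * n + 1 then (-1) ^ (j - 1) else 0)"
    using assms unfolding symplectic_basis_def by (metis add.commute)
  moreover have "- ((-1) ^ (j - 1)) = ((-1) ^ (i - 1) :: complex)" if ij: "i + j = 2 * n + 1"
  proof -
    obtain k l where "i = Suc k" "j = Suc l" using assms by (metis Suc_le_D atLeastAtMost_iff One_nat_def)
    then have "odd (k + l)" using ij by simp presburger
    then show ?thesis using \<open>i = Suc k\<close> \<open>j = Suc l\<close> by (cases "even k") auto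
  qed
  ultimately show ?thesis using symplectic_form_swap[of n "v i" "v j"] by auto
qed

lemma top_coeff_pr: "homog n (2 * n) \<xi> \<Longrightarrow> pr n \<alpha> \<xi> = \<alpha> {1..2 * n} * top_coeff n \<xi>"
proof -
  assume h: "homog n (2 * n) \<xi>"
  have "\<xi> I = 0" if "I \<in> Pow {1..2 * n} - {{1..2 * n}}" for I
  proof (rule ccontr)
    assume "\<xi> I \<noteq> 0"
    then have "I \<subseteq> {1..2 * n} \<and> card I = 2 * n" using homogD[OF h] by blast
    then have "I = {1..2 * n}" by (intro card_subset_eq) auto
    then show False using that by simp
  qed
  then have "pr n \<alpha> \<xi> = (\<Sum>I\<in>{{1..2 * n}}. \<alpha> I * \<xi> I)"
    unfolding pr_def by (intro sum.mono_neutral_right) auto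
  then show ?thesis by (simp add: top_coeff_def)
qed

text \<open>Induction on b: bringing \<open>u (Suc b)\<close> to the other side of \<open>pr\<close>
  contracts the covectors with it. Among the covectors of the first \<open>2 * n - b\<close> basis
  vectors only the last pairs nontrivially, and the value of that pairing cancels the sign of its
  position. The constant is the volume of the covectors, which is shown to be 1 later.\<close>

lemma hodge_scaled:
  assumes u: "symplectic_basis n u"
  shows "b \<le> 2 * n \<Longrightarrow> homog n (2 * n - b) \<xi> \<Longrightarrow>
    pr n (vwedge (map (\<lambda>i. flat n (u i)) [1..<Suc (2 * n - b)])) \<xi> =
    vwedge (map (\<lambda>i. flat n (u i)) [1..<Suc (2 * n)]) {1..2 * n} * top_coeff n (flag_form u b \<and>\<^sub>e \<xi>)"
proof (induction b arbitrary: \<xi>)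
  case 0
  then show ?case by (simp add: top_coeff_pr wedge_unit_left del: upt_Suc)
next
  case (Suc b)
  have sp: "in_space n (u i)" for i by (rule symplectic_basis_in_space[OF u])
  obtain m where m: "2 * n - b = Suc m" "2 * n - Suc b = m" "2 * n = Suc (b + m)"
    using Suc.prems(1) by (metis Suc_diff_Suc Suc_le_lessD le_add_diff_inverse add_Suc)
  let ?f = "\<lambda>k. map (\<lambda>i. flat n (u i)) [1..<Suc k]"
  have len: "length (?f k) = k" for k by simp
  have h: "homog n (2 * n - b) (vec_form (u (Suc b)) \<and>\<^sub>e \<xi>)"
    using homog_wedge[OF homog_vec[OF sp] Suc.prems(2)] m by simp
  have "flag_form u (Suc b) \<and>\<^sub>e \<xi> = flag_form u b \<and>\<^sub>e (vec_form (u (Suc b)) \<and>\<^sub>e \<xi>)"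
    by (simp add: wedge_assoc)
  then have "vwedge (?f (2 * n)) {1..2 * n} * top_coeff n (flag_form u (Suc b) \<and>\<^sub>e \<xi>) =
      pr n (vwedge (?f (Suc m))) (vec_form (u (Suc b)) \<and>\<^sub>e \<xi>)"
    using Suc.IH[OF _ h] Suc.prems(1) m by simp
  also have "\<dots> = (\<Sum>i<Suc m. (-1) ^ i * ev n (u (Suc b)) (?f (Suc m) ! i) *
      pr n (vwedge (take i (?f (Suc m)) @ drop (Suc i) (?f (Suc m)))) \<xi>)"
    by (subst pr_vwedge_Cons) (auto simp: in_space_flat sp simp del: upt_Suc)
  also have "\<dots> = (\<Sum>i<Suc m. if i = m then pr n (vwedge (?f m)) \<xi> else 0)"
  proof (rule sum.cong[OF refl])
    fix i assume i: "i \<in> {..<Suc m}"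
    have "?f (Suc m) ! i = flat n (u (Suc i))"
      using i by (simp del: upt_Suc)
    then have e: "ev n (u (Suc b)) (?f (Suc m) ! i) = symplectic_form n (u (Suc i)) (u (Suc b))"
      unfolding ev_commute[of n "u (Suc b)"] by (simp only: ev_flat)
    have "symplectic_form n (u (Suc i)) (u (Suc b)) = (if i = m then (-1) ^ i else 0)"
      using symplectic_basis_pairing[OF u, of "Suc i" "Suc b"] i m by auto
    moreover have "take m (?f (Suc m)) @ drop (Suc m) (?f (Suc m)) = ?f m" by simp
    ultimately show "(-1) ^ i * ev n (u (Suc b)) (?f (Suc m) ! i) *
      pr n (vwedge (take i (?f (Suc m)) @ drop (Suc i) (?f (Suc m)))) \<xi> = (if i = m then pr n (vwedge (?f m)) \<xi> else 0)"
      unfolding e by (auto simp del: upt_Suc)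
  qed
  also have "\<dots> = pr n (vwedge (?f m)) \<xi>" by simp
  finally show ?case using m by simp
qed

section \<open>Comultiplication as the adjoint of the wedge product\<close>

lemma sum_disjoint_pairs:
  assumes "finite A"
  shows "(\<Sum>I\<in>Pow A. \<Sum>J\<in>Pow A. if I \<inter> J = {} then shuffle_sign I J * f I * g J * h (I \<union> J) else 0) =
    (\<Sum>K\<in>Pow A. h K * (f \<and>\<^sub>e g) K)"
proof -
  have "(\<Sum>I\<in>Pow A. \<Sum>J\<in>Pow A. if I \<inter> J = {} then shuffle_sign I J * f I * g J * h (I \<union> J) else 0) =
      (\<Sum>I\<in>Pow A. \<Sum>J\<in>Pow (A - I). shuffle_sign I J * f I * g J * h (I \<union> J))"
    by (intro sum.cong[OF refl] sum.mono_neutral_cong_right) (use assms in auto)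
  also have "\<dots> = (\<Sum>(I, J)\<in>Sigma (Pow A) (\<lambda>I. Pow (A - I)). shuffle_sign I J * f I * g J * h (I \<union> J))"
    by (rule sum.Sigma) (use assms in auto)
  also have "\<dots> = (\<Sum>(K, I)\<in>Sigma (Pow A) Pow. h K * (shuffle_sign I (K - I) * f I * g (K - I)))"
  proof (rule sum.reindex_bij_witness[of _ "\<lambda>(K, I). (I, K - I)" "\<lambda>(I, J). (I \<union> J, I)"])
    fix x assume "x \<in> Sigma (Pow A) (\<lambda>I. Pow (A - I))"
    then obtain I J where x: "x = (I, J)" "I \<subseteq> A" "J \<subseteq> A - I" by auto
    then have "I \<union> J - I = J" by auto
    then show "(case case x of (I, J) \<Rightarrow> (I \<union> J, I) of (K, I) \<Rightarrow> h K * (shuffle_sign I (K - I) * f I * g (K - I))) =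
      (case x of (I, J) \<Rightarrow> shuffle_sign I J * f I * g J * h (I \<union> J))"
      unfolding x(1) by (simp add: mult_ac)
  qed auto
  also have "\<dots> = (\<Sum>K\<in>Pow A. \<Sum>I\<in>Pow K. h K * (shuffle_sign I (K - I) * f I * g (K - I)))"
    by (rule sum.Sigma[symmetric]) (use assms finite_subset in auto)
  finally show ?thesis unfolding wedge_def sum_distrib_left .
qed

text \<open>The p-form that represents a linear functional on p-forms with respect to
  \<open>pr\<close>.\<close>

definition functional_form :: "nat \<Rightarrow> nat \<Rightarrow> (form \<Rightarrow> complex) \<Rightarrow> form" where
  "functional_form n p l = (\<lambda>I. if I \<subseteq> {1..2 * n} \<and> card I = p then l (basis_form I) else 0)"

lemma homog_functional_form [simp]: "homog n p (functional_form n p l)"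
  by (simp add: homog_def functional_form_def)

lemma sum_lists_Suc:
  assumes "finite A"
  shows "(\<Sum>Is | set Is \<subseteq> A \<and> length Is = Suc r. g Is) = (\<Sum>I\<in>A. \<Sum>Is | set Is \<subseteq> A \<and> length Is = r. g (I # Is))"
proof -
  have fin: "finite {Is. set Is \<subseteq> A \<and> length Is = r}" using assms by (rule finite_lists_length_eq)
  have "{Is. set Is \<subseteq> A \<and> length Is = Suc r} = (\<lambda>(I, Is). I # Is) ` (A \<times> {Is. set Is \<subseteq> A \<and> length Is = r})"
    by (auto simp: length_Suc_conv image_def)
  then have "(\<Sum>Is | set Is \<subseteq> A \<and> length Is = Suc r. g Is) = (\<Sum>(I, Is)\<in>A \<times> {Is. set Is \<subseteq> A \<and> length Is = r}. g (I # Is))"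
    by (simp add: sum.reindex inj_on_def split_def)
  also have "\<dots> = (\<Sum>I\<in>A. \<Sum>Is | set Is \<subseteq> A \<and> length Is = r. g (I # Is))"
    by (rule sum.Sigma[symmetric]) (use assms fin in auto)
  finally show ?thesis .
qed

lemma sum_lists_0: "(\<Sum>Is | set Is \<subseteq> A \<and> length Is = 0. g Is) = g []"
proof -
  have "{Is. set Is \<subseteq> A \<and> length Is = 0} = {[]}" by auto
  then show ?thesis by simp
qed

text \<open>The sign with which comultiplication splits an index set into I and J is the sign of the
  product of the basis forms of I and J. Contracting is therefore pairing with the wedge product of
  the forms that represent the functionals.\<close>

lemma contract_comult_2:
  "contract n [l1, l2] (comult [p, q] \<alpha>) = pr n \<alpha> (functional_form n p l1 \<and>\<^sub>e functional_form n q l2)"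
proof -
  let ?f = "functional_form n p l1" and ?g = "functional_form n q l2"
  have "contract n [l1, l2] (comult [p, q] \<alpha>) = (\<Sum>I\<in>Pow {1..2 * n}. \<Sum>J\<in>Pow {1..2 * n}.
      comult [p, q] \<alpha> [I, J] * (l1 (basis_form I) * l2 (basis_form J)))"
    unfolding contract_def
    by (simp only: length_Cons list.size(3) add_0_right sum_lists_Suc finite_Pow_iff finite_atLeastAtMost sum_lists_0
      prod.lessThan_Suc lessThan_0 prod.empty nth_Cons_0 nth_Cons_Suc mult_1 One_nat_def add_Suc_right)
  also have "\<dots> = (\<Sum>I\<in>Pow {1..2 * n}. \<Sum>J\<in>Pow {1..2 * n}.
      if I \<inter> J = {} then shuffle_sign I J * ?f I * ?g J * \<alpha> (I \<union> J) else 0)"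
    by (intro sum.cong[OF refl]) (simp add: comult_def functional_form_def mult_ac)
  finally show ?thesis
    unfolding pr_def by (simp add: sum_disjoint_pairs)
qed

lemma contract_comult_3:
  "contract n [l1, l2, l3] (comult [p, q, r] \<alpha>) =
    pr n \<alpha> (functional_form n p l1 \<and>\<^sub>e (functional_form n q l2 \<and>\<^sub>e functional_form n r l3))"
proof -
  let ?f = "functional_form n p l1" and ?g = "functional_form n q l2" and ?h = "functional_form n r l3"
  have "contract n [l1, l2, l3] (comult [p, q, r] \<alpha>) = (\<Sum>I\<in>Pow {1..2 * n}. \<Sum>J\<in>Pow {1..2 * n}. \<Sum>L\<in>Pow {1..2 * n}.
      comult [p, q, r] \<alpha> [I, J, L] * (l1 (basis_form I) * l2 (basis_form J) * l3 (basis_form L)))"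
    unfolding contract_def
    by (simp only: length_Cons list.size(3) add_0_right sum_lists_Suc finite_Pow_iff finite_atLeastAtMost sum_lists_0
      prod.lessThan_Suc lessThan_0 prod.empty nth_Cons_0 nth_Cons_Suc mult_1 One_nat_def add_Suc_right)
  also have "\<dots> = (\<Sum>I\<in>Pow {1..2 * n}. \<Sum>J\<in>Pow {1..2 * n}. \<Sum>L\<in>Pow {1..2 * n}. if J \<inter> L = {} then shuffle_sign J L * ?g J * ?h L *
      (if I \<inter> (J \<union> L) = {} then shuffle_sign I (J \<union> L) * ?f I * \<alpha> (I \<union> (J \<union> L)) else 0) else 0)"
    by (intro sum.cong[OF refl]) (auto simp: comult_def functional_form_def mult_ac)
  also have "\<dots> = (\<Sum>I\<in>Pow {1..2 * n}. \<Sum>M\<in>Pow {1..2 * n}.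
      (if I \<inter> M = {} then shuffle_sign I M * ?f I * \<alpha> (I \<union> M) else 0) * (?g \<and>\<^sub>e ?h) M)"
    by (intro sum.cong[OF refl] sum_disjoint_pairs) simp
  also have "\<dots> = (\<Sum>I\<in>Pow {1..2 * n}. \<Sum>M\<in>Pow {1..2 * n}.
      if I \<inter> M = {} then shuffle_sign I M * ?f I * (?g \<and>\<^sub>e ?h) M * \<alpha> (I \<union> M) else 0)"
    by (intro sum.cong[OF refl]) simp
  finally show ?thesis
    unfolding pr_def by (simp add: sum_disjoint_pairs)
qed

lemma pr_basis_form: "I \<subseteq> {1..2 * n} \<Longrightarrow> pr n \<alpha> (basis_form I) = \<alpha> I"
proof -
  assume I: "I \<subseteq> {1..2 * n}"
  have "pr n \<alpha> (basis_form I) = (\<Sum>K\<in>Pow {1..2 * n}. if K = I then \<alpha> I else 0)"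
    unfolding pr_def basis_form_def by (intro sum.cong) auto
  then show ?thesis using I by simp
qed

lemma form_expansion: "homog n p \<alpha> \<Longrightarrow> \<alpha> = (\<lambda>K. \<Sum>I\<in>Pow {1..2 * n}. \<alpha> I * basis_form I K)"
proof
  fix K assume h: "homog n p \<alpha>"
  have "(\<Sum>I\<in>Pow {1..2 * n}. \<alpha> I * basis_form I K) = (\<Sum>I\<in>Pow {1..2 * n}. if I = K then \<alpha> I else 0)"
    by (intro sum.cong) (auto simp: basis_form_def)
  then show "\<alpha> K = (\<Sum>I\<in>Pow {1..2 * n}. \<alpha> I * basis_form I K)"
    using homogD[OF h, of K] by (cases "\<alpha> K = 0") (auto simp: sum.delta)
qed

text \<open>By linearity, weighting the values of a functional on the basis forms by the
  coefficients of \<alpha> gives its value at \<alpha>.\<close>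

lemma pr_functional_form:
  assumes "homog n p \<alpha>"
  shows "pr n \<alpha> (functional_form n p (\<lambda>\<xi>. pr n \<gamma> (L \<and>\<^sub>e \<xi> \<and>\<^sub>e R))) = pr n \<gamma> (L \<and>\<^sub>e \<alpha> \<and>\<^sub>e R)"
proof -
  have "L \<and>\<^sub>e \<alpha> \<and>\<^sub>e R = (\<lambda>K. \<Sum>I\<in>Pow {1..2 * n}. \<alpha> I * (L \<and>\<^sub>e basis_form I \<and>\<^sub>e R) K)"
    by (subst form_expansion[OF assms]) (simp only: wedge_sum_left wedge_sum_right wedge_scale_left wedge_scale_right)
  then have "pr n \<gamma> (L \<and>\<^sub>e \<alpha> \<and>\<^sub>e R) = (\<Sum>I\<in>Pow {1..2 * n}. \<alpha> I * pr n \<gamma> (L \<and>\<^sub>e basis_form I \<and>\<^sub>e R))"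
    unfolding pr_commute[of n \<gamma>] by (simp only: pr_sum_left pr_scale_left)
  also have "\<dots> = pr n \<alpha> (functional_form n p (\<lambda>\<xi>. pr n \<gamma> (L \<and>\<^sub>e \<xi> \<and>\<^sub>e R)))"
    unfolding pr_def[of n \<alpha>] functional_form_def
  proof (rule sum.cong[OF refl])
    fix I
    show "\<alpha> I * pr n \<gamma> (L \<and>\<^sub>e basis_form I \<and>\<^sub>e R) =
      \<alpha> I * (if I \<subseteq> {1..2 * n} \<and> card I = p then pr n \<gamma> (L \<and>\<^sub>e basis_form I \<and>\<^sub>e R) else 0)"
      using homogD[OF assms, of I] by (cases "\<alpha> I = 0") auto
  qed
  finally show ?thesis by simp
qed

lemma top_coeff_as_pr: "top_coeff n \<alpha> = pr n (basis_form {1..2 * n}) \<alpha>"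
  by (simp add: pr_commute[of n "basis_form _"] pr_basis_form top_coeff_def)

lemma functional_form_cong:
  assumes "\<And>I. I \<subseteq> {1..2 * n} \<Longrightarrow> card I = p \<Longrightarrow> homog n p (basis_form I) \<Longrightarrow> l (basis_form I) = c * l' (basis_form I)"
  shows "functional_form n p l = (\<lambda>K. c * functional_form n p l' K)"
proof
  fix K
  show "functional_form n p l K = c * functional_form n p l' K"
    using assms[of K] homog_basis_form[of K n p]
    unfolding functional_form_def by (cases "K \<subseteq> {1..2 * n} \<and> card K = p") (simp_all only: if_True if_False simp_thms mult_zero_right)
qed

lemma functional_form_pr: "homog n p \<alpha> \<Longrightarrow> functional_form n p (pr n \<alpha>) = \<alpha>"
proof (rule homog_eqI[OF homog_functional_form])
  fix K assume "homog n p \<alpha>" "K \<subseteq> {1..2 * n}"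
  then show "functional_form n p (pr n \<alpha>) K = \<alpha> K"
    using homogD[of n p \<alpha> K] by (auto simp: functional_form_def pr_basis_form)
qed

lemma top_wedge_commute:
  assumes "homog n p \<alpha>" "homog n q \<beta>"
  shows "top_coeff n (\<alpha> \<and>\<^sub>e \<beta>) = (-1) ^ (p * q) * top_coeff n (\<beta> \<and>\<^sub>e \<alpha>)"
  unfolding top_coeff_def wedge_commute[OF assms] by simp

section \<open>Iterated contraction\<close>

text \<open>The head of the list is contracted first; in this order the operation is adjoint to
  multiplication from the left by \<open>vwedge ys\<close>.\<close>

definition minterior :: "nat \<Rightarrow> (nat \<Rightarrow> complex) list \<Rightarrow> form \<Rightarrow> form" where
  "minterior n ys = fold (interior n) ys"

lemma pr_minterior: 
  assumes "\<And>y. y \<in> set ys \<Longrightarrow> in_space n y" and "homog n p \<gamma>"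
  shows "pr n \<alpha> (vwedge ys \<and>\<^sub>e \<gamma>) = pr n (minterior n ys \<alpha>) \<gamma>"
  using assms
  by (induction ys arbitrary: \<alpha>) (simp_all add: minterior_def wedge_assoc pr_interior wedge_unit_left)

lemma homog_minterior:
  "homog n (p + length ys) \<alpha> \<Longrightarrow> homog n p (minterior n ys \<alpha>)"
  by (induction ys arbitrary: \<alpha>) (simp_all add: minterior_def homog_interior)

text \<open>Paired with basis forms, this is the anticommutation of two vectors under the wedge
  product.\<close>

lemma interior_anticommute:
  assumes "in_space n y" "in_space n z" "homog n (Suc (Suc p)) \<alpha>"
  shows "interior n y (interior n z \<alpha>) = (\<lambda>K. - interior n z (interior n y \<alpha>) K)"
proof (rule homog_eqI[of n p])
  show "homog n p (interior n y (interior n z \<alpha>))" 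
    using assms(3) by (intro homog_interior)
  show "homog n p (\<lambda>K. - interior n z (interior n y \<alpha>) K)"
    using homog_scale[OF homog_interior[OF homog_interior[OF assms(3)]], of "-1"] by simp
  fix K assume K: "K \<subseteq> {1..2 * n}"
  have "vec_form z \<and>\<^sub>e (vec_form y \<and>\<^sub>e basis_form K) = (\<lambda>L. (-1) * (vec_form y \<and>\<^sub>e (vec_form z \<and>\<^sub>e basis_form K)) L)"
    unfolding wedge_assoc[symmetric] wedge_commute[OF homog_vec[OF assms(1)] homog_vec[OF assms(2)]]
    by (simp only: wedge_scale_left) simp
  then have "pr n \<alpha> (vec_form z \<and>\<^sub>e (vec_form y \<and>\<^sub>e basis_form K)) = - pr n \<alpha> (vec_form y \<and>\<^sub>e (vec_form z \<and>\<^sub>e basis_form K))"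
    by (simp add: pr_def sum_negf)
  then show "interior n y (interior n z \<alpha>) K = - interior n z (interior n y \<alpha>) K"
    by (simp add: pr_interior pr_basis_form[OF K])
qed

lemma interior_minterior:
  assumes "in_space n y" "\<And>z. z \<in> set ys \<Longrightarrow> in_space n z" "homog n (Suc p + length ys) \<alpha>"
  shows "interior n y (minterior n ys \<alpha>) = (\<lambda>K. (-1) ^ length ys * minterior n ys (interior n y \<alpha>) K)"
  using assms(2,3)
proof (induction ys arbitrary: \<alpha>)
  case (Cons z zs)
  have sc: "minterior n ws (\<lambda>K. - \<beta> K) = (\<lambda>K. - minterior n ws \<beta> K)" for ws \<beta>
  proof (induction ws arbitrary: \<beta>)
    case (Cons w ws)
    have "interior n w (\<lambda>K. - \<beta> K) = (\<lambda>K. - interior n w \<beta> K)"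
      by (simp add: interior_def sum_negf)
    then show ?case using Cons by (simp add: minterior_def)
  qed (simp add: minterior_def)
  have "interior n y (minterior n (z # zs) \<alpha>) = interior n y (minterior n zs (interior n z \<alpha>))"
    by (simp add: minterior_def)
  also have "\<dots> = (\<lambda>K. (-1) ^ length zs * minterior n zs (interior n y (interior n z \<alpha>)) K)"
    by (rule Cons.IH) (use Cons.prems in \<open>auto intro: homog_interior\<close>)
  also have "interior n y (interior n z \<alpha>) = (\<lambda>K. - interior n z (interior n y \<alpha>) K)"
    by (rule interior_anticommute[OF assms(1), of _ "p + length zs"]) (use Cons.prems in auto)
  finally show ?case by (simp add: sc) (simp add: minterior_def)
qed (simp add: minterior_def)

text \<open>The product of \<alpha> and \<beta> has degree \<open>2 * n + 1\<close> and vanishes, so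
  the two terms of the antiderivation rule cancel.\<close>

lemma top_interior:
  assumes "homog n p \<alpha>" "homog n q \<beta>" "p + q = Suc (2 * n)"
  shows "top_coeff n (interior n y \<alpha> \<and>\<^sub>e \<beta>) = (-1) ^ Suc p * top_coeff n (\<alpha> \<and>\<^sub>e interior n y \<beta>)"
proof -
  have "(\<alpha> \<and>\<^sub>e \<beta>) K = 0" for K
  proof (rule ccontr)
    assume "(\<alpha> \<and>\<^sub>e \<beta>) K \<noteq> 0"
    then have "K \<subseteq> {1..2 * n}" "card K = Suc (2 * n)" using homogD[OF homog_wedge[OF assms(1,2)]] assms(3) by auto
    then show False using card_mono[of "{1..2 * n}" K] by simp
  qed
  then have "interior n y (\<alpha> \<and>\<^sub>e \<beta>) {1..2 * n} = 0" by (simp add: interior_def)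
  then show ?thesis
    unfolding top_coeff_def interior_wedge[OF assms(1) subset_refl] by (simp add: add_eq_0_iff)
qed

lemma top_minterior:
  assumes "\<And>z. z \<in> set ys \<Longrightarrow> in_space n z"
    and "homog n (p + length ys) \<alpha>" "homog n q \<beta>" "p + q = 2 * n"
  shows "top_coeff n (minterior n ys \<alpha> \<and>\<^sub>e \<beta>) =
    (-1) ^ (length ys * Suc (p + length ys)) * top_coeff n (\<alpha> \<and>\<^sub>e minterior n ys \<beta>)"
  using assms
proof (induction ys arbitrary: \<alpha>)
  case Nil
  show ?case by (simp add: minterior_def)
next
  case (Cons y ys)
  let ?m = "length ys"
  show ?case
  proof (cases "q \<ge> Suc ?m")
    case True
    define q' where "q' = q - Suc ?m"
    have q: "q = Suc q' + ?m" using True by (simp add: q'_def)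
    have "top_coeff n (minterior n (y # ys) \<alpha> \<and>\<^sub>e \<beta>) = top_coeff n (minterior n ys (interior n y \<alpha>) \<and>\<^sub>e \<beta>)"
      by (simp add: minterior_def)
    also have "\<dots> = (-1) ^ (?m * Suc (p + ?m)) * top_coeff n (interior n y \<alpha> \<and>\<^sub>e minterior n ys \<beta>)"
      by (rule Cons.IH) (use Cons.prems in \<open>auto intro: homog_interior\<close>)
    also have "top_coeff n (interior n y \<alpha> \<and>\<^sub>e minterior n ys \<beta>) =
        (-1) ^ Suc (p + Suc ?m) * top_coeff n (\<alpha> \<and>\<^sub>e interior n y (minterior n ys \<beta>))"
      by (rule top_interior[of n _ _ "Suc q'"]) (use Cons.prems q in \<open>auto intro!: homog_minterior\<close>)
    also have "interior n y (minterior n ys \<beta>) = (\<lambda>K. (-1) ^ ?m * minterior n (y # ys) \<beta> K)"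
      by (subst interior_minterior[of n y ys q']) (use Cons.prems q in \<open>auto simp: minterior_def\<close>)
    finally have "top_coeff n (minterior n (y # ys) \<alpha> \<and>\<^sub>e \<beta>) =
       (-1) ^ (?m * Suc (p + ?m) + Suc (p + Suc ?m) + ?m) * top_coeff n (\<alpha> \<and>\<^sub>e minterior n (y # ys) \<beta>)"
      by (simp only: wedge_scale_right top_coeff_def power_add mult.assoc)
    also have "(-1) ^ (?m * Suc (p + ?m) + Suc (p + Suc ?m) + ?m) = ((-1) ^ (Suc ?m * Suc (p + Suc ?m)) :: complex)"
      by (rule arg_cong[of _ _ "power (-1)"]) simp
    finally show ?thesis by simp
  next
    case False
    have "interior n z (\<lambda>_. 0) = (\<lambda>_. 0)" for z by (simp add: interior_def)
    then have z: "minterior n ws (\<lambda>_. 0) = (\<lambda>_. 0)" for ws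
      by (induction ws) (simp_all add: minterior_def)
    \<comment> \<open>In this case the degree \<open>p + Suc ?m\<close> of \<alpha> exceeds
      2n.\<close>
    have "\<alpha> K = 0" for K
    proof (rule ccontr)
      assume "\<alpha> K \<noteq> 0"
      then have "K \<subseteq> {1..2 * n}" "card K = p + Suc ?m" using homogD[OF Cons.prems(2)] by auto
      then show False using card_mono[of "{1..2 * n}" K] Cons.prems(4) False by simp
    qed
    then have "\<alpha> = (\<lambda>_. 0)" by auto
    then show ?thesis by (simp add: z top_coeff_def)
  qed
qed

section \<open>The volume of a symplectic basis\<close>

fun wedge_power :: "form \<Rightarrow> nat \<Rightarrow> form" where
  "wedge_power \<alpha> 0 = basis_form {}"
| "wedge_power \<alpha> (Suc k) = wedge_power \<alpha> k \<and>\<^sub>e \<alpha>"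

fun wedge_prod :: "(nat \<Rightarrow> form) \<Rightarrow> nat \<Rightarrow> form" where
  "wedge_prod b 0 = basis_form {}"
| "wedge_prod b (Suc m) = wedge_prod b m \<and>\<^sub>e b (Suc m)"

lemma wedge_even_commute: "homog n p \<alpha> \<Longrightarrow> homog n 2 \<beta> \<Longrightarrow> \<beta> \<and>\<^sub>e \<alpha> = \<alpha> \<and>\<^sub>e \<beta>"
  using wedge_commute[of n p \<alpha> 2 \<beta>] by simp

text \<open>The binomial theorem for two-forms, which commute, cut off after the linear term because
  \<beta> squares to zero.\<close>

lemma wedge_power_add:
  assumes "homog n 2 \<alpha>" "homog n 2 \<beta>" "\<beta> \<and>\<^sub>e \<beta> = (\<lambda>_. 0)"
  shows "wedge_power (\<lambda>K. \<alpha> K + \<beta> K) (Suc k) = (\<lambda>K. wedge_power \<alpha> (Suc k) K + of_nat (Suc k) * (wedge_power \<alpha> k \<and>\<^sub>e \<beta>) K)"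
proof (induction k)
  case 0
  show ?case by (simp add: wedge_add_right)
next
  case (Suc k)
  have 1: "wedge_power \<alpha> k \<and>\<^sub>e \<beta> \<and>\<^sub>e \<beta> = (\<lambda>_. 0)"
    by (simp add: wedge_assoc assms(3))
  have 2: "wedge_power \<alpha> k \<and>\<^sub>e \<beta> \<and>\<^sub>e \<alpha> = wedge_power \<alpha> (Suc k) \<and>\<^sub>e \<beta>"
    by (simp add: wedge_assoc wedge_even_commute[OF assms(1,2)])
  have "wedge_power (\<lambda>K. \<alpha> K + \<beta> K) (Suc (Suc k)) =
      (\<lambda>K. wedge_power \<alpha> (Suc k) K + of_nat (Suc k) * (wedge_power \<alpha> k \<and>\<^sub>e \<beta>) K) \<and>\<^sub>e (\<lambda>K. \<alpha> K + \<beta> K)"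
    using Suc by simp
  also have "\<dots> = (\<lambda>K. (wedge_power \<alpha> (Suc k) \<and>\<^sub>e \<alpha>) K + (wedge_power \<alpha> (Suc k) \<and>\<^sub>e \<beta>) K +
      of_nat (Suc k) * (wedge_power \<alpha> (Suc k) \<and>\<^sub>e \<beta>) K)"
    unfolding wedge_add_right wedge_add_left wedge_scale_left 1 2 by (simp add: algebra_simps)
  finally show ?case by (simp add: algebra_simps)
qed

text \<open>In the m-th power of a sum of m commuting forms of square zero each form occurs exactly
  once, in any of m! orders; in a higher power some form is repeated. The induction needs both facts
  together.\<close>

lemma wedge_power_sum:
  assumes b: "\<And>i. homog n 2 (b i)" "\<And>i. b i \<and>\<^sub>e b i = (\<lambda>_. 0)"
  shows "wedge_power (\<lambda>K. \<Sum>i=1..m. b i K) m = (\<lambda>K. fact m * wedge_prod b m K)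
    \<and> (\<forall>k>m. wedge_power (\<lambda>K. \<Sum>i=1..m. b i K) k = (\<lambda>_. 0))"
proof (induction m)
  case 0
  have "wedge_power (\<lambda>_. 0) k = (\<lambda>_. 0)" if "k > 0" for k
    using that by (cases k) simp_all
  then show ?case by simp
next
  case (Suc m)
  let ?q = "\<lambda>K. \<Sum>i=1..m. b i K"
  have q: "(\<lambda>K. \<Sum>i=1..Suc m. b i K) = (\<lambda>K. ?q K + b (Suc m) K)" by simp
  have step: "wedge_power (\<lambda>K. \<Sum>i=1..Suc m. b i K) (Suc k) =
      (\<lambda>K. wedge_power ?q (Suc k) K + of_nat (Suc k) * (wedge_power ?q k \<and>\<^sub>e b (Suc m)) K)" for k
    unfolding q by (rule wedge_power_add) (use b in \<open>auto intro: homog_sum\<close>)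
  have IH: "wedge_power ?q m = (\<lambda>K. fact m * wedge_prod b m K)" "\<And>k. k > m \<Longrightarrow> wedge_power ?q k = (\<lambda>_. 0)"
    using Suc by blast+
  have "wedge_power (\<lambda>K. \<Sum>i=1..Suc m. b i K) (Suc m) = (\<lambda>K. fact (Suc m) * wedge_prod b (Suc m) K)"
    unfolding step IH(1) IH(2)[OF lessI] wedge_scale_left by (simp add: mult.assoc)
  moreover have "wedge_power (\<lambda>K. \<Sum>i=1..Suc m. b i K) k = (\<lambda>_. 0)" if "k > Suc m" for k
  proof -
    obtain k' where "k = Suc k'" "k' > m" using \<open>k > Suc m\<close> by (metis Suc_lessE)
    then show ?thesis
      unfolding \<open>k = Suc k'\<close> step IH(2)[OF \<open>k' > m\<close>] IH(2)[OF less_SucI[OF \<open>k' > m\<close>]] by simp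
  qed
  ultimately show ?case by blast
qed

lemma vec_wedge_form: "finite K \<Longrightarrow> (vec_form y \<and>\<^sub>e \<beta>) K = (\<Sum>a\<in>K. y a * shuffle_sign {a} (K - {a}) * \<beta> (K - {a}))"
proof -
  assume "finite K"
  then have "(vec_form y \<and>\<^sub>e \<beta>) K = (\<Sum>I\<in>(\<lambda>a. {a}) ` K. shuffle_sign I (K - I) * vec_form y I * \<beta> (K - I))"
    unfolding wedge_def by (intro sum.mono_neutral_right) (auto simp: vec_form_def card_1_singleton_iff)
  also have "\<dots> = (\<Sum>a\<in>K. y a * shuffle_sign {a} (K - {a}) * \<beta> (K - {a}))"
    by (subst sum.reindex) (auto simp: vec_form_def mult_ac)
  finally show ?thesis .
qed

lemma vec_wedge_vec: "a < b \<Longrightarrow> (vec_form x \<and>\<^sub>e vec_form y) {a, b} = x a * y b - x b * y a"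
proof -
  assume ab: "a < b"
  have "{(i, j). i \<in> {a} \<and> j \<in> {b} \<and> j < i} = {}" "{(i, j). i \<in> {b} \<and> j \<in> {a} \<and> j < i} = {(b, a)}"
    using ab by auto
  then have "shuffle_sign {a} {b} = 1" "shuffle_sign {b} {a} = -1" by (simp_all only: shuffle_sign_def) simp_all
  moreover have "{a, b} - {a} = {b}" "{a, b} - {b} = {a}" using ab by auto
  moreover have "vec_form y {c} = y c" for c by (simp add: vec_form_def)
  ultimately show ?thesis using ab by (simp add: vec_wedge_form)
qed

lemma vec_wedge_self: "in_space n x \<Longrightarrow> vec_form x \<and>\<^sub>e vec_form x = (\<lambda>_. 0)"
proof
  fix K assume "in_space n x"
  then have "(vec_form x \<and>\<^sub>e vec_form x) K = - (vec_form x \<and>\<^sub>e vec_form x) K"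
    using fun_cong[OF wedge_commute[OF homog_vec homog_vec, of n x x], of K] by simp
  then show "(vec_form x \<and>\<^sub>e vec_form x) K = 0" by (simp add: eq_neg_iff_add_eq_0)
qed

text \<open>A summand of the bivector dual to the symplectic form, written in the basis u. The sum
  over i is the same for all symplectic bases, and up to a sign common to all bases its n-th power
  is n! times the volume of the basis. This gives volume 1 by comparison with the standard
  basis.\<close>

definition hyperbolic :: "nat \<Rightarrow> (nat \<Rightarrow> nat \<Rightarrow> complex) \<Rightarrow> nat \<Rightarrow> form" where
  "hyperbolic n u i = (\<lambda>K. (-1) ^ (i - 1) * (vec_form (u i) \<and>\<^sub>e vec_form (u (2 * n + 1 - i))) K)"

lemma homog_hyperbolic: "(\<And>i. in_space n (u i)) \<Longrightarrow> homog n 2 (hyperbolic n u i)"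
  unfolding hyperbolic_def using homog_scale[OF homog_wedge[OF homog_vec homog_vec], of n] by (simp add: numeral_2_eq_2)

lemma hyperbolic_square: 
  assumes "\<And>i. in_space n (u i)"
  shows "hyperbolic n u i \<and>\<^sub>e hyperbolic n u i = (\<lambda>_. 0)"
proof -
  let ?x = "vec_form (u i)" and ?y = "vec_form (u (2 * n + 1 - i))"
  have h: "homog n 2 (?x \<and>\<^sub>e ?y)"
    using homog_wedge[OF homog_vec[OF assms] homog_vec[OF assms]] by (simp add: numeral_2_eq_2)
  have "?x \<and>\<^sub>e ?y \<and>\<^sub>e (?x \<and>\<^sub>e ?y) = ?x \<and>\<^sub>e (?y \<and>\<^sub>e (?x \<and>\<^sub>e ?y))" by (rule wedge_assoc)
  also have "?y \<and>\<^sub>e (?x \<and>\<^sub>e ?y) = ?x \<and>\<^sub>e ?y \<and>\<^sub>e ?y" by (rule wedge_even_commute[OF homog_vec[OF assms] h, symmetric])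
  also have "\<dots> = (\<lambda>_. 0)" unfolding wedge_assoc vec_wedge_self[OF assms] by simp
  finally show ?thesis unfolding hyperbolic_def wedge_scale_left wedge_scale_right by simp
qed

text \<open>Each new pair is inserted in the middle, which costs no sign as two-forms commute.\<close>

lemma wedge_prod_hyperbolic:
  assumes u: "\<And>i. in_space n (u i)"
  shows "m \<le> n \<Longrightarrow> wedge_prod (hyperbolic n u) m =
    (\<lambda>K. (\<Prod>i=1..m. (-1) ^ (i - 1)) * vwedge (map u [1..<Suc m] @ map u [2 * n + 1 - m..<Suc (2 * n)]) K)"
proof (induction m)
  case (Suc m)
  let ?X = "vwedge (map u [1..<Suc m])" and ?Y = "vwedge (map u [2 * n + 1 - m..<Suc (2 * n)])"
  let ?x = "vec_form (u (Suc m))" and ?y = "vec_form (u (2 * n - m))"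
  have hY: "homog n m ?Y"
    using homog_vwedge[of "map u [2 * n + 1 - m..<Suc (2 * n)]" n] u Suc.prems by (auto simp del: upt_Suc)
  have h: "homog n 2 (?x \<and>\<^sub>e ?y)"
    using homog_wedge[OF homog_vec[OF u] homog_vec[OF u]] by (simp add: numeral_2_eq_2)
  have e: "[2 * n + 1 - Suc m..<Suc (2 * n)] = (2 * n - m) # [2 * n + 1 - m..<Suc (2 * n)]"
    using Suc.prems by (subst upt_conv_Cons) (auto simp: Suc_diff_le simp del: upt_Suc)
  have "vwedge (map u [1..<Suc m] @ map u [2 * n + 1 - m..<Suc (2 * n)]) \<and>\<^sub>e (?x \<and>\<^sub>e ?y) = ?X \<and>\<^sub>e (?Y \<and>\<^sub>e (?x \<and>\<^sub>e ?y))"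
    by (subst vwedge_append[of _ n]) (use u in \<open>auto simp: wedge_assoc simp del: upt_Suc\<close>)
  also have "?Y \<and>\<^sub>e (?x \<and>\<^sub>e ?y) = ?x \<and>\<^sub>e ?y \<and>\<^sub>e ?Y" by (rule wedge_even_commute[OF hY h, symmetric])
  also have "?X \<and>\<^sub>e (?x \<and>\<^sub>e ?y \<and>\<^sub>e ?Y) = vwedge (map u [1..<Suc m] @ (map u [Suc m..<Suc (Suc m)] @ map u [2 * n + 1 - Suc m..<Suc (2 * n)]))"
  proof -
    have "map u [Suc m..<Suc (Suc m)] = [u (Suc m)]" by simp
    then show ?thesis
      unfolding e by (subst vwedge_append[of _ n]) (use u in \<open>auto simp: wedge_assoc simp del: upt_Suc\<close>)
  qed
  also have "\<dots> = vwedge (map u [1..<Suc (Suc m)] @ map u [2 * n + 1 - Suc m..<Suc (2 * n)])"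
    by simp
  finally have *: "vwedge (map u [1..<Suc m] @ map u [2 * n + 1 - m..<Suc (2 * n)]) \<and>\<^sub>e (?x \<and>\<^sub>e ?y) =
     vwedge (map u [1..<Suc (Suc m)] @ map u [2 * n + 1 - Suc m..<Suc (2 * n)])" .
  have s: "2 * n + 1 - Suc m = 2 * n - m" by simp
  have "wedge_prod (hyperbolic n u) (Suc m) = wedge_prod (hyperbolic n u) m \<and>\<^sub>e hyperbolic n u (Suc m)" by simp
  also have "\<dots> = (\<lambda>K. (-1) ^ m * ((\<Prod>i=1..m. (-1) ^ (i - 1)) * vwedge (map u [1..<Suc (Suc m)] @ map u [2 * n + 1 - Suc m..<Suc (2 * n)]) K))"
    unfolding Suc.IH[OF Suc_leD[OF Suc.prems]] hyperbolic_def s wedge_scale_left wedge_scale_right *[unfolded s]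
    by (simp add: mult.left_commute del: upt_Suc)
  moreover have "(\<Prod>i=1..Suc m. (-1) ^ (i - 1)) = ((-1) ^ m * (\<Prod>i=1..m. (-1) ^ (i - 1)) :: complex)"
    by simp
  ultimately show ?case by (simp only: mult.assoc)
qed simp

lemma basis_form_wedge_Suc: "basis_form {1..a} \<and>\<^sub>e vec_form (\<lambda>k. if k = Suc a then 1 else 0) = basis_form {1..Suc a}"
proof
  fix K
  let ?v = "vec_form (\<lambda>k. if k = Suc a then 1 else 0)"
  have v: "?v J = (if J = {Suc a} then 1 else 0)" for J
    by (auto simp: vec_form_def card_1_singleton_iff)
  show "(basis_form {1..a} \<and>\<^sub>e ?v) K = basis_form {1..Suc a} K"
  proof (cases "finite K")
    case True
    have "(basis_form {1..a} \<and>\<^sub>e ?v) K = (\<Sum>I\<in>Pow K. if I = {1..a} then (if K = {1..Suc a} then 1 else 0) else 0)"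
      unfolding wedge_def
    proof (rule sum.cong[OF refl])
      fix I assume I: "I \<in> Pow K"
      have "{(i, j). i \<in> {1..a} \<and> j \<in> {Suc a} \<and> j < i} = {}" by auto
      then have s: "shuffle_sign {1..a} {Suc a} = 1" unfolding shuffle_sign_def by (metis card.empty power_0)
      have "K - {1..a} = {Suc a} \<longleftrightarrow> K = {1..Suc a}" if "{1..a} \<subseteq> K"
        using that by (auto simp: atLeastAtMostSuc_conv)
      then show "shuffle_sign I (K - I) * basis_form {1..a} I * ?v (K - I) =
          (if I = {1..a} then (if K = {1..Suc a} then 1 else 0) else 0)"
        using I s by (auto simp: basis_form_def v)
    qed
    also have "\<dots> = basis_form {1..Suc a} K"
      using True by (auto simp: basis_form_def sum.delta)
    finally show ?thesis .
  qed (auto simp: basis_form_def)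
qed

definition std_basis :: "nat \<Rightarrow> nat \<Rightarrow> nat \<Rightarrow> complex" where
  "std_basis n i = (\<lambda>a. if a = i \<and> i \<in> {1..2 * n} then 1 else 0)"

lemma flag_form_std_basis: "a \<le> 2 * n \<Longrightarrow> flag_form (std_basis n) a = basis_form {1..a}"
proof (induction a)
  case (Suc a)
  have "std_basis n (Suc a) = (\<lambda>k. if k = Suc a then 1 else 0)"
    using Suc.prems by (auto simp: std_basis_def)
  then show ?case using Suc by (simp only: flag_form.simps Suc_leD basis_form_wedge_Suc)
qed simp

lemma symplectic_std_basis: "symplectic_basis n (std_basis n)"
  unfolding symplectic_basis_def
proof (intro conjI ballI impI allI)
  fix i j assume ij: "i \<in> {1..2 * n}" "j \<in> {1..2 * n}" "i < j"
  have "symplectic_form n (std_basis n i) (std_basis n j) = (\<Sum>k=1..n. if k = i then (if i + j = 2 * n + 1 then (-1) ^ (i - 1) else 0) else 0)"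
    unfolding symplectic_form_def
  proof (rule sum.cong[OF refl])
    fix k assume "k \<in> {1..n}"
    then show "(-1) ^ (k - 1) * (std_basis n i k * std_basis n j (2 * n + 1 - k) - std_basis n i (2 * n + 1 - k) * std_basis n j k) =
       (if k = i then (if i + j = 2 * n + 1 then (-1) ^ (i - 1) else 0) else 0)"
      using ij by (auto simp: std_basis_def)
  qed
  also have "\<dots> = (if i + j = 2 * n + 1 then (-1) ^ (i - 1) else 0)"
    using ij by (auto simp: sum.delta)
  finally show "symplectic_form n (std_basis n i) (std_basis n j) = (if i + j = 2 * n + 1 then (-1) ^ (i - 1) else 0)" .
qed (auto simp: std_basis_def split: if_splits)

text \<open>The assumption \<open>biv\<close> says that the bivectors of u and of the standard basis
  have the same coordinates. Their n-th powers then agree, and the nonzero factor in front of the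
  volumes cancels.\<close>

lemma top_flag_form:
  assumes u: "\<And>i. in_space n (u i)"
    and biv: "\<And>a b. 1 \<le> a \<Longrightarrow> a < b \<Longrightarrow> b \<le> 2 * n \<Longrightarrow>
      (\<Sum>i=1..n. (-1) ^ (i - 1) * (u i a * u (2 * n + 1 - i) b - u i b * u (2 * n + 1 - i) a)) =
      (\<Sum>i=1..n. (-1) ^ (i - 1) * (std_basis n i a * std_basis n (2 * n + 1 - i) b - std_basis n i b * std_basis n (2 * n + 1 - i) a))"
  shows "top_coeff n (flag_form u (2 * n)) = 1"
proof -
  let ?e = "std_basis n"
  have e: "in_space n (?e i)" for i by (auto simp: in_space_def std_basis_def split: if_splits)
  have eval: "(\<Sum>i=1..n. hyperbolic n w i {a, b}) = (\<Sum>i=1..n. (-1) ^ (i - 1) * (w i a * w (2 * n + 1 - i) b - w i b * w (2 * n + 1 - i) a))"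
    if "a < b" for w a b
    unfolding hyperbolic_def vec_wedge_vec[OF that] by simp
  have "(\<lambda>K. \<Sum>i=1..n. hyperbolic n u i K) = (\<lambda>K. \<Sum>i=1..n. hyperbolic n ?e i K)"
  proof
    fix K
    have h: "homog n 2 (\<lambda>K. \<Sum>i=1..n. hyperbolic n w i K)" if "\<And>i. in_space n (w i)" for w
      by (intro homog_sum homog_hyperbolic that)
    show "(\<Sum>i=1..n. hyperbolic n u i K) = (\<Sum>i=1..n. hyperbolic n ?e i K)"
    proof (cases "K \<subseteq> {1..2 * n} \<and> card K = 2")
      case True
      then obtain a b where "K = {a, b}" "a \<noteq> b" by (auto simp: card_2_iff)
      then obtain a b where ab: "K = {a, b}" "a < b" by (metis insert_commute linorder_neqE_nat)
      then show ?thesis unfolding ab(1) eval[OF ab(2)] using True ab by (intro biv) auto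
    next
      case False
      then show ?thesis using homogD[OF h[of u, OF u], where K = K] homogD[OF h[of ?e, OF e], where K = K] by metis
    qed
  qed
  then have "wedge_power (\<lambda>K. \<Sum>i=1..n. hyperbolic n u i K) n = wedge_power (\<lambda>K. \<Sum>i=1..n. hyperbolic n ?e i K) n" by simp
  moreover have "wedge_power (\<lambda>K. \<Sum>i=1..n. hyperbolic n w i K) n =
      (\<lambda>K. fact n * ((\<Prod>i=1..n. (-1) ^ (i - 1)) * flag_form w (2 * n) K))" if w: "\<And>i. in_space n (w i)" for w
  proof -
    have "[1..<Suc n] @ [2 * n + 1 - n..<Suc (2 * n)] = [1..<Suc (2 * n)]"
      using upt_add_eq_append[of 1 "Suc n" n] by (simp add: mult_2 del: upt_Suc)
    then have "map w [1..<Suc n] @ map w [2 * n + 1 - n..<Suc (2 * n)] = map w [1..<Suc (2 * n)]"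
      by (metis map_append)
    then show ?thesis
      using conjunct1[OF wedge_power_sum[of n "hyperbolic n w" n]] homog_hyperbolic[of n w] hyperbolic_square[of n w] w
      by (simp add: wedge_prod_hyperbolic[OF w] flag_form_vwedge[OF w] del: upt_Suc)
  qed
  ultimately have "(\<lambda>K. fact n * ((\<Prod>i=1..n. (-1) ^ (i - 1)) * flag_form u (2 * n) K)) =
     (\<lambda>K. fact n * ((\<Prod>i=1..n. (-1) ^ (i - 1)) * flag_form ?e (2 * n) K :: complex))"
    using u e by simp
  from fun_cong[OF this, of "{1..2 * n}"] show ?thesis
    by (simp add: top_coeff_def flag_form_std_basis basis_form_def)
qed

section \<open>Minors\<close>

lemma right_inverse_of_left_inverse:
  fixes A B :: "nat \<Rightarrow> nat \<Rightarrow> complex"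
  assumes "\<And>k l. k < N \<Longrightarrow> l < N \<Longrightarrow> (\<Sum>b<N. A k b * B b l) = (if k = l then 1 else 0)"
    and "a < N" "b < N"
  shows "(\<Sum>k<N. B a k * A k b) = (if a = b then 1 else 0)"
proof -
  let ?A = "mat N N (\<lambda>(i, j). A i j)" and ?B = "mat N N (\<lambda>(i, j). B i j)"
  have "?A * ?B = 1\<^sub>m N"
    by (rule eq_matI) (auto simp: scalar_prod_def assms(1) lessThan_atLeast0[symmetric])
  then have "?B * ?A = 1\<^sub>m N"
    by (intro mat_mult_left_right_inverse[of ?A N ?B]) auto
  then have "(?B * ?A) $$ (a, b) = 1\<^sub>m N $$ (a, b)" by simp
  then show ?thesis
    using assms(2,3) by (simp add: scalar_prod_def lessThan_atLeast0[symmetric])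
qed

text \<open>Rows and columns are given by lists of labels, so that blocks can be appended, moved and
  split off by list operations. The size is that of the row list; the rules therefore ask for lists
  of matching lengths.\<close>

definition minor :: "('r \<Rightarrow> 'c \<Rightarrow> complex) \<Rightarrow> 'r list \<Rightarrow> 'c list \<Rightarrow> complex" where
  "minor m rs cs = det (mat (length rs) (length rs) (\<lambda>(i, j). m (rs ! i) (cs ! j)))"

lemma minor_cong:
  assumes "length rs = length cs" "\<And>r c. r \<in> set rs \<Longrightarrow> c \<in> set cs \<Longrightarrow> m r c = m' r c"
  shows "minor m rs cs = minor m' rs cs"
  unfolding minor_def by (rule arg_cong[of _ _ det], rule eq_matI) (use assms in auto)

lemma minor_Nil [simp]: "minor m [] [] = 1"
  by (simp add: minor_def)

lemma minor_transpose: "length rs = length cs \<Longrightarrow> minor m rs cs = minor (\<lambda>c r. m r c) cs rs"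
proof -
  assume l: "length rs = length cs"
  let ?M = "mat (length rs) (length rs) (\<lambda>(i, j). m (rs ! i) (cs ! j))"
  have "minor m rs cs = det (transpose_mat ?M)"
    unfolding minor_def by (rule det_transpose[symmetric]) auto
  also have "transpose_mat ?M = mat (length cs) (length cs) (\<lambda>(i, j). m (rs ! j) (cs ! i))"
    by (rule eq_matI) (use l in auto)
  finally show ?thesis unfolding minor_def .
qed

lemma minor_Cons:
  assumes "length rs = Suc (length cs)"
  shows "minor m rs (c # cs) =
    (\<Sum>i<length rs. (-1) ^ i * m (rs ! i) c * minor m (take i rs @ drop (Suc i) rs) cs)"
proof -
  let ?M = "mat (length rs) (length rs) (\<lambda>(i, j). m (rs ! i) ((c # cs) ! j))"
  have "minor m rs (c # cs) = (\<Sum>i<length rs. ?M $$ (i, 0) * cofactor ?M i 0)"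
    unfolding minor_def by (rule laplace_expansion_column) (use assms in auto)
  also have "\<dots> = (\<Sum>i<length rs. (-1) ^ i * m (rs ! i) c * minor m (take i rs @ drop (Suc i) rs) cs)"
  proof (rule sum.cong[OF refl])
    fix i assume i: "i \<in> {..<length rs}"
    have "mat_delete ?M i 0 = mat (length cs) (length cs) (\<lambda>(k, j). m ((take i rs @ drop (Suc i) rs) ! k) (cs ! j))"
    proof (rule eq_matI)
      fix k j assume kj: "k < dim_row (mat (length cs) (length cs) (\<lambda>(k, j). m ((take i rs @ drop (Suc i) rs) ! k) (cs ! j)))"
        "j < dim_col (mat (length cs) (length cs) (\<lambda>(k, j). m ((take i rs @ drop (Suc i) rs) ! k) (cs ! j)))"
      then have "mat_delete ?M i 0 $$ (k, j) = ?M $$ (if k < i then k else Suc k, Suc j)"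
        using assms by (simp add: mat_delete_def)
      moreover have "(take i rs @ drop (Suc i) rs) ! k = rs ! (if k < i then k else Suc k)"
        using i kj assms by (auto simp: nth_append)
      ultimately show "mat_delete ?M i 0 $$ (k, j) =
        mat (length cs) (length cs) (\<lambda>(k, j). m ((take i rs @ drop (Suc i) rs) ! k) (cs ! j)) $$ (k, j)"
        using kj assms by auto
    qed (use assms in auto)
    then show "?M $$ (i, 0) * cofactor ?M i 0 = (-1) ^ i * m (rs ! i) c * minor m (take i rs @ drop (Suc i) rs) cs"
      using i assms unfolding minor_def cofactor_def by (simp add: min_def)
  qed
  finally show ?thesis .
qed

lemma minor_swap:
  assumes "length (rs1 @ x # y # rs2) = length cs"
  shows "minor m (rs1 @ x # y # rs2) cs = - minor m (rs1 @ y # x # rs2) cs"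
proof -
  let ?k = "length rs1" and ?N = "length (rs1 @ x # y # rs2)"
  let ?M = "mat ?N ?N (\<lambda>(i, j). m ((rs1 @ x # y # rs2) ! i) (cs ! j))"
  have "mat (length (rs1 @ y # x # rs2)) (length (rs1 @ y # x # rs2)) (\<lambda>(i, j). m ((rs1 @ y # x # rs2) ! i) (cs ! j)) = swaprows ?k (Suc ?k) ?M"
  proof (rule eq_matI)
    fix i j assume "i < dim_row (swaprows ?k (Suc ?k) ?M)" "j < dim_col (swaprows ?k (Suc ?k) ?M)"
    then have ij: "i < ?N" "j < ?N" by auto
    consider "i < ?k" | "i = ?k" | "i = Suc ?k" | l where "i = Suc (Suc ?k) + l"
      by (metis le_Suc_ex less_Suc_eq not_less_eq le_neq_implies_less linorder_le_less_linear Suc_leI)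
    then show "mat (length (rs1 @ y # x # rs2)) (length (rs1 @ y # x # rs2)) (\<lambda>(i, j). m ((rs1 @ y # x # rs2) ! i) (cs ! j)) $$ (i, j) = swaprows ?k (Suc ?k) ?M $$ (i, j)"
      using ij by cases (auto simp: nth_append)
  qed auto
  moreover have "det (swaprows ?k (Suc ?k) ?M) = - det ?M"
    by (rule det_swaprows[of _ ?N]) auto
  ultimately show ?thesis
    unfolding minor_def by simp
qed

lemma minor_move:
  "length (rs1 @ x # rs2 @ rs3) = length cs \<Longrightarrow>
    minor m (rs1 @ x # rs2 @ rs3) cs = (-1) ^ length rs2 * minor m (rs1 @ rs2 @ x # rs3) cs"
proof (induction rs2 arbitrary: rs1)
  case (Cons y rs2)
  have "minor m (rs1 @ x # (y # rs2) @ rs3) cs = - minor m ((rs1 @ [y]) @ x # rs2 @ rs3) cs"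
    using minor_swap[of rs1 x y "rs2 @ rs3" cs m] Cons.prems by simp
  also have "minor m ((rs1 @ [y]) @ x # rs2 @ rs3) cs = (-1) ^ length rs2 * minor m ((rs1 @ [y]) @ rs2 @ x # rs3) cs"
    by (rule Cons.IH) (use Cons.prems in simp)
  finally show ?case by simp
qed simp

lemma minor_swap_blocks:
  "length (rs1 @ rs2 @ rs3 @ rs4) = length cs \<Longrightarrow>
    minor m (rs1 @ rs2 @ rs3 @ rs4) cs = (-1) ^ (length rs2 * length rs3) * minor m (rs1 @ rs3 @ rs2 @ rs4) cs"
proof (induction rs2 arbitrary: rs1)
  case (Cons x rs2)
  have "minor m (rs1 @ (x # rs2) @ rs3 @ rs4) cs = minor m ((rs1 @ [x]) @ rs2 @ rs3 @ rs4) cs" by simp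
  also have "\<dots> = (-1) ^ (length rs2 * length rs3) * minor m ((rs1 @ [x]) @ rs3 @ rs2 @ rs4) cs"
    by (rule Cons.IH) (use Cons.prems in simp)
  also have "minor m ((rs1 @ [x]) @ rs3 @ rs2 @ rs4) cs = (-1) ^ length rs3 * minor m (rs1 @ rs3 @ x # rs2 @ rs4) cs"
    using minor_move[of rs1 x rs3 "rs2 @ rs4" cs m] Cons.prems by simp
  finally show ?case by (simp add: power_add)
qed simp

lemma minor_swap_blocks_cols:
  assumes "length rs = length (cs1 @ cs2 @ cs3 @ cs4)"
  shows "minor m rs (cs1 @ cs2 @ cs3 @ cs4) = (-1) ^ (length cs2 * length cs3) * minor m rs (cs1 @ cs3 @ cs2 @ cs4)"
  using minor_swap_blocks[of cs1 cs2 cs3 cs4 rs "\<lambda>c r. m r c"] assms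
  by (simp add: minor_transpose[of rs _ m])

lemma minor_block_upper:
  assumes "length r1 = length c1" "length r2 = length c2" "\<And>r c. r \<in> set r2 \<Longrightarrow> c \<in> set c1 \<Longrightarrow> m r c = 0"
  shows "minor m (r1 @ r2) (c1 @ c2) = minor m r1 c1 * minor m r2 c2"
  using assms(1,3)
proof (induction c1 arbitrary: r1)
  case (Cons c c1)
  have "minor m (r1 @ r2) ((c # c1) @ c2) =
      (\<Sum>i<length r1 + length r2. (-1) ^ i * m ((r1 @ r2) ! i) c * minor m (take i (r1 @ r2) @ drop (Suc i) (r1 @ r2)) (c1 @ c2))"
    using minor_Cons[of "r1 @ r2" "c1 @ c2" m c] Cons.prems(1) assms(2) by simp
  also have "\<dots> = (\<Sum>i<length r1. (-1) ^ i * m ((r1 @ r2) ! i) c * minor m (take i (r1 @ r2) @ drop (Suc i) (r1 @ r2)) (c1 @ c2))"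
    by (rule sum.mono_neutral_right) (use Cons.prems(2) in \<open>auto simp: nth_append\<close>)
  also have "\<dots> = (\<Sum>i<length r1. (-1) ^ i * m (r1 ! i) c * minor m (take i r1 @ drop (Suc i) r1) c1 * minor m r2 c2)"
  proof (rule sum.cong[OF refl])
    fix i assume i: "i \<in> {..<length r1}"
    have "minor m ((take i r1 @ drop (Suc i) r1) @ r2) (c1 @ c2) = minor m (take i r1 @ drop (Suc i) r1) c1 * minor m r2 c2"
      by (rule Cons.IH) (use Cons.prems i in auto)
    then show "(-1) ^ i * m ((r1 @ r2) ! i) c * minor m (take i (r1 @ r2) @ drop (Suc i) (r1 @ r2)) (c1 @ c2) =
      (-1) ^ i * m (r1 ! i) c * minor m (take i r1 @ drop (Suc i) r1) c1 * minor m r2 c2"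
      using i by (simp add: nth_append)
  qed
  also have "\<dots> = minor m r1 (c # c1) * minor m r2 c2"
    by (subst minor_Cons) (use Cons.prems(1) in \<open>simp_all only: sum_distrib_right length_Cons\<close>)
  finally show ?case .
qed simp

lemma minor_block_lower:
  assumes "length r1 = length c1" "length r2 = length c2" "\<And>r c. r \<in> set r1 \<Longrightarrow> c \<in> set c2 \<Longrightarrow> m r c = 0"
  shows "minor m (r1 @ r2) (c1 @ c2) = minor m r1 c1 * minor m r2 c2"
  using minor_block_upper[of c1 r1 c2 r2 "\<lambda>c r. m r c"] assms
  by (simp add: minor_transpose[of _ _ m])

text \<open>The matrix is multiplied from the left by a lower unitriangular matrix whose entries
  below the diagonal are the coefficients \<open>lam\<close>.\<close>

lemma minor_row_operation:
  assumes len: "length (vs @ ws) = length cs"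
    and v: "\<And>v c. v \<in> set vs \<Longrightarrow> c \<in> set cs \<Longrightarrow> m' v c = m v c"
    and w: "\<And>w c. w \<in> set ws \<Longrightarrow> c \<in> set cs \<Longrightarrow> m' w c = m w c + (\<Sum>i<length vs. lam w i * m (vs ! i) c)"
  shows "minor m' (vs @ ws) cs = minor m (vs @ ws) cs"
proof -
  let ?N = "length (vs @ ws)" and ?k = "length vs"
  let ?M = "mat ?N ?N (\<lambda>(i, j). m ((vs @ ws) ! i) (cs ! j))"
  let ?E = "mat ?N ?N (\<lambda>(i, j). (if i = j then 1 else 0) + (if \<not> i < ?k \<and> j < ?k then lam (ws ! (i - ?k)) j else 0))"
  have "det ?E = prod_list (diag_mat ?E)"
    by (rule det_lower_triangular[of ?N]) auto
  also have "diag_mat ?E = map (\<lambda>_. 1) [0..<?N]"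
    by (auto simp: diag_mat_def)
  finally have E: "det ?E = 1" by (simp add: map_replicate_const del: length_append)
  have "mat ?N ?N (\<lambda>(i, j). m' ((vs @ ws) ! i) (cs ! j)) = ?E * ?M"
  proof (rule eq_matI)
    fix i j assume "i < dim_row (?E * ?M)" "j < dim_col (?E * ?M)"
    then have ij: "i < ?N" "j < ?N" by auto
    then have c: "cs ! j \<in> set cs" using len by auto
    have "(?E * ?M) $$ (i, j) = (\<Sum>l<?N. ((if i = l then 1 else 0) + (if \<not> i < ?k \<and> l < ?k then lam (ws ! (i - ?k)) l else 0)) * m ((vs @ ws) ! l) (cs ! j))"
      using ij by (simp add: scalar_prod_def lessThan_atLeast0[symmetric] del: length_append)
    also have "\<dots> = (\<Sum>l<?N. if i = l then m ((vs @ ws) ! l) (cs ! j) else 0) +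
        (\<Sum>l<?N. if l < ?k then (if \<not> i < ?k then lam (ws ! (i - ?k)) l else 0) * m (vs ! l) (cs ! j) else 0)"
      unfolding sum.distrib[symmetric] by (intro sum.cong) (auto simp: nth_append distrib_right)
    also have "(\<Sum>l<?N. if l < ?k then (if \<not> i < ?k then lam (ws ! (i - ?k)) l else 0) * m (vs ! l) (cs ! j) else 0) =
        (\<Sum>l<?k. (if \<not> i < ?k then lam (ws ! (i - ?k)) l else 0) * m (vs ! l) (cs ! j))"
      by (rule sum.mono_neutral_cong_right) auto
    finally show "mat ?N ?N (\<lambda>(i, j). m' ((vs @ ws) ! i) (cs ! j)) $$ (i, j) = (?E * ?M) $$ (i, j)"
      using ij v[OF _ c, of "vs ! i"] w[OF _ c, of "ws ! (i - ?k)"] by (auto simp: nth_append)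
  qed auto
  then show ?thesis
    unfolding minor_def using E det_mult[of ?E ?N ?M] by simp
qed

lemma minor_column_operation:
  assumes len: "length rs = length (vs @ ws)"
    and v: "\<And>r v. r \<in> set rs \<Longrightarrow> v \<in> set vs \<Longrightarrow> m' r v = m r v"
    and w: "\<And>r w. r \<in> set rs \<Longrightarrow> w \<in> set ws \<Longrightarrow> m' r w = m r w + (\<Sum>i<length vs. lam w i * m r (vs ! i))"
  shows "minor m' rs (vs @ ws) = minor m rs (vs @ ws)"
  unfolding minor_transpose[OF len] by (rule minor_row_operation[of _ _ _ _ _ lam]) (use assms in auto)

text \<open>The coefficients come from an inverse of the matrix with rows R and columns C.\<close>

lemma row_combination:
  assumes "length R = length C" "minor m R C \<noteq> 0"
  shows "\<exists>lam. \<forall>c\<in>set C. m x c = (\<Sum>i<length R. lam i * m (R ! i) c)"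
proof -
  let ?N = "length R"
  let ?M = "mat ?N ?N (\<lambda>(i, j). m (R ! i) (C ! j))"
  obtain L where L: "L \<in> carrier_mat ?N ?N" "L * ?M = 1\<^sub>m ?N"
    using det_non_zero_imp_unit[of ?M ?N] assms(2) unfolding minor_def Units_def
    by (auto simp: ring_mat_def)
  define lam where "lam = (\<lambda>i. \<Sum>j<?N. m x (C ! j) * L $$ (j, i))"
  have "m x (C ! l) = (\<Sum>i<?N. lam i * m (R ! i) (C ! l))" if l: "l < ?N" for l
  proof -
    have "(\<Sum>i<?N. lam i * m (R ! i) (C ! l)) = (\<Sum>j<?N. m x (C ! j) * (\<Sum>i<?N. L $$ (j, i) * m (R ! i) (C ! l)))"
      unfolding lam_def sum_distrib_left sum_distrib_right mult.assoc by (rule sum.swap)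
    also have "\<dots> = (\<Sum>j<?N. m x (C ! j) * (L * ?M) $$ (j, l))"
      using l L(1) by (intro sum.cong) (auto simp: scalar_prod_def lessThan_atLeast0[symmetric])
    also have "\<dots> = (\<Sum>j<?N. if j = l then m x (C ! j) else 0)"
      unfolding L(2) using l by (intro sum.cong) auto
    also have "\<dots> = m x (C ! l)" using l by simp
    finally show ?thesis by (rule sym)
  qed
  then show ?thesis
    unfolding assms(1) all_set_conv_all_nth by (intro exI[of _ lam]) auto
qed

lemma minor_1: "minor m [x] [p] = m x p"
  using minor_Cons[of "[x]" "[]" m p] by simp

lemma minor_2: "minor m [x, y] [p, q] = m x p * m y q - m y p * m x q"
  using minor_Cons[of "[x, y]" "[q]" m p] by (simp add: minor_1 lessThan_Suc)

text \<open>Gaussian elimination: subtracting combinations of the rows R clears the columns C in all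
  other rows. Every bordered minor becomes the core times a minor of size one or two of the Schur
  complement \<open>m'\<close>, and the identity reduces to the formula for a determinant of size
  two. The new labels have to lie outside R because \<open>m'\<close> recognises the core rows by
  their labels.\<close>

lemma desnanot_jacobi:
  assumes len: "length R = length C" and core: "minor m R C \<noteq> 0"
    and new: "x \<notin> set R" "y \<notin> set R"
  shows "minor m (R @ [x]) (C @ [p]) * minor m (R @ [y]) (C @ [q]) =
    minor m (R @ [x, y]) (C @ [p, q]) * minor m R C + minor m (R @ [y]) (C @ [p]) * minor m (R @ [x]) (C @ [q])"
proof -
  obtain lam where lam: "\<And>z c. c \<in> set C \<Longrightarrow> m z c = (\<Sum>i<length R. lam z i * m (R ! i) c)"
  proof -
    have "\<exists>lam. \<forall>z. \<forall>c\<in>set C. m z c = (\<Sum>i<length R. lam z i * m (R ! i) c)"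
      by (rule choice) (use row_combination[OF len core] in blast)
    then show ?thesis using that by blast
  qed
  define m' where "m' = (\<lambda>z c. if z \<in> set R then m z c else m z c + (\<Sum>i<length R. - lam z i * m (R ! i) c))"
  have zero: "m' z c = 0" if "c \<in> set C" "z \<notin> set R" for z c
    using that lam[of c z] by (simp add: m'_def sum_negf)
  have op: "minor m (R @ ws) cs = minor m' (R @ ws) cs" if "set ws \<inter> set R = {}" "length (R @ ws) = length cs" for ws cs
    by (rule minor_row_operation[symmetric, of _ _ _ _ _ "\<lambda>w i. - lam w i"]) (use that in \<open>auto simp: m'_def\<close>)
  have block: "minor m' (R @ ws) (C @ cs) = minor m R C * minor m' ws cs" if "set ws \<inter> set R = {}" "length ws = length cs" for ws cs
  proof -
    have "minor m' (R @ ws) (C @ cs) = minor m' R C * minor m' ws cs"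
      by (rule minor_block_upper) (use that len zero in auto)
    moreover have "minor m' R C = minor m R C"
      by (rule minor_cong) (auto simp: len m'_def)
    ultimately show ?thesis by simp
  qed
  have 1: "minor m (R @ [z]) (C @ [c]) = minor m R C * m' z c" if "z \<notin> set R" for z c
    using op[of "[z]" "C @ [c]"] block[of "[z]" "[c]"] that len by (simp add: minor_1)
  have 2: "minor m (R @ [x, y]) (C @ [p, q]) = minor m R C * (m' x p * m' y q - m' y p * m' x q)"
    using op[of "[x, y]" "C @ [p, q]"] block[of "[x, y]" "[p, q]"] new len by (simp add: minor_2)
  show ?thesis unfolding 2 1[OF new(1)] 1[OF new(2)] by (simp add: algebra_simps)
qed

section \<open>Brackets as minors\<close>

lemma minor_map: 
  "length rs = length cs \<Longrightarrow> minor m (map f rs) (map g cs) = minor (\<lambda>r c. m (f r) (g c)) rs cs"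
  unfolding minor_def by (rule arg_cong[of _ _ det], rule eq_matI) auto

lemma pr_scalars: "pr n (basis_form {}) (basis_form {}) = 1"
  by (simp add: pr_basis_form) (simp add: basis_form_def)

text \<open>A Gram determinant: contraction with the first of \<open>ys\<close> is Laplace expansion
  along the first column.\<close>

lemma pr_vwedge:
  assumes "\<And>x. x \<in> set xs \<Longrightarrow> in_space n x" "length xs = length ys"
  shows "pr n (vwedge xs) (vwedge ys) = minor (\<lambda>x y. ev n y x) xs ys"
  using assms
proof (induction ys arbitrary: xs)
  case (Cons y ys)
  have "pr n (vwedge xs) (vwedge (y # ys)) = (\<Sum>i<length xs. (-1) ^ i * ev n y (xs ! i) *
      pr n (vwedge (take i xs @ drop (Suc i) xs)) (vwedge ys))"
    using pr_vwedge_Cons[of xs n y] Cons.prems(1) by simp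
  also have "\<dots> = (\<Sum>i<length xs. (-1) ^ i * ev n y (xs ! i) * minor (\<lambda>x y. ev n y x) (take i xs @ drop (Suc i) xs) ys)"
    by (intro sum.cong[OF refl] arg_cong2[of _ _ _ _ times] Cons.IH)
      (use Cons.prems in \<open>auto dest: in_set_takeD in_set_dropD\<close>)
  finally show ?case using minor_Cons[of xs ys _ y] Cons.prems(2) by simp
qed (simp add: pr_scalars)

lemma pr_vwedge_contraction:
  assumes f: "\<And>r. in_space n (f r)" and g: "\<And>c. in_space n (g c)"
    and m: "\<And>r c. r \<in> set rs \<Longrightarrow> c \<in> set ys \<union> set ps \<Longrightarrow> m r c = ev n (g c) (f r)"
    and mu: "\<And>r c. r \<in> set us \<Longrightarrow> c \<in> set ps \<Longrightarrow> m r c = ev n (g c) (f r)"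
    and m0: "\<And>r c. r \<in> set us \<Longrightarrow> c \<in> set ys \<Longrightarrow> m r c = 0"
    and len: "length rs = length ys + p" "p + length us = length ps"
  shows "pr n (vwedge (map f rs)) (vwedge (map g ys) \<and>\<^sub>e
      functional_form n p (\<lambda>\<xi>. pr n (vwedge (map g ps)) (\<xi> \<and>\<^sub>e vwedge (map f us)))) =
    minor m (rs @ us) (ys @ ps)"
  using m m0 len(1)
proof (induction ys arbitrary: rs)
  case Nil
  let ?l = "\<lambda>\<xi>. pr n (vwedge (map g ps)) (\<xi> \<and>\<^sub>e vwedge (map f us))"
  have X: "homog n p (vwedge (map f rs))" using homog_vwedge[of "map f rs" n] f Nil by auto
  have "functional_form n p ?l = functional_form n p (\<lambda>\<xi>. pr n (vwedge (map g ps)) (basis_form {} \<and>\<^sub>e \<xi> \<and>\<^sub>e vwedge (map f us)))"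
    using functional_form_cong[of n p ?l 1 "\<lambda>\<xi>. pr n (vwedge (map g ps)) (basis_form {} \<and>\<^sub>e \<xi> \<and>\<^sub>e vwedge (map f us))"]
    by (simp add: wedge_unit_left)
  then have "pr n (vwedge (map f rs)) (functional_form n p ?l) = pr n (vwedge (map g ps)) (vwedge (map f rs) \<and>\<^sub>e vwedge (map f us))"
    using pr_functional_form[OF X, of "vwedge (map g ps)" "basis_form {}" "vwedge (map f us)"] wedge_unit_left[OF X] by simp
  also have "\<dots> = pr n (vwedge (map f (rs @ us))) (vwedge (map g ps))"
    unfolding pr_commute[of n "vwedge (map g ps)"] map_append
    by (subst vwedge_append[of _ n]) (use f in auto)
  also have "\<dots> = minor (\<lambda>r c. ev n (g c) (f r)) (rs @ us) ps"
  proof -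
    have "length (rs @ us) = length ps" using len(2) Nil(3) by simp
    then show ?thesis
      by (subst pr_vwedge) (use f minor_map[of "rs @ us" ps "\<lambda>x y. ev n y x" f g] in auto)
  qed
  also have "\<dots> = minor m (rs @ us) ps"
    by (rule minor_cong) (use Nil len mu in auto)
  finally show ?case by (simp add: wedge_unit_left[OF homog_functional_form])
next
  case (Cons y ys)
  let ?\<gamma> = "functional_form n p (\<lambda>\<xi>. pr n (vwedge (map g ps)) (\<xi> \<and>\<^sub>e vwedge (map f us)))"
  have "pr n (vwedge (map f rs)) (vwedge (map g (y # ys)) \<and>\<^sub>e ?\<gamma>) =
      pr n (vwedge (map f rs)) (vec_form (g y) \<and>\<^sub>e (vwedge (map g ys) \<and>\<^sub>e ?\<gamma>))"
    by (simp add: wedge_assoc)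
  also have "\<dots> = (\<Sum>i<length rs. (-1) ^ i * ev n (g y) (f (rs ! i)) *
      pr n (vwedge (map f (take i rs @ drop (Suc i) rs))) (vwedge (map g ys) \<and>\<^sub>e ?\<gamma>))"
    by (subst pr_vwedge_Cons) (use f in \<open>auto simp: take_map drop_map\<close>)
  also have "\<dots> = (\<Sum>i<length rs. (-1) ^ i * m (rs ! i) y * minor m ((take i rs @ drop (Suc i) rs) @ us) (ys @ ps))"
  proof (rule sum.cong[OF refl])
    fix i assume i: "i \<in> {..<length rs}"
    have "pr n (vwedge (map f (take i rs @ drop (Suc i) rs))) (vwedge (map g ys) \<and>\<^sub>e ?\<gamma>) =
        minor m ((take i rs @ drop (Suc i) rs) @ us) (ys @ ps)"
    proof (rule Cons.IH)
      fix r c assume "r \<in> set (take i rs @ drop (Suc i) rs)" "c \<in> set ys \<union> set ps"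
      then show "m r c = ev n (g c) (f r)"
        using Cons.prems(1)[of r c] by (auto dest: in_set_takeD in_set_dropD)
    qed (use Cons.prems i in auto)
    moreover have "ev n (g y) (f (rs ! i)) = m (rs ! i) y"
      using Cons.prems(1)[of "rs ! i" y] i by simp
    ultimately show "(-1) ^ i * ev n (g y) (f (rs ! i)) *
      pr n (vwedge (map f (take i rs @ drop (Suc i) rs))) (vwedge (map g ys) \<and>\<^sub>e ?\<gamma>) =
      (-1) ^ i * m (rs ! i) y * minor m ((take i rs @ drop (Suc i) rs) @ us) (ys @ ps)" by simp
  qed
  also have "\<dots> = (\<Sum>i<length rs. (-1) ^ i * m ((rs @ us) ! i) y * minor m (take i (rs @ us) @ drop (Suc i) (rs @ us)) (ys @ ps))"
    by (intro sum.cong[OF refl]) (simp add: nth_append)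
  also have "\<dots> = (\<Sum>i<length (rs @ us). (-1) ^ i * m ((rs @ us) ! i) y * minor m (take i (rs @ us) @ drop (Suc i) (rs @ us)) (ys @ ps))"
    by (rule sum.mono_neutral_left) (use Cons.prems(2) in \<open>auto simp: nth_append\<close>)
  also have "\<dots> = minor m (rs @ us) (y # ys @ ps)"
    by (rule minor_Cons[symmetric]) (use Cons.prems(3) len in auto)
  finally show ?case by simp
qed

lemma minus_one_power_reflect: "b \<le> 2 * n + 1 \<Longrightarrow> (-1) ^ (2 * n + 1 - b) = (- ((-1) ^ b) :: complex)"
proof -
  assume "b \<le> 2 * n + 1"
  then have "odd (b + (2 * n + 1 - b))" by simp
  then show ?thesis by (cases "even b") auto
qed

lemma sum_shift: "(\<Sum>k<2 * n. F (Suc k)) = (\<Sum>k=1..2 * n. F k)"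
  by (rule sum.reindex_bij_witness[of _ "\<lambda>k. k - 1" Suc]) auto

section \<open>Completeness relations of a symplectic basis\<close>

text \<open>The prescribed pairings say that the reversed basis, with signs, gives a left inverse of
  the coordinate matrix. As the matrices are square it is also a right inverse, which is a relation
  between coordinates instead of vectors.\<close>

lemma symplectic_completeness:
  assumes u: "symplectic_basis n u" and ab: "a \<in> {1..2 * n}" "b \<in> {1..2 * n}"
  shows "(\<Sum>k=1..2 * n. (-1) ^ k * u k a * u (2 * n + 1 - k) b) = (if a + b = 2 * n + 1 then (-1) ^ a else 0)"
proof -
  define B where "B = (\<lambda>a k. u (Suc k) (Suc a))"
  \<comment> \<open>Row k is, up to the sign \<open>(-1) ^ Suc k\<close>, the covector of
    \<open>u (2 * n - k)\<close>, with indices shifted to start at 0.\<close>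
  define A where "A = (\<lambda>k b. (-1) ^ Suc k * (-1) ^ Suc b * u (2 * n - k) (2 * n - b))"
  have inv: "(\<Sum>b<2 * n. A k b * B b l) = (if k = l then 1 else 0)" if kl: "k < 2 * n" "l < 2 * n" for k l
  proof -
    have "(\<Sum>b<2 * n. A k b * B b l) = (-1) ^ Suc k * (\<Sum>b<2 * n. (-1) ^ Suc b * u (2 * n - k) (2 * n + 1 - Suc b) * u (Suc l) (Suc b))"
      by (simp add: A_def B_def sum_distrib_left mult_ac)
    also have "\<dots> = (-1) ^ Suc k * ev n (flat n (u (2 * n - k))) (u (Suc l))"
      unfolding ev_def flat_def sum_shift[symmetric] by (rule refl)
    also have "\<dots> = (if k = l then 1 else 0)"
      unfolding ev_flat using kl
      by (subst symplectic_basis_pairing[OF u]) (auto simp flip: power_add)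
    finally show ?thesis .
  qed
  obtain a' b' where ab': "a = Suc a'" "2 * n + 1 - b = Suc b'" "a' < 2 * n" "b' < 2 * n" "b = 2 * n - b'"
  proof
    show "a = Suc (a - 1)" "2 * n + 1 - b = Suc (2 * n - b)" "a - 1 < 2 * n" "2 * n - b < 2 * n" "b = 2 * n - (2 * n - b)"
      using ab by auto
  qed
  have "(\<Sum>k<2 * n. B a' k * A k b') = (if a' = b' then 1 else 0)"
    by (rule right_inverse_of_left_inverse[OF inv]) (use ab' in auto)
  moreover have "(\<Sum>k<2 * n. B a' k * A k b') = (-1) ^ Suc b' * (\<Sum>k<2 * n. (-1) ^ Suc k * u (Suc k) a * u (2 * n + 1 - Suc k) b)"
    unfolding ab'(1,5) by (simp add: A_def B_def sum_distrib_left mult_ac)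
  ultimately have "(-1) ^ Suc b' * (\<Sum>k=1..2 * n. (-1) ^ k * u k a * u (2 * n + 1 - k) b) = (if a' = b' then 1 else 0)"
    unfolding sum_shift[symmetric] by simp
  then have "(-1) ^ Suc b' * ((-1) ^ Suc b' * (\<Sum>k=1..2 * n. (-1) ^ k * u k a * u (2 * n + 1 - k) b)) = (-1) ^ Suc b' * (if a' = b' then 1 else 0)"
    by simp
  then show ?thesis using ab ab' by (auto split: if_splits)
qed

text \<open>The identity of V, resolved by u and its dual basis, is inserted between x and
  y.\<close>

lemma symplectic_form_expansion:
  assumes u: "symplectic_basis n u"
  shows "symplectic_form n x y = (\<Sum>k=1..2 * n. (-1) ^ k * symplectic_form n x (u k) * symplectic_form n (u (2 * n + 1 - k)) y)"
proof -
  have swap: "symplectic_form n (u i) y = - (\<Sum>b=1..2 * n. flat n y b * u i b)" for i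
    by (subst symplectic_form_swap) (simp only: ev_flat[symmetric] ev_def)
  have "(\<Sum>k=1..2 * n. (-1) ^ k * symplectic_form n x (u k) * symplectic_form n (u (2 * n + 1 - k)) y) =
     (\<Sum>k=1..2 * n. \<Sum>a=1..2 * n. \<Sum>b=1..2 * n. - (flat n x a * flat n y b * ((-1) ^ k * u k a * u (2 * n + 1 - k) b)))"
  proof (rule sum.cong[OF refl])
    fix k
    have "(-1) ^ k * symplectic_form n x (u k) * symplectic_form n (u (2 * n + 1 - k)) y =
      - ((-1) ^ k * ((\<Sum>a=1..2 * n. flat n x a * u k a) * (\<Sum>b=1..2 * n. flat n y b * u (2 * n + 1 - k) b)))"
      unfolding swap ev_flat[symmetric, of n x] ev_def by simp
    also have "\<dots> = (\<Sum>a=1..2 * n. \<Sum>b=1..2 * n. - (flat n x a * flat n y b * ((-1) ^ k * u k a * u (2 * n + 1 - k) b)))"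
      unfolding sum_product by (simp add: sum_distrib_left sum_negf mult_ac)
    finally show "(-1) ^ k * symplectic_form n x (u k) * symplectic_form n (u (2 * n + 1 - k)) y =
      (\<Sum>a=1..2 * n. \<Sum>b=1..2 * n. - (flat n x a * flat n y b * ((-1) ^ k * u k a * u (2 * n + 1 - k) b)))" .
  qed
  also have "\<dots> = (\<Sum>a=1..2 * n. \<Sum>b=1..2 * n. \<Sum>k=1..2 * n. - (flat n x a * flat n y b * ((-1) ^ k * u k a * u (2 * n + 1 - k) b)))"
    by (subst sum.swap, rule sum.cong[OF refl], rule sum.swap)
  also have "\<dots> = (\<Sum>a=1..2 * n. \<Sum>b=1..2 * n. if b = 2 * n + 1 - a then - (flat n x a * flat n y b * (-1) ^ a) else 0)"
  proof (intro sum.cong[OF refl])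
    fix a b assume ab: "a \<in> {1..2 * n}" "b \<in> {1..2 * n}"
    have "(\<Sum>k=1..2 * n. - (flat n x a * flat n y b * ((-1) ^ k * u k a * u (2 * n + 1 - k) b))) =
       - (flat n x a * flat n y b * (\<Sum>k=1..2 * n. (-1) ^ k * u k a * u (2 * n + 1 - k) b))"
      by (simp add: sum_distrib_left sum_negf)
    also have "\<dots> = - (flat n x a * flat n y b * (if a + b = 2 * n + 1 then (-1) ^ a else 0))"
      unfolding symplectic_completeness[OF u ab] ..
    finally show "(\<Sum>k=1..2 * n. - (flat n x a * flat n y b * ((-1) ^ k * u k a * u (2 * n + 1 - k) b))) =
      (if b = 2 * n + 1 - a then - (flat n x a * flat n y b * (-1) ^ a) else 0)"
      using ab by auto
  qed
  also have "\<dots> = (\<Sum>a=1..2 * n. flat n x a * y a)"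
  proof (rule sum.cong[OF refl])
    fix a assume a: "a \<in> {1..2 * n}"
    have "(\<Sum>b=1..2 * n. if b = 2 * n + 1 - a then - (flat n x a * flat n y b * (-1) ^ a) else 0) =
       - (flat n x a * flat n y (2 * n + 1 - a) * (-1) ^ a)"
      using a by (subst sum.delta) auto
    also have "flat n y (2 * n + 1 - a) = - ((-1) ^ a) * y a"
      unfolding flat_def using a by (subst minus_one_power_reflect) auto
    finally show "(\<Sum>b=1..2 * n. if b = 2 * n + 1 - a then - (flat n x a * flat n y b * (-1) ^ a) else 0) = flat n x a * y a"
      by simp
  qed
  also have "\<dots> = symplectic_form n x y" unfolding ev_flat[symmetric] ev_def ..
  finally show ?thesis ..
qed

text \<open>The completeness sum folded in the middle, k being joined with
  \<open>2 * n + 1 - k\<close>. The result shows that the coordinates of the bivector do not depend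
  on the basis.\<close>

lemma symplectic_completeness_pairs:
  assumes "symplectic_basis n u" "a \<in> {1..2 * n}" "b \<in> {1..2 * n}"
  shows "(\<Sum>i=1..n. (-1) ^ (i - 1) * (u i a * u (2 * n + 1 - i) b - u i b * u (2 * n + 1 - i) a)) =
    - (if a + b = 2 * n + 1 then (-1) ^ a else 0)"
proof -
  have "{1..2 * n} = {1..n} \<union> {n + 1..2 * n}" "{1..n} \<inter> {n + 1..2 * n} = {}" by auto
  then have "(\<Sum>k=1..2 * n. (-1) ^ k * u k a * u (2 * n + 1 - k) b) =
      (\<Sum>k=1..n. (-1) ^ k * u k a * u (2 * n + 1 - k) b) + (\<Sum>k=n + 1..2 * n. (-1) ^ k * u k a * u (2 * n + 1 - k) b)"
    by (simp add: sum.union_disjoint)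
  also have "(\<Sum>k=n + 1..2 * n. (-1) ^ k * u k a * u (2 * n + 1 - k) b) = (\<Sum>k=1..n. - ((-1) ^ k) * u (2 * n + 1 - k) a * u k b)"
  proof (rule sum.reindex_bij_witness[of _ "\<lambda>b. 2 * n + 1 - b" "\<lambda>b. 2 * n + 1 - b"])
    fix k assume "k \<in> {n + 1..2 * n}"
    then show "- ((-1) ^ (2 * n + 1 - k)) * u (2 * n + 1 - (2 * n + 1 - k)) a * u (2 * n + 1 - k) b =
       (-1) ^ k * u k a * u (2 * n + 1 - k) b"
      by (subst minus_one_power_reflect) auto
  qed auto
  also have "(\<Sum>k=1..n. (-1) ^ k * u k a * u (2 * n + 1 - k) b) + \<dots> =
      - (\<Sum>i=1..n. (-1) ^ (i - 1) * (u i a * u (2 * n + 1 - i) b - u i b * u (2 * n + 1 - i) a))"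
    unfolding sum.distrib[symmetric] sum_negf[symmetric]
  proof (rule sum.cong[OF refl])
    fix i assume "i \<in> {1..n}"
    then obtain k where "i = Suc k" by (cases i) auto
    then show "(-1) ^ i * u i a * u (2 * n + 1 - i) b + - ((-1) ^ i) * u (2 * n + 1 - i) a * u i b =
      - ((-1) ^ (i - 1) * (u i a * u (2 * n + 1 - i) b - u i b * u (2 * n + 1 - i) a))"
      by (simp add: algebra_simps)
  qed
  finally show ?thesis unfolding symplectic_completeness[OF assms] by simp
qed

lemma top_symplectic_basis:
  assumes "symplectic_basis n u"
  shows "top_coeff n (flag_form u (2 * n)) = 1"
proof (rule top_flag_form)
  show "in_space n (u i)" for i by (rule symplectic_basis_in_space[OF assms])
  fix a b :: nat assume "1 \<le> a" "a < b" "b \<le> 2 * n"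
  then have "a \<in> {1..2 * n}" "b \<in> {1..2 * n}" by auto
  then show "(\<Sum>i=1..n. (-1) ^ (i - 1) * (u i a * u (2 * n + 1 - i) b - u i b * u (2 * n + 1 - i) a)) =
      (\<Sum>i=1..n. (-1) ^ (i - 1) * (std_basis n i a * std_basis n (2 * n + 1 - i) b - std_basis n i b * std_basis n (2 * n + 1 - i) a))"
    by (simp only: symplectic_completeness_pairs assms symplectic_std_basis)
qed

abbreviation flats :: "nat \<Rightarrow> (nat \<Rightarrow> nat \<Rightarrow> complex) \<Rightarrow> nat \<Rightarrow> (nat \<Rightarrow> complex) list" where
  "flats n u k \<equiv> map (\<lambda>i. flat n (u i)) [1..<Suc k]"

lemma wedge_unit_right: "homog n p \<alpha> \<Longrightarrow> \<alpha> \<and>\<^sub>e basis_form {} = \<alpha>"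
  using wedge_commute[OF homog_empty, of n p \<alpha>] wedge_unit_left[of n p \<alpha>] by simp

text \<open>The Hodge star of \<open>U\<^sub>b\<close> is the image of \<open>U\<^bsub>2n-b\<^esub>\<close> under the isomorphism of \<open>V\<close> with its dual
  given by the symplectic form.\<close>

lemma hodge:
  assumes u: "symplectic_basis n u" and b: "b \<le> 2 * n" and \<xi>: "homog n (2 * n - b) \<xi>"
  shows "top_coeff n (flag_form u b \<and>\<^sub>e \<xi>) = pr n (vwedge (flats n u (2 * n - b))) \<xi>"
proof -
  have "flag_form u (2 * n) \<and>\<^sub>e basis_form {} = flag_form u (2 * n)"
    by (rule wedge_unit_right[OF homog_flag_form[of n]]) (rule symplectic_basis_in_space[OF u])
  then have "vwedge (flats n u (2 * n)) {1..2 * n} = 1"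
    using hodge_scaled[OF u, of "2 * n" "basis_form {}"] top_symplectic_basis[OF u] by (simp add: pr_scalars)
  then show ?thesis using hodge_scaled[OF u b \<xi>] by simp
qed

declare upt_Suc [simp del]

section \<open>Labels for the vectors of three flags\<close>

definition flag_of :: "flags \<Rightarrow> nat \<Rightarrow> flag" where
  "flag_of Z g = (if g = 0 then fst Z else if g = 1 then fst (snd Z) else snd (snd Z))"

text \<open>A label consists of a flag, 0 for A, 1 for B and 2 for C, and of an index in it. Columns
  play the role of covectors, which is why the column label comes first in the symplectic
  form.\<close>

definition pairing :: "nat \<Rightarrow> flags \<Rightarrow> nat \<times> nat \<Rightarrow> nat \<times> nat \<Rightarrow> complex" where
  "pairing n Z r c = symplectic_form n (flag_of Z (fst c) (snd c)) (flag_of Z (fst r) (snd r))"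

text \<open>The A-rows are cut off from the C-columns, because in \<open>[a, b; n, n; c, d]\<close>
  the form U_a occurs in the third factor only and W_d in the first only.\<close>

definition pairing0 :: "nat \<Rightarrow> flags \<Rightarrow> nat \<times> nat \<Rightarrow> nat \<times> nat \<Rightarrow> complex" where
  "pairing0 n Z r c = (if fst r = 0 \<and> fst c = 2 then 0 else pairing n Z r c)"

abbreviation seg :: "nat \<Rightarrow> nat \<Rightarrow> (nat \<times> nat) list" where
  "seg g a \<equiv> map (Pair g) [1..<Suc a]"

lemma minus_one_power_eqI: "even (k + l) \<Longrightarrow> (-1) ^ k = ((-1) ^ l :: complex)"
  by (cases "even k"; cases "even l") auto

lemma homog_flats: "symplectic_basis n u \<Longrightarrow> homog n k (vwedge (flats n u k))"
proof -
  assume u: "symplectic_basis n u"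
  have "homog n (length (flats n u k)) (vwedge (flats n u k))"
    by (rule homog_vwedge) (use symplectic_basis_in_space[OF u] in \<open>auto simp: in_space_flat\<close>)
  then show ?thesis by simp
qed

section \<open>The functionals of the brackets as forms\<close>

lemma functional_form_left:
  assumes u: "symplectic_basis n u" and b: "b \<le> 2 * n"
  shows "functional_form n (2 * n - b) (\<lambda>\<xi>. top_coeff n (flag_form u b \<and>\<^sub>e \<xi>)) = vwedge (flats n u (2 * n - b))"
proof -
  have h: "homog n (2 * n - b) (vwedge (flats n u (2 * n - b)))"
    by (rule homog_flats[OF u])
  have "functional_form n (2 * n - b) (\<lambda>\<xi>. top_coeff n (flag_form u b \<and>\<^sub>e \<xi>)) =
      (\<lambda>K. 1 * functional_form n (2 * n - b) (pr n (vwedge (flats n u (2 * n - b)))) K)"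
    by (rule functional_form_cong) (use hodge[OF u b] in simp)
  then show ?thesis using functional_form_pr[OF h] by simp
qed

lemma functional_form_right:
  assumes u: "symplectic_basis n u" and b: "b \<le> 2 * n"
  shows "functional_form n (2 * n - b) (\<lambda>\<xi>. top_coeff n (\<xi> \<and>\<^sub>e flag_form u b)) =
    (\<lambda>K. (-1) ^ b * vwedge (flats n u (2 * n - b)) K)"
  unfolding functional_form_left[OF assms, symmetric]
proof (rule functional_form_cong)
  fix I assume I: "homog n (2 * n - b) (basis_form I)"
  have h: "homog n b (flag_form u b)"
    by (rule homog_flag_form) (rule symplectic_basis_in_space[OF u])
  have "(-1) ^ ((2 * n - b) * b) = ((-1) ^ b :: complex)"
  proof (rule minus_one_power_eqI)
    have "even (2 * n - b) \<longleftrightarrow> even b" using b by simp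
    then show "even ((2 * n - b) * b + b)" by auto
  qed
  then show "top_coeff n (basis_form I \<and>\<^sub>e flag_form u b) = (-1) ^ b * top_coeff n (flag_form u b \<and>\<^sub>e basis_form I)"
    using top_wedge_commute[OF I h] by simp
qed

lemma top_wedge_rotate:
  assumes "homog n a \<alpha>" "homog n p \<xi>" "homog n d \<gamma>" "p + a + d = 2 * n"
  shows "top_coeff n (\<alpha> \<and>\<^sub>e \<xi> \<and>\<^sub>e \<gamma>) = (-1) ^ a * top_coeff n (\<xi> \<and>\<^sub>e (\<gamma> \<and>\<^sub>e \<alpha>))"
proof -
  have "top_coeff n (\<alpha> \<and>\<^sub>e (\<xi> \<and>\<^sub>e \<gamma>)) = (-1) ^ (a * (p + d)) * top_coeff n (\<xi> \<and>\<^sub>e \<gamma> \<and>\<^sub>e \<alpha>)"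
    by (rule top_wedge_commute[OF assms(1) homog_wedge[OF assms(2,3)]])
  moreover have "(-1) ^ (a * (p + d)) = ((-1) ^ a :: complex)"
  proof (rule minus_one_power_eqI)
    have "even (p + a + d)" unfolding assms(4) by simp
    then show "even (a * (p + d) + a)" by auto
  qed
  ultimately show ?thesis by (simp only: wedge_assoc)
qed

text \<open>Moves the form of w to the front, where its Hodge star applies, and the form of u behind
  \<xi>, where \<open>pr_vwedge_contraction\<close> expects it.\<close>

lemma functional_form_middle:
  assumes u: "symplectic_basis n u" and w: "symplectic_basis n w" and p: "p + a + d = 2 * n"
  shows "functional_form n p (\<lambda>\<xi>. top_coeff n (flag_form u a \<and>\<^sub>e \<xi> \<and>\<^sub>e flag_form w d)) =
    (\<lambda>K. (-1) ^ (d + a + a * d) * functional_form n p (\<lambda>\<xi>. pr n (vwedge (flats n w (2 * n - d))) (\<xi> \<and>\<^sub>e flag_form u a)) K)"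
proof (rule functional_form_cong)
  fix I assume I: "homog n p (basis_form I)"
  have h: "homog n a (flag_form u a)" "homog n d (flag_form w d)"
    using symplectic_basis_in_space[OF u] symplectic_basis_in_space[OF w] by (auto intro: homog_flag_form)
  have 1: "top_coeff n (flag_form u a \<and>\<^sub>e basis_form I \<and>\<^sub>e flag_form w d) = (-1) ^ ((a + p) * d) * top_coeff n (flag_form w d \<and>\<^sub>e (flag_form u a \<and>\<^sub>e basis_form I))"
    by (rule top_wedge_commute[OF homog_wedge[OF h(1) I] h(2)])
  have 2: "flag_form u a \<and>\<^sub>e basis_form I = (\<lambda>K. (-1) ^ (a * p) * (basis_form I \<and>\<^sub>e flag_form u a) K)"
    using wedge_commute[OF I h(1)] by (simp add: mult.commute)
  have 3: "top_coeff n (flag_form w d \<and>\<^sub>e (\<lambda>K. (-1) ^ (a * p) * (basis_form I \<and>\<^sub>e flag_form u a) K)) =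
      (-1) ^ (a * p) * pr n (vwedge (flats n w (2 * n - d))) (basis_form I \<and>\<^sub>e flag_form u a)"
  proof -
    have d: "d \<le> 2 * n" "2 * n - d = p + a" using p by auto
    have "homog n (2 * n - d) (basis_form I \<and>\<^sub>e flag_form u a)"
      unfolding d(2) by (rule homog_wedge[OF I h(1)])
    from hodge[OF w d(1) this] show ?thesis
      unfolding wedge_scale_right top_coeff_def by simp
  qed
  have 4: "(-1) ^ ((a + p) * d) * ((-1) ^ (a * p) * x) = (-1) ^ (d + a + a * d) * x" for x :: complex
  proof -
    have "p = 2 * n - (a + d)" "a + d \<le> 2 * n" using p by auto
    then have "even p \<longleftrightarrow> even (a + d)" by simp
    then have "even ((a + p) * d + a * p + (d + a + a * d))" by auto
    from minus_one_power_eqI[OF this] show ?thesis by (simp add: power_add)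
  qed
  show "top_coeff n (flag_form u a \<and>\<^sub>e basis_form I \<and>\<^sub>e flag_form w d) =
      (-1) ^ (d + a + a * d) * pr n (vwedge (flats n w (2 * n - d))) (basis_form I \<and>\<^sub>e flag_form u a)"
    unfolding 1 unfolding 2 3 4 ..
qed

lemma functional_form_two:
  assumes u: "symplectic_basis n u" and v: "symplectic_basis n v" and a: "a \<le> n"
  shows "functional_form n (n - a) (\<lambda>\<xi>. top_coeff n (flag_form u a \<and>\<^sub>e flag_form v n \<and>\<^sub>e \<xi>)) =
    (\<lambda>K. (-1) ^ a * functional_form n (n - a) (\<lambda>\<xi>. pr n (vwedge (flats n v n)) (\<xi> \<and>\<^sub>e flag_form u a)) K)"
proof (rule functional_form_cong)
  fix I assume I: "homog n (n - a) (basis_form I)"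
  have h: "homog n a (flag_form u a)" "homog n n (flag_form v n)"
    using symplectic_basis_in_space[OF u] symplectic_basis_in_space[OF v] by (auto intro: homog_flag_form)
  have "top_coeff n (flag_form u a \<and>\<^sub>e flag_form v n \<and>\<^sub>e basis_form I) = (-1) ^ a * top_coeff n (flag_form v n \<and>\<^sub>e (basis_form I \<and>\<^sub>e flag_form u a))"
    by (rule top_wedge_rotate[OF h I]) (use a in auto)
  then show "top_coeff n (flag_form u a \<and>\<^sub>e flag_form v n \<and>\<^sub>e basis_form I) =
      (-1) ^ a * pr n (vwedge (flats n v n)) (basis_form I \<and>\<^sub>e flag_form u a)"
    using hodge[OF v, of n "basis_form I \<and>\<^sub>e flag_form u a"] homog_wedge[OF I h(1)] a by simp
qed

lemma flag_triplesD:
  assumes "Z \<in> flag_triples n"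
  shows "symplectic_basis n (flag_of Z g)"
  using assms by (auto simp: flag_triples_def flag_of_def)

lemma pairing_ev: "pairing n Z r c = ev n (flat n (flag_of Z (fst c) (snd c))) (flag_of Z (fst r) (snd r))"
  by (simp add: pairing_def ev_flat)

lemma pairing_same:
  assumes "Z \<in> flag_triples n" "i \<in> {1..2 * n}" "k \<in> {1..2 * n}" "i + k \<le> 2 * n"
  shows "pairing n Z (g, i) (g, k) = 0"
  using symplectic_basis_pairing[OF flag_triplesD[OF assms(1)], of k i g] assms(2-4) by (simp add: pairing_def)

lemma pr_scale_right: "pr n \<alpha> (\<lambda>K. c * \<beta> K) = c * pr n \<alpha> \<beta>"
  by (simp add: pr_commute[of n \<alpha>] pr_scale_left)

lemma pr_vwedge_contraction_seg:
  assumes Z: "Z \<in> flag_triples n"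
    and m: "\<And>r c. r \<in> set rs \<Longrightarrow> c \<in> set ys \<union> set ps \<Longrightarrow> m r c = pairing n Z r c"
    and mu: "\<And>r c. r \<in> set us \<Longrightarrow> c \<in> set ps \<Longrightarrow> m r c = pairing n Z r c"
    and m0: "\<And>r c. r \<in> set us \<Longrightarrow> c \<in> set ys \<Longrightarrow> m r c = 0"
    and len: "length rs = length ys + p" "p + length us = length ps"
  shows "pr n (vwedge (map (case_prod (flag_of Z)) rs)) (vwedge (map (\<lambda>(g, i). flat n (flag_of Z g i)) ys) \<and>\<^sub>e
      functional_form n p (\<lambda>\<xi>. pr n (vwedge (map (\<lambda>(g, i). flat n (flag_of Z g i)) ps)) (\<xi> \<and>\<^sub>e vwedge (map (case_prod (flag_of Z)) us)))) =
    minor m (rs @ us) (ys @ ps)"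
  by (rule pr_vwedge_contraction)
    (use assms symplectic_basis_in_space[OF flag_triplesD[OF Z]] in \<open>auto simp: pairing_ev split_def in_space_flat\<close>)

lemma flags_seg: "flats n (flag_of Z g) k = map (\<lambda>(g, i). flat n (flag_of Z g i)) (seg g k)"
  by simp

lemma flag_form_seg: "Z \<in> flag_triples n \<Longrightarrow> flag_form (flag_of Z g) a = vwedge (map (case_prod (flag_of Z)) (seg g a))"
  using flag_form_vwedge[of n "flag_of Z g" a] symplectic_basis_in_space[OF flag_triplesD[of Z n g]]
  by (simp add: comp_def)

lemma vwedge_append_flags:
  "Z \<in> flag_triples n \<Longrightarrow> vwedge (map (case_prod (flag_of Z)) (rs @ rs')) =
    vwedge (map (case_prod (flag_of Z)) rs) \<and>\<^sub>e vwedge (map (case_prod (flag_of Z)) rs')"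
  unfolding map_append by (rule vwedge_append[of _ n]) (auto intro: symplectic_basis_in_space[OF flag_triplesD])

lemma vwedge_append_flats:
  "Z \<in> flag_triples n \<Longrightarrow> vwedge (map (\<lambda>(g, i). flat n (flag_of Z g i)) (rs @ rs')) =
    vwedge (map (\<lambda>(g, i). flat n (flag_of Z g i)) rs) \<and>\<^sub>e vwedge (map (\<lambda>(g, i). flat n (flag_of Z g i)) rs')"
  unfolding map_append by (rule vwedge_append[of _ n]) (auto intro: in_space_flat symplectic_basis_in_space[OF flag_triplesD])

section \<open>Determinantal formulas for the brackets\<close>

text \<open>The three factors of the comultiplication become the column blocks: the covectors of
  W_d, those of U_b, and those of V_n, with the vectors of U_a attached to the last as rows. The
  A-rows vanish on the A-columns because vectors of one flag are orthogonal when their indices add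
  up to at most 2n; on the C-columns the zeros are forced.\<close>

lemma br222_minor_seg:
  assumes Z: "Z \<in> flag_triples n"
    and abcd: "a \<le> n" "n \<le> b" "b \<le> 2 * n" "d \<le> 2 * n" "a + b + c + d = 4 * n"
  shows "br222 n a b c d Z = (-1) ^ (a + d) *
    minor (pairing0 n Z) (seg 1 n @ seg 2 c @ seg 0 a) (seg 2 (2 * n - d) @ seg 0 (2 * n - b) @ seg 1 n)"
proof -
  note sb = flag_triplesD[OF Z]
  let ?A = "flag_of Z 0" and ?B = "flag_of Z 1" and ?C = "flag_of Z 2"
  let ?f = "case_prod (flag_of Z)" and ?g = "\<lambda>(g, i). flat n (flag_of Z g i)"
  have Zeq: "Z = (?A, ?B, ?C)" by (simp add: flag_of_def)
  let ?h = "functional_form n (n - a) (\<lambda>\<xi>. pr n (vwedge (flats n ?B n)) (\<xi> \<and>\<^sub>e flag_form ?A a))"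
  have "br222 n a b c d Z = contract n
       [\<lambda>\<xi>. top_coeff n (\<xi> \<and>\<^sub>e flag_form ?C d), \<lambda>\<xi>. top_coeff n (flag_form ?A b \<and>\<^sub>e \<xi>),
        \<lambda>\<xi>. top_coeff n (flag_form ?A a \<and>\<^sub>e flag_form ?B n \<and>\<^sub>e \<xi>)]
       (comult [2 * n - d, 2 * n - b, n - a] (flag_form ?B n \<and>\<^sub>e flag_form ?C c))"
    by (subst Zeq) (simp only: br222_def prod.case)
  also have "\<dots> = (-1) ^ d * ((-1) ^ a * pr n (flag_form ?B n \<and>\<^sub>e flag_form ?C c)
      (vwedge (flats n ?C (2 * n - d)) \<and>\<^sub>e (vwedge (flats n ?A (2 * n - b)) \<and>\<^sub>e ?h)))"
    unfolding contract_comult_3 functional_form_left[OF sb abcd(3)] functional_form_right[OF sb abcd(4)]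
      functional_form_two[OF sb sb abcd(1)] wedge_scale_left wedge_scale_right pr_scale_right ..
  also have "pr n (flag_form ?B n \<and>\<^sub>e flag_form ?C c)
      (vwedge (flats n ?C (2 * n - d)) \<and>\<^sub>e (vwedge (flats n ?A (2 * n - b)) \<and>\<^sub>e ?h)) =
      pr n (vwedge (map ?f (seg 1 n @ seg 2 c))) (vwedge (map ?g (seg 2 (2 * n - d) @ seg 0 (2 * n - b))) \<and>\<^sub>e
        functional_form n (n - a) (\<lambda>\<xi>. pr n (vwedge (map ?g (seg 1 n))) (\<xi> \<and>\<^sub>e vwedge (map ?f (seg 0 a)))))"
    unfolding flags_seg flag_form_seg[OF Z] vwedge_append_flags[OF Z] vwedge_append_flats[OF Z] wedge_assoc ..
  also have "\<dots> = minor (pairing0 n Z) ((seg 1 n @ seg 2 c) @ seg 0 a) ((seg 2 (2 * n - d) @ seg 0 (2 * n - b)) @ seg 1 n)"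
  proof (rule pr_vwedge_contraction_seg[OF Z])
    fix r k assume "r \<in> set (seg 0 a)" "k \<in> set (seg 2 (2 * n - d) @ seg 0 (2 * n - b))"
    then show "pairing0 n Z r k = 0"
      using abcd by (auto simp: pairing0_def intro!: pairing_same[OF Z])
  qed (use abcd in \<open>auto simp: pairing0_def\<close>)
  finally show ?thesis by (simp add: power_add mult_ac)
qed

text \<open>The two tensor factors are exchanged, so that the covectors of the larger form of A
  stand first, as the contraction lemma requires.\<close>

lemma br211_minor_aux:
  assumes Z: "Z \<in> flag_triples n"
    and abcd: "a \<le> b" "b \<le> 2 * n" "c \<le> 2 * n" "d \<le> 2 * n" "2 * n \<le> b + c" "a + b + c + d = 4 * n"
  shows "br211 n a b c d Z = (-1) ^ ((a + d) * b) * pr n (flag_form (flag_of Z 1) c)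
    (vwedge (flats n (flag_of Z 0) (2 * n - b)) \<and>\<^sub>e
      functional_form n (b + c - 2 * n) (\<lambda>\<xi>. top_coeff n (flag_form (flag_of Z 0) a \<and>\<^sub>e \<xi> \<and>\<^sub>e flag_form (flag_of Z 2) d)))"
proof -
  note sb = flag_triplesD[OF Z]
  let ?A = "flag_of Z 0" and ?B = "flag_of Z 1" and ?C = "flag_of Z 2"
  let ?h = "functional_form n (b + c - 2 * n) (\<lambda>\<xi>. top_coeff n (flag_form ?A a \<and>\<^sub>e \<xi> \<and>\<^sub>e flag_form ?C d))"
  let ?k = "vwedge (flats n ?A (2 * n - b))"
  have Zeq: "Z = (?A, ?B, ?C)" by (simp add: flag_of_def)
  have k: "homog n (2 * n - b) ?k"
    by (rule homog_flats[OF sb])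
  have "br211 n a b c d Z = contract n
       [\<lambda>\<xi>. top_coeff n (flag_form ?A a \<and>\<^sub>e \<xi> \<and>\<^sub>e flag_form ?C d), \<lambda>\<xi>. top_coeff n (flag_form ?A b \<and>\<^sub>e \<xi>)]
       (comult [b + c - 2 * n, 2 * n - b] (flag_form ?B c))"
    by (subst Zeq) (simp only: br211_def prod.case Let_def max_absorb2[OF abcd(1)] min_absorb1[OF abcd(1)])
  also have "\<dots> = pr n (flag_form ?B c) (?h \<and>\<^sub>e ?k)"
    unfolding contract_comult_2 functional_form_left[OF sb abcd(2)] ..
  also have "?h \<and>\<^sub>e ?k = (\<lambda>K. (-1) ^ ((2 * n - b) * (b + c - 2 * n)) * (?k \<and>\<^sub>e ?h) K)"
    by (rule wedge_commute[OF k homog_functional_form])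
  also have "(-1) ^ ((2 * n - b) * (b + c - 2 * n)) = ((-1) ^ ((a + d) * b) :: complex)"
  proof (rule minus_one_power_eqI)
    have "b + c - 2 * n = 2 * n - (a + d)" "a + d \<le> 2 * n" using abcd by auto
    then show "even ((2 * n - b) * (b + c - 2 * n) + (a + d) * b)" using abcd(2) by auto
  qed
  finally show ?thesis unfolding pr_scale_right .
qed

text \<open>A first formula, in which V_c supplies rows. The block that has to vanish consists of
  A-rows and A-columns and vanishes by itself, so plain pairings suffice.\<close>

lemma br211_minor_direct_seg:
  assumes Z: "Z \<in> flag_triples n"
    and abcd: "a \<le> b" "b \<le> 2 * n" "c \<le> 2 * n" "d \<le> 2 * n" "2 * n \<le> b + c" "a + b + c + d = 4 * n"
  shows "br211 n a b c d Z = (-1) ^ ((a + d) * b + d + a + a * d) *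
    minor (pairing n Z) (seg 1 c @ seg 0 a) (seg 0 (2 * n - b) @ seg 2 (2 * n - d))"
proof -
  note sb = flag_triplesD[OF Z]
  have p: "b + c - 2 * n + a + d = 2 * n" using abcd by auto
  have "br211 n a b c d Z = (-1) ^ ((a + d) * b) * ((-1) ^ (d + a + a * d) *
      minor (pairing n Z) (seg 1 c @ seg 0 a) (seg 0 (2 * n - b) @ seg 2 (2 * n - d)))"
    unfolding br211_minor_aux[OF assms] functional_form_middle[OF sb sb p] wedge_scale_right pr_scale_right
    unfolding flags_seg flag_form_seg[OF Z]
  proof (subst pr_vwedge_contraction_seg[OF Z, where m = "pairing n Z"])
    fix r k assume "r \<in> set (seg 0 a)" "k \<in> set (seg 0 (2 * n - b))"
    then show "pairing n Z r k = 0"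
      using abcd by (auto intro!: pairing_same[OF Z])
  qed (use abcd in \<open>auto\<close>)
  then show ?thesis by (simp add: power_add mult_ac)
qed

text \<open>A second formula for the same bracket: the contraction by the covectors of U_b is
  shifted from V_c to the product of W_d and U_a, after which the Hodge star turns V_c into columns.
  Playing the two formulas off against each other yields the symmetry of
  \<open>br112\<close>.\<close>

lemma br211_minor_seg:
  assumes Z: "Z \<in> flag_triples n"
    and abcd: "a \<le> b" "b \<le> 2 * n" "c \<le> 2 * n" "d \<le> 2 * n" "2 * n \<le> b + c" "a + b + c + d = 4 * n"
  shows "br211 n a b c d Z = (-1) ^ a * minor (pairing n Z) (seg 2 d @ seg 0 a) (seg 0 (2 * n - b) @ seg 1 (2 * n - c))"
proof -
  note sb = flag_triplesD[OF Z]
  let ?A = "flag_of Z 0" and ?B = "flag_of Z 1" and ?C = "flag_of Z 2"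
  let ?f = "case_prod (flag_of Z)" and ?g = "\<lambda>(g, i). flat n (flag_of Z g i)"
  have sp: "in_space n (flag_of Z g i)" for g i by (rule symplectic_basis_in_space[OF sb])
  have hf: "homog n k (flag_form (flag_of Z g) k)" for g k by (rule homog_flag_form) (rule sp)
  define p q where "p = b + c - 2 * n" and "q = 2 * n - b"
  let ?ys = "flats n ?A q"
  have ys: "\<And>y. y \<in> set ?ys \<Longrightarrow> in_space n y" "length ?ys = q" using sp by (auto simp: in_space_flat)
  have pq: "p + q = c" "p + a + d = 2 * n" "p + (d + a) = 2 * n" "(2 * n - c) + q = d + a" using abcd by (auto simp: p_def q_def)
  let ?X = "minterior n ?ys (flag_form ?B c)" and ?\<beta> = "flag_form ?C d \<and>\<^sub>e flag_form ?A a"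
  have X: "homog n p ?X" by (rule homog_minterior) (use hf[of c] ys(2) pq(1) in simp)
  have \<beta>: "homog n (d + a) ?\<beta>" by (rule homog_wedge[OF hf hf])
  have Y: "homog n (2 * n - c) (minterior n ?ys ?\<beta>)" by (rule homog_minterior) (use \<beta> ys(2) pq(4) in simp)
  have hB: "homog n (2 * n - c) (vwedge (flats n ?B (2 * n - c)))"
    by (rule homog_flats[OF sb])
  have "br211 n a b c d Z = (-1) ^ ((a + d) * b) * pr n ?X (functional_form n p (\<lambda>\<xi>. top_coeff n (flag_form ?A a \<and>\<^sub>e \<xi> \<and>\<^sub>e flag_form ?C d)))"
    unfolding br211_minor_aux[OF assms] p_def[symmetric] q_def[symmetric]
    by (subst pr_minterior[of ?ys n p]) (use ys in auto)
  also have "\<dots> = (-1) ^ ((a + d) * b) * top_coeff n (flag_form ?A a \<and>\<^sub>e ?X \<and>\<^sub>e flag_form ?C d)"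
    unfolding top_coeff_as_pr pr_functional_form[OF X] ..
  also have "top_coeff n (flag_form ?A a \<and>\<^sub>e ?X \<and>\<^sub>e flag_form ?C d) = (-1) ^ a * top_coeff n (?X \<and>\<^sub>e ?\<beta>)"
    by (rule top_wedge_rotate[OF hf X hf pq(2)])
  also have "top_coeff n (?X \<and>\<^sub>e ?\<beta>) = (-1) ^ (q * Suc (p + q)) * top_coeff n (flag_form ?B c \<and>\<^sub>e minterior n ?ys ?\<beta>)"
    using top_minterior[of ?ys n p "flag_form ?B c" "d + a" ?\<beta>] ys hf[of c 1] \<beta> pq by simp
  also have "top_coeff n (flag_form ?B c \<and>\<^sub>e minterior n ?ys ?\<beta>) = pr n (minterior n ?ys ?\<beta>) (vwedge (flats n ?B (2 * n - c)))"
    unfolding hodge[OF sb abcd(3) Y] by (rule pr_commute)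
  also have "\<dots> = pr n ?\<beta> (vwedge ?ys \<and>\<^sub>e vwedge (flats n ?B (2 * n - c)))"
    by (rule pr_minterior[symmetric, OF ys(1) hB])
  also have "\<dots> = pr n (vwedge (map ?f (seg 2 d @ seg 0 a))) (vwedge (map ?g (seg 0 q @ seg 1 (2 * n - c))))"
    unfolding flags_seg flag_form_seg[OF Z] vwedge_append_flags[OF Z] vwedge_append_flats[OF Z] ..
  also have "\<dots> = minor (\<lambda>x y. ev n y x) (map ?f (seg 2 d @ seg 0 a)) (map ?g (seg 0 q @ seg 1 (2 * n - c)))"
    by (rule pr_vwedge) (use sp pq(4) in \<open>auto\<close>)
  also have "\<dots> = minor (\<lambda>r c. ev n (?g c) (?f r)) (seg 2 d @ seg 0 a) (seg 0 q @ seg 1 (2 * n - c))"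
    by (rule minor_map) (use pq(4) in auto)
  also have "(\<lambda>r c. ev n (?g c) (?f r)) = pairing n Z"
    by (auto simp: pairing_ev fun_eq_iff)
  also have "(-1) ^ ((a + d) * b) * ((-1) ^ a * ((-1) ^ (q * Suc (p + q)) * x)) = (-1) ^ a * x" for x :: complex
  proof -
    have "q + b = 2 * n" using abcd(2) by (simp add: q_def)
    then have "even (q + b)" by simp
    moreover have "even (p + a + d)" unfolding pq(2) by simp
    ultimately have "even ((a + d) * b + a + q * Suc (p + q) + a)" by auto
    from minus_one_power_eqI[OF this] show ?thesis by (simp add: power_add)
  qed
  finally show ?thesis unfolding q_def .
qed

lemma br111_middle_minor_seg:
  assumes Z: "Z \<in> flag_triples n" and ac: "a + c = n"
  shows "br111 n a n c Z = (-1) ^ a * minor (pairing n Z) (seg 2 c @ seg 0 a) (seg 1 n)"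
proof -
  note sb = flag_triplesD[OF Z]
  let ?A = "flag_of Z 0" and ?B = "flag_of Z 1" and ?C = "flag_of Z 2"
  let ?f = "case_prod (flag_of Z)" and ?g = "\<lambda>(g, i). flat n (flag_of Z g i)"
  have sp: "in_space n (flag_of Z g i)" for g i by (rule symplectic_basis_in_space[OF sb])
  have hf: "homog n k (flag_form (flag_of Z g) k)" for g k by (rule homog_flag_form) (rule sp)
  have Zeq: "Z = (?A, ?B, ?C)" by (simp add: flag_of_def)
  have n: "2 * n - n = n" by simp
  have h: "homog n (2 * n - n) (flag_form ?C c \<and>\<^sub>e flag_form ?A a)" using homog_wedge[OF hf hf] ac by (metis n add.commute)
  have "br111 n a n c Z = top_coeff n (flag_form ?A a \<and>\<^sub>e flag_form ?B n \<and>\<^sub>e flag_form ?C c)"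
    by (subst Zeq) (simp only: br111_def prod.case)
  also have "\<dots> = (-1) ^ a * top_coeff n (flag_form ?B n \<and>\<^sub>e (flag_form ?C c \<and>\<^sub>e flag_form ?A a))"
    by (rule top_wedge_rotate[OF hf hf hf]) (use ac in simp)
  also have "top_coeff n (flag_form ?B n \<and>\<^sub>e (flag_form ?C c \<and>\<^sub>e flag_form ?A a)) =
      pr n (vwedge (map ?f (seg 2 c @ seg 0 a))) (vwedge (map ?g (seg 1 n)))"
    by (subst hodge[OF sb _ h], simp, subst pr_commute)
      (simp only: n flags_seg flag_form_seg[OF Z] vwedge_append_flags[OF Z])
  also have "\<dots> = minor (\<lambda>x y. ev n y x) (map ?f (seg 2 c @ seg 0 a)) (map ?g (seg 1 n))"
    by (rule pr_vwedge) (use sp ac in \<open>auto\<close>)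
  also have "\<dots> = minor (\<lambda>r c. ev n (?g c) (?f r)) (seg 2 c @ seg 0 a) (seg 1 n)"
    by (rule minor_map) (use ac in auto)
  also have "(\<lambda>r c. ev n (?g c) (?f r)) = pairing n Z"
    by (auto simp: pairing_ev fun_eq_iff)
  finally show ?thesis .
qed

lemma top_two_flags_minor_seg:
  assumes Z: "Z \<in> flag_triples n" and ac: "a + c = 2 * n"
  shows "top_coeff n (flag_form (flag_of Z g) a \<and>\<^sub>e flag_form (flag_of Z h) c) = minor (pairing n Z) (seg h c) (seg g c)"
proof -
  note sb = flag_triplesD[OF Z]
  let ?f = "case_prod (flag_of Z)" and ?g = "\<lambda>(g, i). flat n (flag_of Z g i)"
  have sp: "in_space n (flag_of Z g i)" for g i by (rule symplectic_basis_in_space[OF sb])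
  have c: "a \<le> 2 * n" "2 * n - a = c" using ac by auto
  have h: "homog n (2 * n - a) (flag_form (flag_of Z h) c)" unfolding c by (rule homog_flag_form) (rule sp)
  have "top_coeff n (flag_form (flag_of Z g) a \<and>\<^sub>e flag_form (flag_of Z h) c) = pr n (vwedge (map ?f (seg h c))) (vwedge (map ?g (seg g c)))"
    by (subst hodge[OF sb c(1) h], subst pr_commute) (simp only: c flags_seg flag_form_seg[OF Z])
  also have "\<dots> = minor (\<lambda>x y. ev n y x) (map ?f (seg h c)) (map ?g (seg g c))"
    by (rule pr_vwedge) (use sp ac in \<open>auto\<close>)
  also have "\<dots> = minor (\<lambda>r c. ev n (?g c) (?f r)) (seg h c) (seg g c)"
    by (rule minor_map) (use ac in auto)
  also have "(\<lambda>r c. ev n (?g c) (?f r)) = pairing n Z"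
    by (auto simp: pairing_ev fun_eq_iff)
  finally show ?thesis .
qed

lemma br111_zero_minor_seg:
  assumes Z: "Z \<in> flag_triples n" and j: "j \<le> 2 * n"
  shows "br111 n (2 * n - j) 0 j Z = minor (pairing n Z) (seg 2 j) (seg 0 j)"
proof -
  let ?A = "flag_of Z 0" and ?B = "flag_of Z 1" and ?C = "flag_of Z 2"
  have Zeq: "Z = (?A, ?B, ?C)" by (simp add: flag_of_def)
  have "homog n (2 * n - j) (flag_form ?A (2 * n - j))"
    by (rule homog_flag_form) (rule symplectic_basis_in_space[OF flag_triplesD[OF Z]])
  from wedge_unit_right[OF this]
  have "br111 n (2 * n - j) 0 j Z = top_coeff n (flag_form ?A (2 * n - j) \<and>\<^sub>e flag_form ?C j)"
    by (subst Zeq) (simp only: br111_def prod.case flag_form.simps)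
  then show ?thesis using top_two_flags_minor_seg[OF Z, of "2 * n - j" j 0 2] j by simp
qed

section \<open>Relations between the brackets\<close>

lemma minor_scale:
  "length rs = length cs \<Longrightarrow> minor (\<lambda>r c. s r * t c * m r c) rs cs = (\<Prod>r\<leftarrow>rs. s r) * (\<Prod>c\<leftarrow>cs. t c) * minor m rs cs"
proof (induction cs arbitrary: rs)
  case (Cons c cs)
  have "minor (\<lambda>r c. s r * t c * m r c) rs (c # cs) = (\<Sum>i<length rs. (-1) ^ i * (s (rs ! i) * t c * m (rs ! i) c) *
      minor (\<lambda>r c. s r * t c * m r c) (take i rs @ drop (Suc i) rs) cs)"
    by (rule minor_Cons) (use Cons.prems in simp)
  also have "\<dots> = (\<Sum>i<length rs. (\<Prod>r\<leftarrow>rs. s r) * (\<Prod>c\<leftarrow>c # cs. t c) * ((-1) ^ i * m (rs ! i) c * minor m (take i rs @ drop (Suc i) rs) cs))"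
  proof (rule sum.cong[OF refl])
    fix i assume i: "i \<in> {..<length rs}"
    have IH: "minor (\<lambda>r c. s r * t c * m r c) (take i rs @ drop (Suc i) rs) cs =
        (\<Prod>r\<leftarrow>take i rs @ drop (Suc i) rs. s r) * (\<Prod>c\<leftarrow>cs. t c) * minor m (take i rs @ drop (Suc i) rs) cs"
      by (rule Cons.IH) (use Cons.prems i in simp)
    have "rs = take i rs @ rs ! i # drop (Suc i) rs" using i by (simp add: id_take_nth_drop)
    then have "(\<Prod>r\<leftarrow>rs. s r) = (\<Prod>r\<leftarrow>take i rs @ rs ! i # drop (Suc i) rs. s r)" by simp
    then have "(\<Prod>r\<leftarrow>rs. s r) = s (rs ! i) * (\<Prod>r\<leftarrow>take i rs @ drop (Suc i) rs. s r)" by (simp add: mult_ac)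
    then show "(-1) ^ i * (s (rs ! i) * t c * m (rs ! i) c) * minor (\<lambda>r c. s r * t c * m r c) (take i rs @ drop (Suc i) rs) cs =
      (\<Prod>r\<leftarrow>rs. s r) * (\<Prod>c\<leftarrow>c # cs. t c) * ((-1) ^ i * m (rs ! i) c * minor m (take i rs @ drop (Suc i) rs) cs)"
      unfolding IH by (simp add: mult_ac)
  qed
  also have "\<dots> = (\<Prod>r\<leftarrow>rs. s r) * (\<Prod>c\<leftarrow>c # cs. t c) * minor m rs (c # cs)"
    unfolding sum_distrib_left[symmetric] by (subst minor_Cons[of rs cs m c]) (use Cons.prems in simp_all)
  finally show ?case .
qed simp

lemma minor_move_cols:
  assumes "length rs = length (cs1 @ x # cs2 @ cs3)"
  shows "minor m rs (cs1 @ x # cs2 @ cs3) = (-1) ^ length cs2 * minor m rs (cs1 @ cs2 @ x # cs3)"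
  using minor_move[of cs1 x cs2 cs3 rs "\<lambda>c r. m r c"] assms
  by (simp add: minor_transpose[of rs _ m])

lemma pairing_skew: "pairing n Z r c = - pairing n Z c r"
  unfolding pairing_def by (rule symplectic_form_swap)

lemma prod_list_map_const: "(\<And>x. x \<in> set xs \<Longrightarrow> f x = c) \<Longrightarrow> (\<Prod>x\<leftarrow>xs. f x) = c ^ length xs"
  by (induction xs) auto

lemma prod_list_const: "(\<Prod>x\<leftarrow>xs. c) = (c :: complex) ^ length xs"
  by (induction xs) simp_all

lemma minor_pairing_swap:
  assumes "length rs = length cs"
  shows "minor (pairing n Z) rs cs = (-1) ^ length rs * minor (pairing n Z) cs rs"
proof -
  have "minor (pairing n Z) rs cs = minor (\<lambda>c r. (-1) * 1 * pairing n Z c r) cs rs"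
    unfolding minor_transpose[OF assms]
  proof (rule minor_cong)
    show "pairing n Z c r = (-1) * 1 * pairing n Z r c" for r c
      by (subst pairing_skew) simp
  qed (use assms in simp)
  also have "\<dots> = (\<Prod>c\<leftarrow>cs. -1) * (\<Prod>r\<leftarrow>rs. 1) * minor (pairing n Z) cs rs"
    by (rule minor_scale) (use assms in simp)
  finally show ?thesis using assms by (simp add: prod_list_const)
qed

text \<open>The list \<open>seg\<close> once more, as a constant that stays folded during
  simplification.\<close>

definition sg :: "nat \<Rightarrow> nat \<Rightarrow> (nat \<times> nat) list" where
  "sg g k = map (Pair g) [1..<Suc k]"

lemmas br222_minor = br222_minor_seg[folded sg_def]
lemmas br211_minor = br211_minor_seg[folded sg_def]
lemmas br211_minor_direct = br211_minor_direct_seg[folded sg_def]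
lemmas br111_middle_minor = br111_middle_minor_seg[folded sg_def]
lemmas top_two_flags_minor = top_two_flags_minor_seg[folded sg_def]
lemmas br111_zero_minor = br111_zero_minor_seg[folded sg_def]

lemma sg_Suc: "sg g (Suc k) = sg g k @ [(g, Suc k)]"
  by (simp add: sg_def upt_Suc_append)

lemma sg_0 [simp]: "sg g 0 = []"
  by (simp add: sg_def)

lemma length_sg [simp]: "length (sg g k) = k"
  by (simp add: sg_def)

lemma nth_sg [simp]: "i < k \<Longrightarrow> sg g k ! i = (g, Suc i)"
  by (simp add: sg_def)

lemma set_sg: "x \<in> set (sg g k) \<longleftrightarrow> fst x = g \<and> 1 \<le> snd x \<and> snd x \<le> k"
  by (cases x) (auto simp: sg_def)

lemma pairing_same_seg:
  assumes "Z \<in> flag_triples n" "r \<in> set (sg g k)" "c \<in> set (sg g l)" "k + l \<le> 2 * n"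
  shows "pairing n Z r c = 0"
proof -
  have "r = (g, snd r)" "c = (g, snd c)" using assms(2,3) by (auto simp: set_sg prod_eq_iff)
  moreover have "pairing n Z (g, snd r) (g, snd c) = 0"
    by (rule pairing_same[OF assms(1)]) (use assms(2-4) in \<open>auto simp: set_sg\<close>)
  ultimately show ?thesis by metis
qed

text \<open>Raising c or a appends a C- or an A-row to the core, and lowering \<open>Suc d\<close>
  or \<open>Suc b\<close> appends a C- or an A-column. The six functions are thus the core and its
  borders, and the relation is the Desnanot--Jacobi identity once the new rows and columns have been
  moved to the end. All signs of these moves cancel.\<close>

lemma octahedron:
  assumes Z: "Z \<in> flag_triples n"
    and abcd: "a < n" "n \<le> b" "Suc b \<le> 2 * n" "Suc d \<le> 2 * n" "a + b + c + d + 2 = 4 * n"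
    and core: "br222 n a (Suc b) c (Suc d) Z \<noteq> 0"
  shows "br222 n a (Suc b) (Suc c) d Z * br222 n (Suc a) b c (Suc d) Z =
    br222 n (Suc a) b (Suc c) d Z * br222 n a (Suc b) c (Suc d) Z +
    br222 n (Suc a) (Suc b) c d Z * br222 n a b (Suc c) (Suc d) Z"
proof -
  define e q where "e = 2 * n - Suc d" and "q = 2 * n - Suc b"
  have eq: "2 * n - Suc d = e" "2 * n - d = Suc e" "2 * n - Suc b = q" "2 * n - b = Suc q"
    using abcd by (auto simp: e_def q_def)
  have size: "a + c = e + q" using abcd by (auto simp: e_def q_def)
  let ?m = "pairing0 n Z"
  define R C where "R = sg 1 n @ sg 2 c @ sg 0 a" and "C = sg 2 e @ sg 0 q @ sg 1 n"
  let ?x = "(2, Suc c)" and ?y = "(0, Suc a)" and ?p = "(2, Suc e)" and ?q = "(0, Suc q)"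
  have lR: "length R = n + c + a" and lC: "length C = n + c + a" using size by (auto simp: R_def C_def)
  have r1: "minor ?m (sg 1 n @ sg 2 (Suc c) @ sg 0 a) cs = (-1) ^ a * minor ?m (R @ [?x]) cs" if "length cs = Suc (n + c + a)" for cs
    using minor_move[of "sg 1 n @ sg 2 c" ?x "sg 0 a" "[]" cs ?m] that by (simp add: sg_Suc R_def)
  have r2: "minor ?m (sg 1 n @ sg 2 (Suc c) @ sg 0 (Suc a)) cs = (-1) ^ a * minor ?m (R @ [?x, ?y]) cs" if "length cs = Suc (Suc (n + c + a))" for cs
    using minor_move[of "sg 1 n @ sg 2 c" ?x "sg 0 a" "[?y]" cs ?m] that by (simp add: sg_Suc R_def)
  have r3: "sg 1 n @ sg 2 c @ sg 0 (Suc a) = R @ [?y]" by (simp add: sg_Suc R_def)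
  have c1: "minor ?m rs (sg 2 (Suc e) @ sg 0 q @ sg 1 n) = (-1) ^ (q + n) * minor ?m rs (C @ [?p])" if "length rs = Suc (n + c + a)" for rs
    using minor_move_cols[of rs "sg 2 e" ?p "sg 0 q @ sg 1 n" "[]" ?m] that size by (simp add: sg_Suc C_def)
  have c2: "minor ?m rs (sg 2 e @ sg 0 (Suc q) @ sg 1 n) = (-1) ^ n * minor ?m rs (C @ [?q])" if "length rs = Suc (n + c + a)" for rs
    using minor_move_cols[of rs "sg 2 e @ sg 0 q" ?q "sg 1 n" "[]" ?m] that size by (simp add: sg_Suc C_def)
  have c3: "minor ?m rs (sg 2 (Suc e) @ sg 0 (Suc q) @ sg 1 n) = (-1) ^ n * ((-1) ^ (q + n) * minor ?m rs (C @ [?p, ?q]))" if "length rs = Suc (Suc (n + c + a))" for rs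
    using minor_move_cols[of rs "sg 2 (Suc e) @ sg 0 q" ?q "sg 1 n" "[]" ?m]
      minor_move_cols[of rs "sg 2 e" ?p "sg 0 q @ sg 1 n" "[?q]" ?m] that size by (simp add: sg_Suc C_def)
  have F1: "br222 n a (Suc b) (Suc c) d Z = (-1) ^ (a + d) * ((-1) ^ (q + n) * ((-1) ^ a * minor ?m (R @ [?x]) (C @ [?p])))"
    using br222_minor[OF Z, of a "Suc b" d "Suc c"] abcd by (simp add: eq c1 r1 lR lC del: One_nat_def)
  have F2: "br222 n (Suc a) b c (Suc d) Z = (-1) ^ (a + d) * ((-1) ^ n * minor ?m (R @ [?y]) (C @ [?q]))"
    using br222_minor[OF Z, of "Suc a" b "Suc d" c] abcd by (simp add: eq c2 r3 lR lC del: One_nat_def)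
  have F3: "br222 n (Suc a) b (Suc c) d Z = (-1) ^ Suc (a + d) * ((-1) ^ n * ((-1) ^ (q + n) * ((-1) ^ a * minor ?m (R @ [?x, ?y]) (C @ [?p, ?q]))))"
    using br222_minor[OF Z, of "Suc a" b d "Suc c"] abcd by (simp add: eq c3 r2 lR lC del: One_nat_def)
  have F4: "br222 n a (Suc b) c (Suc d) Z = (-1) ^ Suc (a + d) * minor ?m R C"
    using br222_minor[OF Z, of a "Suc b" "Suc d" c] abcd by (simp add: eq R_def C_def del: One_nat_def)
  have F5: "br222 n (Suc a) (Suc b) c d Z = (-1) ^ Suc (a + d) * ((-1) ^ (q + n) * minor ?m (R @ [?y]) (C @ [?p]))"
    using br222_minor[OF Z, of "Suc a" "Suc b" d c] abcd by (simp add: eq c1 r3 lR lC del: One_nat_def)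
  have F6: "br222 n a b (Suc c) (Suc d) Z = (-1) ^ Suc (a + d) * ((-1) ^ n * ((-1) ^ a * minor ?m (R @ [?x]) (C @ [?q])))"
    using br222_minor[OF Z, of a b "Suc d" "Suc c"] abcd by (simp add: eq c2 r1 lR lC del: One_nat_def)
  have nz: "minor ?m R C \<noteq> 0" using core unfolding F4 by auto
  have dj: "minor ?m (R @ [?x]) (C @ [?p]) * minor ?m (R @ [?y]) (C @ [?q]) =
      minor ?m (R @ [?x, ?y]) (C @ [?p, ?q]) * minor ?m R C + minor ?m (R @ [?y]) (C @ [?p]) * minor ?m (R @ [?x]) (C @ [?q])"
    by (rule desnanot_jacobi) (use lR lC nz in \<open>auto simp: R_def set_sg\<close>)
  have s: "(-1) ^ k * ((-1) ^ k * z) = (z :: complex)" for k z by simp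
  show ?thesis
    unfolding F1 F2 F3 F4 F5 F6 power_add power_Suc using dj
    by (cases "even a"; cases "even d"; cases "even q"; cases "even n"; simp)
qed

lemma minor_pairing0:
  assumes "length rs = length cs" "\<And>r c. r \<in> set rs \<Longrightarrow> c \<in> set cs \<Longrightarrow> fst r \<noteq> 0 \<or> fst c \<noteq> 2"
  shows "minor (pairing0 n Z) rs cs = minor (pairing n Z) rs cs"
proof (rule minor_cong[OF assms(1)])
  fix r c assume "r \<in> set rs" "c \<in> set cs"
  from assms(2)[OF this] show "pairing0 n Z r c = pairing n Z r c" by (auto simp: pairing0_def)
qed

text \<open>For d = n the C-columns meet the B-rows only: they are orthogonal to the C-rows, and cut
  off from the A-rows. This square block is \<open>[0; n; n]\<close>.\<close>

lemma br222_initial: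
  assumes Z: "Z \<in> flag_triples n" and abc: "a \<le> n" "n \<le> b" "b \<le> 2 * n" "c \<le> n" "a + b + c = 3 * n"
  shows "br222 n a b c n Z = br111 n 0 n n Z * br211 n a b n c Z"
proof -
  let ?q = "2 * n - b"
  have n: "2 * n - n = n" by simp
  have size: "c + a = ?q + n" using abc by auto
  have "br222 n a b c n Z = (-1) ^ (a + n) * minor (pairing0 n Z) (sg 1 n @ (sg 2 c @ sg 0 a)) (sg 2 n @ (sg 0 ?q @ sg 1 n))"
    using br222_minor[OF Z, of a b n c] abc by (simp add: n)
  also have "minor (pairing0 n Z) (sg 1 n @ (sg 2 c @ sg 0 a)) (sg 2 n @ (sg 0 ?q @ sg 1 n)) =
      minor (pairing0 n Z) (sg 1 n) (sg 2 n) * minor (pairing0 n Z) (sg 2 c @ sg 0 a) (sg 0 ?q @ sg 1 n)"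
  proof (rule minor_block_upper)
    fix r k assume "r \<in> set (sg 2 c @ sg 0 a)" "k \<in> set (sg 2 n)"
    then show "pairing0 n Z r k = 0"
      using pairing_same_seg[OF Z, of r 2 c k n] abc by (auto simp: pairing0_def set_sg)
  qed (use size in \<open>auto simp: set_sg\<close>)
  also have "minor (pairing0 n Z) (sg 1 n) (sg 2 n) = minor (pairing n Z) (sg 1 n) (sg 2 n)"
    by (rule minor_pairing0) (auto simp: set_sg)
  also have "\<dots> = (-1) ^ n * minor (pairing n Z) (sg 2 n) (sg 1 n)"
    by (subst minor_pairing_swap) auto
  also have "minor (pairing n Z) (sg 2 n) (sg 1 n) = br111 n 0 n n Z"
    using br111_middle_minor[OF Z, of 0 n] by simp
  also have "minor (pairing0 n Z) (sg 2 c @ sg 0 a) (sg 0 ?q @ sg 1 n) = minor (pairing n Z) (sg 2 c @ sg 0 a) (sg 0 ?q @ sg 1 n)"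
    by (rule minor_pairing0) (use size in \<open>auto simp: set_sg\<close>)
  finally show ?thesis
    using br211_minor[OF Z, of a b n c] abc by (simp add: n power_add)
qed

lemma top_frozen:
  assumes Z: "Z \<in> flag_triples n"
  shows "minor (pairing n Z) (sg 0 n) (sg 1 n) = (-1) ^ n * top_coeff n (flag_form (flag_of Z 0) n \<and>\<^sub>e flag_form (flag_of Z 1) n)"
  using top_two_flags_minor[OF Z, of n n 0 1] by (subst minor_pairing_swap) auto

lemma br211_boundary:
  assumes Z: "Z \<in> flag_triples n" and c: "c \<le> n"
  shows "br211 n n (2 * n - c) n c Z =
    top_coeff n (flag_form (flag_of Z 0) n \<and>\<^sub>e flag_form (flag_of Z 1) n) * br111 n (2 * n - c) 0 c Z"
proof -
  have n: "2 * n - n = n" "2 * n - (2 * n - c) = c" using c by auto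
  have "br211 n n (2 * n - c) n c Z = (-1) ^ n * minor (pairing n Z) (sg 2 c @ sg 0 n) (sg 0 c @ sg 1 n)"
    using br211_minor[OF Z, of n "2 * n - c" n c] c by (simp add: n)
  also have "minor (pairing n Z) (sg 2 c @ sg 0 n) (sg 0 c @ sg 1 n) =
      minor (pairing n Z) (sg 2 c) (sg 0 c) * minor (pairing n Z) (sg 0 n) (sg 1 n)"
    by (rule minor_block_upper) (use pairing_same_seg[OF Z, of _ 0 n _ c] c in auto)
  finally show ?thesis
    unfolding top_frozen[OF Z] using br111_zero_minor[OF Z, of c] c by simp
qed

section \<open>Cyclic rotation of the flags\<close>

lemma br112_permute: "br112 n a b c d (A, B, C) = br211 n c d a b (neg_flag C, A, B)"
  by (simp add: br112_def)

lemma symplectic_basis_neg: "symplectic_basis n v \<Longrightarrow> symplectic_basis n (neg_flag v)"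
  by (simp add: symplectic_basis_def neg_flag_def symplectic_form_def)

text \<open>The triple through which \<open>[a; b; c, d]\<close> is reduced to a bracket of the
  other type. \<open>rot_index\<close> translates its labels back, and \<open>rot_sign\<close>
  accounts for the negated flag.\<close>

definition rotated :: "flags \<Rightarrow> flags" where
  "rotated Z = (neg_flag (flag_of Z 2), flag_of Z 0, flag_of Z 1)"

definition rot_index :: "nat \<times> nat \<Rightarrow> nat \<times> nat" where
  "rot_index r = (if fst r = 0 then 2 else fst r - 1, snd r)"

definition rot_sign :: "nat \<times> nat \<Rightarrow> complex" where
  "rot_sign r = (if fst r = 0 then -1 else 1)"

lemma rotated_triples: "Z \<in> flag_triples n \<Longrightarrow> rotated Z \<in> flag_triples n"
  using flag_triplesD[of Z n] symplectic_basis_neg by (simp add: rotated_def flag_triples_def)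

lemma pairing_rotated:
  assumes "fst r \<le> 2" "fst c \<le> 2"
  shows "pairing n (rotated Z) r c = rot_sign r * rot_sign c * pairing n Z (rot_index r) (rot_index c)"
proof -
  have s: "symplectic_form n (\<lambda>a. - x a) y = - symplectic_form n x y" "symplectic_form n x (\<lambda>a. - y a) = - symplectic_form n x y" for x y
    by (simp_all add: symplectic_form_def sum_negf[symmetric] algebra_simps)
  have f: "flag_of (rotated Z) 0 = (\<lambda>i a. - flag_of Z 2 i a)" "flag_of (rotated Z) (Suc 0) = flag_of Z 0"
    "flag_of (rotated Z) 2 = flag_of Z (Suc 0)"
    by (simp_all add: rotated_def flag_of_def neg_flag_def)
  have "fst r = 0 \<or> fst r = 1 \<or> fst r = 2" "fst c = 0 \<or> fst c = 1 \<or> fst c = 2" using assms by linarith+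
  then show ?thesis
    by (elim disjE) (simp_all add: pairing_def rot_index_def rot_sign_def f s)
qed

lemma minor_rotated:
  assumes "length rs = length cs" "\<And>r. r \<in> set rs \<union> set cs \<Longrightarrow> fst r \<le> 2"
  shows "minor (pairing n (rotated Z)) rs cs = (\<Prod>r\<leftarrow>rs. rot_sign r) * (\<Prod>c\<leftarrow>cs. rot_sign c) *
    minor (pairing n Z) (map rot_index rs) (map rot_index cs)"
proof -
  have "minor (pairing n (rotated Z)) rs cs = minor (\<lambda>r c. rot_sign r * rot_sign c * pairing n Z (rot_index r) (rot_index c)) rs cs"
    using assms by (intro minor_cong pairing_rotated) auto
  then show ?thesis
    by (simp add: minor_scale[OF assms(1)] minor_map[OF assms(1)])
qed

lemma rot_seg: "map rot_index (sg g k) = sg (if g = 0 then 2 else g - 1) k"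
  "(\<Prod>r\<leftarrow>sg g k. rot_sign r) = (if g = 0 then (-1) ^ k else 1)"
  by (simp_all add: sg_def rot_index_def rot_sign_def comp_def prod_list_const)

lemma br112_rotated: "br112 n a b c d Z = br211 n c d a b (rotated Z)"
  using br112_permute[of n a b c d "flag_of Z 0" "flag_of Z 1" "flag_of Z 2"] by (simp add: rotated_def flag_of_def)

lemma br112_minor:
  assumes Z: "Z \<in> flag_triples n" and bcd: "c \<le> d" "d \<le> 2 * n" "n \<le> d" "n \<le> b" "b \<le> 2 * n" "b + c + d = 3 * n"
  shows "br112 n b n c d Z = (-1) ^ d * minor (pairing n Z) (sg 1 n @ sg 2 c) (sg 2 (2 * n - d) @ sg 0 (2 * n - b))"
proof -
  have "br112 n b n c d Z = (-1) ^ c * minor (pairing n (rotated Z)) (sg 2 n @ sg 0 c) (sg 0 (2 * n - d) @ sg 1 (2 * n - b))"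
    unfolding br112_rotated by (rule br211_minor[OF rotated_triples[OF Z]]) (use bcd in auto)
  also have "\<dots> = (-1) ^ c * ((-1) ^ c * (-1) ^ (2 * n - d) * minor (pairing n Z) (sg 1 n @ sg 2 c) (sg 2 (2 * n - d) @ sg 0 (2 * n - b)))"
  proof (subst minor_rotated)
    show "length (sg 2 n @ sg 0 c) = length (sg 0 (2 * n - d) @ sg 1 (2 * n - b))" using bcd by auto
  qed (auto simp: map_append rot_seg set_sg simp del: map_map)
  also have "(-1) ^ (2 * n - d) = ((-1) ^ d :: complex)"
    by (rule minus_one_power_eqI) (use bcd in simp)
  finally show ?thesis by simp
qed

lemma br112_minor_direct:
  assumes Z: "Z \<in> flag_triples n" and bcd: "c \<le> d" "d \<le> 2 * n" "b \<le> n" "2 * n \<le> d + b" "b + c + d = 3 * n"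
  shows "br112 n b n c d Z = (-1) ^ ((c + n) * d + n + c * n + d) *
    minor (pairing n Z) (sg 0 b @ sg 2 c) (sg 2 (2 * n - d) @ sg 1 n)"
proof -
  have n: "2 * n - n = n" by simp
  have "br112 n b n c d Z = (-1) ^ ((c + n) * d + n + c + c * n) *
      minor (pairing n (rotated Z)) (sg 1 b @ sg 0 c) (sg 0 (2 * n - d) @ sg 2 (2 * n - n))"
    unfolding br112_rotated by (rule br211_minor_direct[OF rotated_triples[OF Z]]) (use bcd in auto)
  also have "\<dots> = (-1) ^ ((c + n) * d + n + c + c * n) * ((-1) ^ c * (-1) ^ (2 * n - d) * minor (pairing n Z) (sg 0 b @ sg 2 c) (sg 2 (2 * n - d) @ sg 1 n))"
    unfolding n
  proof (subst minor_rotated)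
    show "length (sg 1 b @ sg 0 c) = length (sg 0 (2 * n - d) @ sg 2 n)" using bcd by auto
  qed (auto simp: map_append rot_seg set_sg simp del: map_map)
  also have "(-1) ^ (2 * n - d) = ((-1) ^ d :: complex)"
    by (rule minus_one_power_eqI) (use bcd in simp)
  finally show ?thesis by (simp add: power_add mult_ac)
qed

text \<open>The left side is expanded by the Hodge dual formula, the right side by the direct one.
  Both minors pair the vectors B_1, ..., B_n, C_1, ..., C_(j-i) with A_1, ..., A_j, C_1, ...,
  C_(n-i), with rows and columns interchanged; skew-symmetry and swaps of blocks identify them, and
  the signs cancel.\<close>

lemma br112_symmetric:
  assumes Z: "Z \<in> flag_triples n" and ij: "i < j" "j \<le> n"
  shows "br112 n (2 * n - j) n (j - i) (n + i) Z = br112 n j n (n - i) (2 * n + i - j) Z"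
proof -
  define k l where "k = j - i" and "l = n - i"
  have kl: "j = i + k" "n = i + l" "k \<le> l" "0 < k" using ij by (auto simp: k_def l_def)
  have e: "2 * n - (n + i) = l" "2 * n - (2 * n - j) = j" "2 * n - (2 * n + i - j) = k" "j - i = k" "n - i = l"
    using kl by auto
  let ?m = "pairing n Z"
  have "br112 n j n l (2 * n + i - j) Z = (-1) ^ ((l + n) * (2 * n + i - j) + n + l * n + (2 * n + i - j)) *
      minor ?m (sg 0 j @ sg 2 l) (sg 2 k @ sg 1 n)"
  proof -
    have "br112 n j n l (2 * n + i - j) Z = (-1) ^ ((l + n) * (2 * n + i - j) + n + l * n + (2 * n + i - j)) *
        minor ?m (sg 0 j @ sg 2 l) (sg 2 (2 * n - (2 * n + i - j)) @ sg 1 n)"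
      by (rule br112_minor_direct[OF Z]) (use kl in auto)
    then show ?thesis unfolding e(3) .
  qed
  also have "minor ?m (sg 0 j @ sg 2 l) (sg 2 k @ sg 1 n) = (-1) ^ (j + l) * minor ?m (sg 2 k @ sg 1 n) (sg 0 j @ sg 2 l)"
    by (subst minor_pairing_swap) (use kl in auto)
  also have "minor ?m (sg 2 k @ sg 1 n) (sg 0 j @ sg 2 l) = (-1) ^ (k * n) * minor ?m (sg 1 n @ sg 2 k) (sg 0 j @ sg 2 l)"
    using minor_swap_blocks[of "[]" "sg 2 k" "sg 1 n" "[]" "sg 0 j @ sg 2 l" ?m] kl by simp
  also have "minor ?m (sg 1 n @ sg 2 k) (sg 0 j @ sg 2 l) = (-1) ^ (j * l) * minor ?m (sg 1 n @ sg 2 k) (sg 2 l @ sg 0 j)"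
    using minor_swap_blocks_cols[of "sg 1 n @ sg 2 k" "[]" "sg 0 j" "sg 2 l" "[]" ?m] kl by simp
  also have "(-1) ^ ((l + n) * (2 * n + i - j) + n + l * n + (2 * n + i - j)) * ((-1) ^ (j + l) * ((-1) ^ (k * n) * ((-1) ^ (j * l) * z))) =
      (-1) ^ (n + i) * z" for z :: complex
  proof -
    define x where "x = 2 * n + i - j"
    have "x + k = 2 * n" using kl by (auto simp: x_def)
    then have "even (x + k)" by simp
    moreover have "even (j + (i + k))" "even (n + (i + l))" using kl(1,2) by simp_all
    ultimately have "even ((l + n) * x + n + l * n + x + (j + l) + k * n + j * l + (n + i))"
      by (cases "even i"; cases "even k"; cases "even l"; simp)
    then have "even ((l + n) * (2 * n + i - j) + n + l * n + (2 * n + i - j) + (j + l) + k * n + j * l + (n + i))"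
      unfolding x_def .
    from minus_one_power_eqI[OF this] show ?thesis by (simp add: power_add mult.assoc)
  qed
  also have "(-1) ^ (n + i) * minor ?m (sg 1 n @ sg 2 k) (sg 2 l @ sg 0 j) = br112 n (2 * n - j) n k (n + i) Z"
  proof -
    have "br112 n (2 * n - j) n k (n + i) Z = (-1) ^ (n + i) *
        minor ?m (sg 1 n @ sg 2 k) (sg 2 (2 * n - (n + i)) @ sg 0 (2 * n - (2 * n - j)))"
      by (rule br112_minor[OF Z]) (use kl in auto)
    then show ?thesis unfolding e(1,2) by (rule sym)
  qed
  finally show ?thesis unfolding e(4,5) by (rule sym)
qed

text \<open>For a = n the A-rows are orthogonal to the A-columns and cut off from the C-columns, so
  they form a square block with the B-columns. That block is the function of \<open>Y n\<close> up
  to sign.\<close>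

lemma br222_final:
  assumes Z: "Z \<in> flag_triples n" and bcd: "c \<le> n" "d \<le> 2 * n" "n \<le> d" "n \<le> b" "b \<le> 2 * n" "b + c + d = 3 * n"
  shows "br222 n n b c d Z = top_coeff n (flag_form (flag_of Z 0) n \<and>\<^sub>e flag_form (flag_of Z 1) n) * br112 n b n c d Z"
proof -
  let ?e = "2 * n - d" and ?q = "2 * n - b"
  have "br222 n n b c d Z = (-1) ^ (n + d) * minor (pairing0 n Z) ((sg 1 n @ sg 2 c) @ sg 0 n) ((sg 2 ?e @ sg 0 ?q) @ sg 1 n)"
    using br222_minor[OF Z, of n b d c] bcd by simp
  also have "minor (pairing0 n Z) ((sg 1 n @ sg 2 c) @ sg 0 n) ((sg 2 ?e @ sg 0 ?q) @ sg 1 n) =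
      minor (pairing0 n Z) (sg 1 n @ sg 2 c) (sg 2 ?e @ sg 0 ?q) * minor (pairing0 n Z) (sg 0 n) (sg 1 n)"
  proof (rule minor_block_upper)
    fix r k assume "r \<in> set (sg 0 n)" "k \<in> set (sg 2 ?e @ sg 0 ?q)"
    then show "pairing0 n Z r k = 0"
      using pairing_same_seg[OF Z, of r 0 n k ?q] bcd by (auto simp: pairing0_def set_sg)
  qed (use bcd in auto)
  also have "minor (pairing0 n Z) (sg 1 n @ sg 2 c) (sg 2 ?e @ sg 0 ?q) = minor (pairing n Z) (sg 1 n @ sg 2 c) (sg 2 ?e @ sg 0 ?q)"
    by (rule minor_pairing0) (use bcd in \<open>auto simp: set_sg\<close>)
  also have "minor (pairing0 n Z) (sg 0 n) (sg 1 n) = minor (pairing n Z) (sg 0 n) (sg 1 n)"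
    by (rule minor_pairing0) (auto simp: set_sg)
  finally show ?thesis
    unfolding top_frozen[OF Z] using br112_minor[OF Z, of c d b] bcd by (simp add: power_add)
qed

text \<open>The B-rows vanish on the B-columns. When a + c = n, the B-columns form a square block
  with the C- and A-rows, and the matrix falls apart into two blocks.\<close>

lemma br222_diagonal:
  assumes Z: "Z \<in> flag_triples n" and abcd: "a + c = n" "n \<le> b" "b \<le> 2 * n" "n \<le> d" "d \<le> 2 * n" "b + d = 3 * n"
  shows "br222 n a b c d Z = br111 n a n c Z * br111 n (2 * n - b) n (2 * n - d) Z"
proof -
  define e q where "e = 2 * n - d" and "q = 2 * n - b"
  have eq: "q + e = n" "e + q = n" "d + e = 2 * n" using abcd by (auto simp: e_def q_def)
  have "br222 n a b c d Z = (-1) ^ (a + d) * minor (pairing0 n Z) (sg 1 n @ (sg 2 c @ sg 0 a)) ((sg 2 e @ sg 0 q) @ sg 1 n)"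
    using br222_minor[OF Z, of a b d c] abcd by (simp add: e_def q_def)
  also have "minor (pairing0 n Z) (sg 1 n @ (sg 2 c @ sg 0 a)) ((sg 2 e @ sg 0 q) @ sg 1 n) =
      minor (pairing0 n Z) (sg 1 n) (sg 2 e @ sg 0 q) * minor (pairing0 n Z) (sg 2 c @ sg 0 a) (sg 1 n)"
  proof (rule minor_block_lower)
    fix r k assume "r \<in> set (sg 1 n)" "k \<in> set (sg 1 n)"
    then show "pairing0 n Z r k = 0"
      using pairing_same_seg[OF Z, of r 1 n k n] by (auto simp: pairing0_def)
  qed (use eq abcd in auto)
  also have "minor (pairing0 n Z) (sg 1 n) (sg 2 e @ sg 0 q) = minor (pairing n Z) (sg 1 n) (sg 2 e @ sg 0 q)"
    by (rule minor_pairing0) (use eq in \<open>auto simp: set_sg\<close>)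
  also have "\<dots> = (-1) ^ n * minor (pairing n Z) (sg 2 e @ sg 0 q) (sg 1 n)"
    by (subst minor_pairing_swap) (use eq in auto)
  also have "minor (pairing n Z) (sg 2 e @ sg 0 q) (sg 1 n) = (-1) ^ q * br111 n q n e Z"
    using br111_middle_minor[OF Z eq(1)] by simp
  also have "minor (pairing0 n Z) (sg 2 c @ sg 0 a) (sg 1 n) = minor (pairing n Z) (sg 2 c @ sg 0 a) (sg 1 n)"
    by (rule minor_pairing0) (use abcd in \<open>auto simp: set_sg\<close>)
  also have "\<dots> = (-1) ^ a * br111 n a n c Z"
    using br111_middle_minor[OF Z abcd(1)] by simp
  also have "(-1) ^ (a + d) * ((-1) ^ n * ((-1) ^ q * x) * ((-1) ^ a * y)) = y * x" for x y :: complex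
  proof -
    have "even (d + e)" unfolding eq by simp
    then have "even (a + d + n + q + a + 0)" unfolding eq(1)[symmetric] by auto
    from minus_one_power_eqI[OF this] have "(-1) ^ (a + d) * ((-1) ^ n * ((-1) ^ q * (-1) ^ a)) = (1 :: complex)"
      by (simp add: power_add mult_ac)
    then have "(-1) ^ (a + d) * ((-1) ^ n * ((-1) ^ q * (-1) ^ a)) * (y * x) = y * x" by (simp only: mult_1)
    then show ?thesis by (simp only: mult_ac)
  qed
  finally show ?thesis by (simp add: e_def q_def)
qed

text \<open>Expanding the pairings of \<open>A\<close> and \<open>C\<close> in the symplectic basis \<open>B\<close> shows that
  subtracting suitable multiples of the columns and the rows of \<open>B\<close> moves the nonzero block from
  \<open>(C, A)\<close> to \<open>(A, C)\<close>, which transposes the matrix up to signs.\<close>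

lemma br222_dual:
  assumes Z: "Z \<in> flag_triples n"
    and abcd: "a \<le> n" "n \<le> b" "b \<le> 2 * n" "c \<le> n" "n \<le> d" "d \<le> 2 * n" "a + b + c + d = 4 * n"
  shows "br222 n a b c d Z = br222 n (2 * n - b) (2 * n - a) (2 * n - d) (2 * n - c) Z"
proof -
  define e q where "e = 2 * n - d" and "q = 2 * n - b"
  have size: "a + c = e + q" "e \<le> n" "q \<le> n" "d + e = 2 * n" using abcd by (auto simp: e_def q_def)
  define m1 where "m1 = pairing0 n Z"
  define m2 where "m2 = (\<lambda>r c. if fst r = 2 \<and> fst c = 0 then 0 else pairing n Z r c)"
  \<comment> \<open>Coefficients of the expansion in the basis B. By \<open>expand\<close>, a
    pairing is a combination of the rows B_1, ..., B_n plus a combination of the columns B_1, ...,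
    B_n.\<close>
  define \<alpha> where "\<alpha> = (\<lambda>r i. (-1) ^ Suc i * symplectic_form n (flag_of Z 1 (2 * n - i)) (flag_of Z (fst r) (snd r)))"
  define \<beta> where "\<beta> = (\<lambda>c i. (-1) ^ (2 * n - i) * symplectic_form n (flag_of Z (fst c) (snd c)) (flag_of Z 1 (2 * n - i)))"
  have expand: "pairing n Z r c = (\<Sum>i<n. \<alpha> r i * pairing n Z (1, Suc i) c) + (\<Sum>i<n. pairing n Z r (1, Suc i) * \<beta> c i)" for r c
  proof -
    let ?y = "flag_of Z (fst c) (snd c)" and ?x = "flag_of Z (fst r) (snd r)" and ?v = "flag_of Z 1"
    let ?t = "\<lambda>k. (-1) ^ k * symplectic_form n ?y (?v k) * symplectic_form n (?v (2 * n + 1 - k)) ?x"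
    have "pairing n Z r c = (\<Sum>k=1..2 * n. ?t k)"
      unfolding pairing_def by (rule symplectic_form_expansion[OF flag_triplesD[OF Z]])
    also have "\<dots> = (\<Sum>k=1..n. ?t k) + (\<Sum>k=n + 1..2 * n. ?t k)"
    proof -
      have "{1..2 * n} = {1..n} \<union> {n + 1..2 * n}" "{1..n} \<inter> {n + 1..2 * n} = {}" by auto
      then show ?thesis by (simp add: sum.union_disjoint)
    qed
    also have "(\<Sum>k=1..n. ?t k) = (\<Sum>i<n. \<alpha> r i * pairing n Z (1, Suc i) c)"
    proof (rule sum.reindex_bij_witness[of _ Suc "\<lambda>k. k - 1"])
      fix k assume "k \<in> {1..n}"
      then obtain l where "k = Suc l" by (cases k) auto
      then show "\<alpha> r (k - 1) * pairing n Z (1, Suc (k - 1)) c = ?t k"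
        by (simp add: \<alpha>_def pairing_def mult_ac)
    qed auto
    also have "(\<Sum>k=n + 1..2 * n. ?t k) = (\<Sum>i<n. pairing n Z r (1, Suc i) * \<beta> c i)"
      by (rule sum.reindex_bij_witness[of _ "\<lambda>i. 2 * n - i" "\<lambda>k. 2 * n - k"]) (auto simp: \<beta>_def pairing_def mult_ac Suc_diff_le)
    finally show ?thesis .
  qed
  have BB: "pairing n Z r c = 0" if "r \<in> set (sg 1 n)" "c \<in> set (sg 1 n)" for r c
    by (rule pairing_same_seg[OF Z that]) simp
  define R C where "R = sg 2 c @ sg 0 a" and "C = sg 2 e @ sg 0 q"
  have len: "length R = length C" "length R = a + c" "length C = a + c" using size by (auto simp: R_def C_def)
  have gR: "fst r = 2 \<or> fst r = 0" if "r \<in> set R" for r using that by (auto simp: R_def set_sg)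
  have gC: "fst r = 2 \<or> fst r = 0" if "r \<in> set C" for r using that by (auto simp: C_def set_sg)
  have same: "pairing n Z r c' = 0" if "r \<in> set R" "c' \<in> set C" "fst r = fst c'" for r c'
    using that pairing_same_seg[OF Z, of r 2 c c' e] pairing_same_seg[OF Z, of r 0 a c' q] abcd size
    by (auto simp: R_def C_def set_sg)
  have nth: "i < n \<Longrightarrow> sg 1 n ! i = (1, Suc i)" for i by (rule nth_sg)
  have inB: "i < n \<Longrightarrow> (1, Suc i) \<in> set (sg 1 n)" for i by (simp add: set_sg)
  \<comment> \<open>Columns are reduced first, then rows. Away from B this subtracts the full
    pairing: entries that were kept become zero, and those that were cut off reappear with a minus
    sign.\<close>
  define m' where "m' = (\<lambda>r c. if fst c = 1 then m1 r c else m1 r c - (\<Sum>i<n. pairing n Z r (1, Suc i) * \<beta> c i))"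
  define m'' where "m'' = (\<lambda>r c. if fst r = 1 then m' r c else m' r c - (\<Sum>i<n. \<alpha> r i * m' (1, Suc i) c))"
  have col: "minor m' (sg 1 n @ R) (sg 1 n @ C) = minor m1 (sg 1 n @ R) (sg 1 n @ C)"
  proof (rule minor_column_operation[where lam = "\<lambda>c i. - \<beta> c i"])
    fix r w assume r: "r \<in> set (sg 1 n @ R)" and w: "w \<in> set C"
    have "m1 r (1, Suc i) = pairing n Z r (1, Suc i)" for i by (simp add: m1_def pairing0_def)
    then show "m' r w = m1 r w + (\<Sum>i<length (sg 1 n). - \<beta> w i * m1 r (sg 1 n ! i))"
      using gC[OF w] by (auto simp: m'_def sum_negf nth mult.commute)
  qed (use len in \<open>auto simp: m'_def set_sg\<close>)
  have row: "minor m'' (sg 1 n @ R) (sg 1 n @ C) = minor m' (sg 1 n @ R) (sg 1 n @ C)"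
  proof (rule minor_row_operation[where lam = "\<lambda>r i. - \<alpha> r i"])
    fix w c' assume w: "w \<in> set R"
    show "m'' w c' = m' w c' + (\<Sum>i<length (sg 1 n). - \<alpha> w i * m' (sg 1 n ! i) c')"
      using gR[OF w] by (auto simp: m''_def sum_negf nth)
  qed (use len in \<open>auto simp: m''_def set_sg\<close>)
  define s where "s = (\<lambda>r :: nat \<times> nat. if fst r = 1 then 1 else -1 :: complex)"
  define t where "t = (\<lambda>c :: nat \<times> nat. if fst c = 1 then -1 else 1 :: complex)"
  have m'B: "m' (1, Suc i) c' = pairing n Z (1, Suc i) c'" if "i < n" "c' \<in> set (sg 1 n @ C)" for i c'
  proof -
    have "(\<Sum>l<n. pairing n Z (1, Suc i) (1, Suc l) * \<beta> c' l) = 0"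
      by (rule sum.neutral) (use BB inB that in auto)
    then show ?thesis by (simp add: m'_def m1_def pairing0_def)
  qed
  have "minor m'' (sg 1 n @ R) (sg 1 n @ C) = minor (\<lambda>r c. s r * t c * m2 r c) (sg 1 n @ R) (sg 1 n @ C)"
  proof (rule minor_cong)
    show "length (sg 1 n @ R) = length (sg 1 n @ C)" using len by simp
    fix r c' assume r: "r \<in> set (sg 1 n @ R)" and c': "c' \<in> set (sg 1 n @ C)"
    show "m'' r c' = s r * t c' * m2 r c'"
    proof (cases "r \<in> set (sg 1 n)")
      case True
      then have "fst r = 1" "1 \<le> snd r" "snd r \<le> n" by (simp_all add: set_sg)
      then have "r = (1, Suc (snd r - 1))" "snd r - 1 < n" by (simp_all add: prod_eq_iff)
      then obtain i where i: "r = (1, Suc i)" "i < n" by blast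
      have "m'' r c' = pairing n Z r c'" unfolding i(1) using m'B[OF i(2) c'] by (simp add: m''_def)
      moreover have "pairing n Z r c' = 0" if "c' \<in> set (sg 1 n)" using BB[OF True that] .
      moreover have "fst c' \<noteq> 1" if "c' \<notin> set (sg 1 n)" using c' that gC[of c'] by auto
      moreover have "m2 r c' = pairing n Z r c'" using i by (simp add: m2_def)
      ultimately show ?thesis using i by (cases "c' \<in> set (sg 1 n)") (auto simp: s_def t_def)
    next
      case False
      then have rR: "r \<in> set R" using r by auto
      have m'': "m'' r c' = m' r c' - (\<Sum>i<n. \<alpha> r i * pairing n Z (1, Suc i) c')"
        using gR[OF rR] m'B[OF _ c'] by (auto simp: m''_def intro!: sum.cong)
      show ?thesis
      proof (cases "c' \<in> set (sg 1 n)")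
        case True
        then have "(\<Sum>i<n. \<alpha> r i * pairing n Z (1, Suc i) c') = 0"
          by (intro sum.neutral) (use BB inB in auto)
        moreover have "fst c' = 1" using True by (simp add: set_sg)
        ultimately show ?thesis
          unfolding m'' using gR[OF rR] by (auto simp: m'_def m1_def pairing0_def m2_def s_def t_def)
      next
        case False
        then have cC: "c' \<in> set C" using c' by auto
        have "m'' r c' = m1 r c' - pairing n Z r c'"
          unfolding m'' using gC[OF cC] expand[of r c'] by (auto simp: m'_def)
        then show ?thesis
          using gR[OF rR] gC[OF cC] same[OF rR cC] by (auto simp: m1_def pairing0_def m2_def s_def t_def)
      qed
    qed
  qed
  also have "\<dots> = (\<Prod>r\<leftarrow>sg 1 n @ R. s r) * (\<Prod>c\<leftarrow>sg 1 n @ C. t c) * minor m2 (sg 1 n @ R) (sg 1 n @ C)"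
    by (rule minor_scale) (use len in simp)
  also have "(\<Prod>r\<leftarrow>sg 1 n @ R. s r) = (-1) ^ (a + c)"
  proof -
    have "(\<Prod>r\<leftarrow>sg 1 n. s r) = 1 ^ length (sg 1 n)"
      by (rule prod_list_map_const) (simp add: s_def set_sg)
    moreover have "fst r \<noteq> 1" if "r \<in> set R" for r using gR[OF that] by auto
    then have "(\<Prod>r\<leftarrow>R. s r) = (-1) ^ length R"
      by (intro prod_list_map_const) (simp add: s_def)
    ultimately show ?thesis using len(2) by simp
  qed
  also have "(\<Prod>c\<leftarrow>sg 1 n @ C. t c) = (-1) ^ n"
  proof -
    have "(\<Prod>c\<leftarrow>sg 1 n. t c) = (-1) ^ length (sg 1 n)"
      by (rule prod_list_map_const) (simp add: t_def set_sg)
    moreover have "fst c' \<noteq> 1" if "c' \<in> set C" for c' using gC[OF that] by auto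
    then have "(\<Prod>c\<leftarrow>C. t c) = 1 ^ length C"
      by (intro prod_list_map_const) (simp add: t_def)
    ultimately show ?thesis by simp
  qed
  finally have key: "minor m1 (sg 1 n @ R) (sg 1 n @ C) = (-1) ^ (a + c) * (-1) ^ n * minor m2 (sg 1 n @ R) (sg 1 n @ C)"
    using col row by simp
  have F: "br222 n a b c d Z = (-1) ^ (a + d) * ((-1) ^ ((a + c) * n) * minor m1 (sg 1 n @ R) (sg 1 n @ C))"
  proof -
    have "br222 n a b c d Z = (-1) ^ (a + d) * minor m1 (sg 1 n @ R) (C @ sg 1 n)"
      using br222_minor[OF Z, of a b d c] abcd by (simp add: m1_def R_def C_def e_def q_def)
    then show ?thesis
      using minor_swap_blocks_cols[of "sg 1 n @ R" "[]" C "sg 1 n" "[]" m1] len by simp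
  qed
  have F': "br222 n q (2 * n - a) e (2 * n - c) Z = (-1) ^ (q + c) * ((-1) ^ (n + a + c) * ((-1) ^ ((a + c) * n) * minor m2 (sg 1 n @ R) (sg 1 n @ C)))"
  proof -
    have "2 * n - (2 * n - c) = c" "2 * n - (2 * n - a) = a" using abcd by auto
    then have "br222 n q (2 * n - a) e (2 * n - c) Z = (-1) ^ (q + (2 * n - c)) * minor m1 (sg 1 n @ C) (R @ sg 1 n)"
      using br222_minor[OF Z, of q "2 * n - a" "2 * n - c" e] abcd size by (simp add: m1_def R_def C_def)
    also have "minor m1 (sg 1 n @ C) (R @ sg 1 n) = minor (\<lambda>c r. m1 r c) (R @ sg 1 n) (sg 1 n @ C)"
      by (rule minor_transpose) (use len in simp)
    also have "\<dots> = minor (\<lambda>c r. (-1) * 1 * m2 c r) (R @ sg 1 n) (sg 1 n @ C)"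
    proof (rule minor_cong)
      show "m1 c r = (-1) * 1 * m2 r c" for r c
        unfolding m1_def m2_def pairing0_def by (subst pairing_skew) auto
    qed (use len in simp)
    also have "\<dots> = (\<Prod>c\<leftarrow>R @ sg 1 n. -1) * (\<Prod>c\<leftarrow>sg 1 n @ C. 1) * minor m2 (R @ sg 1 n) (sg 1 n @ C)"
      by (rule minor_scale) (use len in simp)
    also have "(\<Prod>c\<leftarrow>R @ sg 1 n. -1) = ((-1) ^ (n + a + c) :: complex)"
      using len(2) by (simp add: prod_list_const power_add mult_ac)
    also have "(\<Prod>c\<leftarrow>sg 1 n @ C. 1) = (1 :: complex)" by (simp add: prod_list_const)
    also have "minor m2 (R @ sg 1 n) (sg 1 n @ C) = (-1) ^ ((a + c) * n) * minor m2 (sg 1 n @ R) (sg 1 n @ C)"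
      using minor_swap_blocks[of "[]" R "sg 1 n" "[]" "sg 1 n @ C" m2] len by simp
    also have "(-1) ^ (q + (2 * n - c)) = ((-1) ^ (q + c) :: complex)"
      by (rule minus_one_power_eqI) (use abcd in simp)
    finally show ?thesis by simp
  qed
  have "(-1) ^ (a + d) * ((-1) ^ ((a + c) * n) * ((-1) ^ (a + c) * (-1) ^ n * z)) =
      (-1) ^ (q + c) * ((-1) ^ (n + a + c) * ((-1) ^ ((a + c) * n) * z))" for z :: complex
  proof -
    have "even (d + e)" "even (a + c + (e + q))" using size(1,4) by simp_all
    then have "even (a + d + (a + c) * n + (a + c) + n + (q + c + (n + a + c) + (a + c) * n))" by auto
    from minus_one_power_eqI[OF this] show ?thesis by (simp add: power_add mult_ac)
  qed
  then have "br222 n a b c d Z = br222 n q (2 * n - a) e (2 * n - c) Z"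
    unfolding F F' key by blast
  then show ?thesis by (simp add: e_def q_def)
qed

section \<open>A positive triple of flags\<close>

definition positive :: "complex \<Rightarrow> bool" where
  "positive z \<longleftrightarrow> (\<exists>x>0. z = complex_of_real x)"

lemma positive_mult: "positive z \<Longrightarrow> positive w \<Longrightarrow> positive (z * w)"
  unfolding positive_def by (metis mult_pos_pos of_real_mult)

lemma positive_add: "positive z \<Longrightarrow> positive w \<Longrightarrow> positive (z + w)"
  unfolding positive_def by (metis add_pos_pos of_real_add)

lemma positive_divide: "positive z \<Longrightarrow> positive w \<Longrightarrow> positive (z / w)"
  unfolding positive_def by (metis divide_pos_pos of_real_divide)

lemma positive_nonzero: "positive z \<Longrightarrow> z \<noteq> 0"
  unfolding positive_def by auto

lemma positive_of_real: "x > 0 \<Longrightarrow> positive (of_real x)"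
  unfolding positive_def by auto

lemma positive_prod_list: "(\<And>z. z \<in> set zs \<Longrightarrow> positive z) \<Longrightarrow> positive (prod_list zs)"
proof (induction zs)
  case Nil
  show ?case using positive_of_real[of 1] by simp
qed (auto intro: positive_mult)

text \<open>Passing from the polynomials \<open>(x - 1) \<cdots> (x - r)\<close> to the Newton basis of the nodes
  makes a Vandermonde-like matrix triangular.\<close>

fun newton_coeff :: "(nat \<Rightarrow> complex) \<Rightarrow> nat \<Rightarrow> nat \<Rightarrow> complex" where
  "newton_coeff x 0 s = (if s = 0 then 1 else 0)"
| "newton_coeff x (Suc r) s = (if s = 0 then 0 else newton_coeff x r (s - 1)) + (x s - of_nat (Suc r)) * newton_coeff x r s"

lemma newton_coeff_zero: "s > r \<Longrightarrow> newton_coeff x r s = 0"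
  by (induction r arbitrary: s) auto

lemma newton_coeff_diag: "newton_coeff x r r = 1"
  by (induction r) (simp_all add: newton_coeff_zero)

lemma newton_expansion:
  "(\<Prod>i<r. z - of_nat (Suc i)) = (\<Sum>s\<le>r. newton_coeff x r s * (\<Prod>i<s. z - x i))"
proof (induction r)
  case (Suc r)
  let ?N = "\<lambda>s. \<Prod>i<s. z - x i" and ?c = "newton_coeff x r"
  have "(\<Prod>i<Suc r. z - of_nat (Suc i)) = (\<Sum>s\<le>r. ?c s * ?N s) * (z - of_nat (Suc r))"
    using Suc by simp
  also have "\<dots> = (\<Sum>s\<le>r. ?c s * ?N (Suc s) + (x s - of_nat (Suc r)) * ?c s * ?N s)"
    unfolding sum_distrib_right by (intro sum.cong[OF refl]) (simp add: algebra_simps)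
  also have "\<dots> = (\<Sum>s\<le>r. ?c s * ?N (Suc s)) + (\<Sum>s\<le>r. (x s - of_nat (Suc r)) * ?c s * ?N s)"
    by (rule sum.distrib)
  also have "(\<Sum>s\<le>r. (x s - of_nat (Suc r)) * ?c s * ?N s) = (\<Sum>s\<le>Suc r. (x s - of_nat (Suc r)) * ?c s * ?N s)"
    by (simp add: newton_coeff_zero)
  also have "(\<Sum>s\<le>r. ?c s * ?N (Suc s)) = (\<Sum>s\<le>Suc r. (if s = 0 then 0 else ?c (s - 1)) * ?N s)"
    unfolding sum.atMost_Suc_shift by simp
  also have "(\<Sum>s\<le>Suc r. (if s = 0 then 0 else ?c (s - 1)) * ?N s) + (\<Sum>s\<le>Suc r. (x s - of_nat (Suc r)) * ?c s * ?N s) =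
      (\<Sum>s\<le>Suc r. newton_coeff x (Suc r) s * ?N s)"
    unfolding sum.distrib[symmetric] by (intro sum.cong[OF refl]) (simp add: distrib_right)
  finally show ?case .
qed simp

lemma vandermonde_positive:
  fixes x :: "nat \<Rightarrow> nat"
  assumes "\<And>i k. i < k \<Longrightarrow> k < d \<Longrightarrow> x i < x k"
  shows "positive (minor (\<lambda>r k. \<Prod>i<r. of_nat (x k) - of_nat (Suc i)) [0..<d] [0..<d])"
proof -
  define y where "y = (\<lambda>k. of_nat (x k) :: complex)"
  let ?L = "mat d d (\<lambda>(r, s). newton_coeff y r s)" and ?N = "mat d d (\<lambda>(s, k). \<Prod>i<s. y k - y i)"
  have "mat d d (\<lambda>(r, k). \<Prod>i<r. y k - of_nat (Suc i)) = ?L * ?N"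
  proof (rule eq_matI)
    fix r k assume "r < dim_row (?L * ?N)" "k < dim_col (?L * ?N)"
    then have rk: "r < d" "k < d" by auto
    have "(\<Prod>i<r. y k - of_nat (Suc i)) = (\<Sum>s\<le>r. newton_coeff y r s * (\<Prod>i<s. y k - y i))"
      by (rule newton_expansion)
    also have "\<dots> = (\<Sum>s<d. newton_coeff y r s * (\<Prod>i<s. y k - y i))"
      by (rule sum.mono_neutral_left) (use rk newton_coeff_zero in auto)
    finally show "mat d d (\<lambda>(r, k). \<Prod>i<r. y k - of_nat (Suc i)) $$ (r, k) = (?L * ?N) $$ (r, k)"
      using rk by (simp add: scalar_prod_def lessThan_atLeast0[symmetric])
  qed auto
  then have "det (mat d d (\<lambda>(r, k). \<Prod>i<r. y k - of_nat (Suc i))) = det ?L * det ?N"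
    using det_mult[of ?L d ?N] by simp
  moreover have "det ?L = 1"
  proof -
    have "det ?L = prod_list (diag_mat ?L)"
      by (rule det_lower_triangular[of d]) (auto simp: newton_coeff_zero)
    also have "diag_mat ?L = map (\<lambda>_. 1) [0..<d]"
      by (auto simp: diag_mat_def newton_coeff_diag)
    finally show ?thesis by (simp add: map_replicate_const)
  qed
  moreover have "positive (det ?N)"
  proof -
    have z: "(\<Prod>i<s. y k - y i) = 0" if "k < s" for s k
      using that by (intro prod_zero) auto
    have "upper_triangular ?N" by (auto simp: upper_triangular_def z)
    then have "det ?N = prod_list (diag_mat ?N)" by (rule det_upper_triangular[of _ d]) auto
    moreover have "positive z" if z: "z \<in> set (diag_mat ?N)" for z
    proof -
      obtain k where k: "k < d" "z = (\<Prod>i<k. y k - y i)" using z by (auto simp: diag_mat_def)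
      have "z = of_real (\<Prod>i<k. real (x k) - real (x i))" unfolding k(2) y_def by simp
      moreover have "(\<Prod>i<k. real (x k) - real (x i)) > 0" using assms k(1) by (intro prod_pos) auto
      ultimately show ?thesis using positive_of_real by metis
    qed
    ultimately show ?thesis using positive_prod_list by metis
  qed
  moreover have "minor (\<lambda>r k. \<Prod>i<r. of_nat (x k) - of_nat (Suc i)) [0..<d] [0..<d] = det (mat d d (\<lambda>(r, k). \<Prod>i<r. y k - of_nat (Suc i)))"
    unfolding minor_def y_def by (rule arg_cong[of _ _ det], rule eq_matI) auto
  ultimately show ?thesis by simp
qed

section \<open>Minors of the matrix with entries \<open>1 / (a - r)!\<close>\<close>

text \<open>The exponential of a nilpotent Jordan block. Multiplying column a by
  \<open>(a - 1)!\<close> turns row r into the polynomial (a - 1) ... (a - r + 1), which also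
  produces the zeros for a < r.\<close>

definition pascal :: "nat \<Rightarrow> nat \<Rightarrow> complex" where
  "pascal r a = (if r \<le> a then 1 / fact (a - r) else 0)"

lemma pascal_falling: "a \<ge> 1 \<Longrightarrow> pascal (Suc r) a = 1 / fact (a - 1) * (\<Prod>i<r. of_nat a - of_nat (Suc i))"
proof (induction r)
  case 0
  then show ?case by (simp add: pascal_def)
next
  case (Suc r)
  have IH: "1 / fact (a - 1) * (\<Prod>i<r. of_nat a - of_nat (Suc i)) = pascal (Suc r) a" using Suc by simp
  have "1 / fact (a - 1) * (\<Prod>i<Suc r. of_nat a - of_nat (Suc i)) = pascal (Suc r) a * (of_nat a - of_nat (Suc r))"
    unfolding IH[symmetric] by simp
  also have "\<dots> = pascal (Suc (Suc r)) a"
  proof (cases "Suc (Suc r) \<le> a")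
    case True
    then obtain k where k: "a = Suc (Suc r) + k" using le_Suc_ex by blast
    have "(of_nat a :: complex) - of_nat (Suc r) = of_nat (Suc k)" unfolding k by simp
    moreover have "fact (Suc k) = of_nat (Suc k) * (fact k :: complex)" by simp
    ultimately show ?thesis unfolding pascal_def k by (simp add: field_simps del: of_nat_Suc fact_Suc)
  next
    case False
    then show ?thesis by (cases "a = Suc r") (auto simp: pascal_def)
  qed
  finally show ?case by simp
qed

text \<open>Only initial rows occur, so after scaling the columns the minor is the Vandermonde-like
  one with the elements of L as nodes.\<close>

lemma pascal_positive:
  assumes L: "sorted_wrt (<) L" "\<And>a. a \<in> set L \<Longrightarrow> a \<ge> 1"
  shows "positive (minor pascal [1..<Suc (length L)] L)"
proof -
  let ?d = "length L"
  have L': "L = map (\<lambda>k. L ! k) [0..<?d]" by (simp add: map_nth)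
  have R': "[1..<Suc ?d] = map Suc [0..<?d]" by (simp add: map_Suc_upt)
  have "minor pascal [1..<Suc ?d] L = minor (\<lambda>r k. pascal (Suc r) (L ! k)) [0..<?d] [0..<?d]"
    by (subst (2) L', subst R', subst minor_map) auto
  also have "\<dots> = minor (\<lambda>r k. 1 * (1 / fact (L ! k - 1)) * (\<Prod>i<r. of_nat (L ! k) - of_nat (Suc i))) [0..<?d] [0..<?d]"
    by (rule minor_cong) (use L(2) pascal_falling in auto)
  also have "\<dots> = (\<Prod>r\<leftarrow>[0..<?d]. 1) * (\<Prod>k\<leftarrow>[0..<?d]. 1 / fact (L ! k - 1)) *
      minor (\<lambda>r k. \<Prod>i<r. of_nat (L ! k) - of_nat (Suc i)) [0..<?d] [0..<?d]"
    by (rule minor_scale) simp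
  finally have e: "minor pascal [1..<Suc ?d] L = (\<Prod>k\<leftarrow>[0..<?d]. 1 / fact (L ! k - 1)) *
      minor (\<lambda>r k. \<Prod>i<r. of_nat (L ! k) - of_nat (Suc i)) [0..<?d] [0..<?d]"
    by (simp add: prod_list_const)
  have p1: "positive (1 / fact m)" for m
    using positive_of_real[of "1 / fact m"] by simp
  have "positive (\<Prod>k\<leftarrow>[0..<?d]. 1 / fact (L ! k - 1))"
    by (rule positive_prod_list) (use p1 in auto)
  moreover have "positive (minor (\<lambda>r k. \<Prod>i<r. of_nat (L ! k) - of_nat (Suc i)) [0..<?d] [0..<?d])"
    by (rule vandermonde_positive) (use L(1) in \<open>auto simp: sorted_wrt_iff_nth_less\<close>)
  ultimately show ?thesis unfolding e by (rule positive_mult)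
qed

lemma minor_rev_cols:
  "length rs = length (cs1 @ xs @ cs2) \<Longrightarrow>
    minor m rs (cs1 @ rev xs @ cs2) = (\<Prod>i<length xs. (-1) ^ i) * minor m rs (cs1 @ xs @ cs2)"
proof (induction xs arbitrary: cs2)
  case (Cons x xs)
  have "minor m rs (cs1 @ rev (x # xs) @ cs2) = minor m rs (cs1 @ rev xs @ x # cs2)" by simp
  also have "\<dots> = (\<Prod>i<length xs. (-1) ^ i) * minor m rs (cs1 @ xs @ x # cs2)"
    by (rule Cons.IH) (use Cons.prems in simp)
  also have "minor m rs (cs1 @ (x # xs) @ cs2) = (-1) ^ length xs * minor m rs (cs1 @ xs @ x # cs2)"
    using minor_move_cols[of rs cs1 x xs cs2 m] Cons.prems by simp
  then have "minor m rs (cs1 @ xs @ x # cs2) = (-1) ^ length xs * minor m rs (cs1 @ (x # xs) @ cs2)" by simp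
  finally show ?case by (simp add: mult_ac)
qed simp

section \<open>The three flags\<close>

text \<open>The standard basis in reverse order, with the signs that make it symplectic.\<close>

definition opposite_basis :: "nat \<Rightarrow> nat \<Rightarrow> nat \<Rightarrow> complex" where
  "opposite_basis n i = (\<lambda>a. if i \<in> {1..2 * n} \<and> a = 2 * n + 1 - i then (-1) ^ (i - 1) else 0)"

text \<open>The alternating sign makes the rows of the matrix a symplectic basis. The overall minus
  does not affect this; it is chosen so that the signs in \<open>minor_positive\<close> work
  out.\<close>

definition pascal_basis :: "nat \<Rightarrow> nat \<Rightarrow> nat \<Rightarrow> complex" where
  "pascal_basis n r = (\<lambda>a. if r \<in> {1..2 * n} \<and> a \<in> {1..2 * n} then - ((-1) ^ (a + r)) * pascal r a else 0)"

definition positive_triple :: "nat \<Rightarrow> flags" where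
  "positive_triple n = (std_basis n, opposite_basis n, pascal_basis n)"

lemma symplectic_form_std: 
  assumes "k \<in> {1..2 * n}"
  shows "symplectic_form n (std_basis n k) x = (-1) ^ (2 * n + 1 - k) * x (2 * n + 1 - k)"
proof -
  have "symplectic_form n (std_basis n k) x = (\<Sum>b=1..2 * n. if b = 2 * n + 1 - k then (-1) ^ b * x b else 0)"
    unfolding ev_flat[symmetric] ev_def flat_def std_basis_def using assms by (intro sum.cong[OF refl]) auto
  moreover have "2 * n + 1 - k \<in> {1..2 * n}" using assms by auto
  ultimately show ?thesis by (simp only: sum.delta[OF finite_atLeastAtMost] if_True)
qed

lemma symplectic_form_opposite:
  assumes "k \<in> {1..2 * n}"
  shows "symplectic_form n (opposite_basis n k) x = - x k"
proof -
  have "symplectic_form n (opposite_basis n k) x = (\<Sum>b=1..2 * n. if b = k then (-1) ^ k * (-1) ^ (k - 1) * x k else 0)"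
    unfolding ev_flat[symmetric] ev_def flat_def opposite_basis_def using assms by (intro sum.cong[OF refl]) auto
  also have "\<dots> = (-1) ^ k * (-1) ^ (k - 1) * x k" using assms by (simp add: sum.delta)
  also have "(-1) ^ k * (-1) ^ (k - 1) = (-1 :: complex)" using assms by (cases k) auto
  finally show ?thesis by simp
qed

lemma symplectic_opposite_basis: "symplectic_basis n (opposite_basis n)"
  unfolding symplectic_basis_def
proof (intro conjI ballI impI allI)
  fix i j assume ij: "i \<in> {1..2 * n}" "j \<in> {1..2 * n}" "i < j"
  show "symplectic_form n (opposite_basis n i) (opposite_basis n j) = (if i + j = 2 * n + 1 then (-1) ^ (i - 1) else 0)"
  proof (cases "i + j = 2 * n + 1")
    case True
    then have "odd (i + j)" by simp
    moreover obtain a b where "i = Suc a" "j = Suc b" using ij by (cases i; cases j) auto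
    ultimately have "- ((-1) ^ (j - 1)) = ((-1) ^ (i - 1) :: complex)" by (cases "even a") auto
    then show ?thesis using ij True unfolding symplectic_form_opposite[OF ij(1)] by (auto simp: opposite_basis_def)
  next
    case False
    then show ?thesis using ij unfolding symplectic_form_opposite[OF ij(1)] by (auto simp: opposite_basis_def)
  qed
qed (auto simp: opposite_basis_def split: if_splits)

text \<open>With m = 2n + 1 - j - k the pairing is, up to sign, the alternating sum of the binomial
  coefficients (m choose s) divided by m!, which vanishes unless m = 0. For j + k > 2n + 1 the
  summands have no common support.\<close>

lemma symplectic_pascal_basis: "symplectic_basis n (pascal_basis n)"
  unfolding symplectic_basis_def
proof (intro conjI ballI impI allI)
  fix j k assume jk: "j \<in> {1..2 * n}" "k \<in> {1..2 * n}" "j < k"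
  have e1: "symplectic_form n (pascal_basis n j) (pascal_basis n k) =
      (\<Sum>b=1..2 * n. - ((-1) ^ (j + k + b)) * (pascal j (2 * n + 1 - b) * pascal k b))"
    unfolding ev_flat[symmetric] ev_def flat_def
  proof (rule sum.cong[OF refl])
    fix b assume b: "b \<in> {1..2 * n}"
    have "(-1) ^ b * (- ((-1) ^ (2 * n + 1 - b + j))) * (- ((-1) ^ (b + k))) = (- ((-1) ^ (j + k + b)) :: complex)"
    proof -
      have "(-1) ^ (2 * n + 1 - b + j) = (- ((-1) ^ b) * (-1) ^ j :: complex)"
        unfolding power_add using b by (subst minus_one_power_reflect) auto
      then show ?thesis by (simp add: power_add mult_ac)
    qed
    moreover have "x * (y * u) * (z * w) = x * y * z * (u * w)" for x y z u w :: complex by (simp only: mult_ac)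
    ultimately have "(-1) ^ b * (- ((-1) ^ (2 * n + 1 - b + j)) * pascal j (2 * n + 1 - b)) * (- ((-1) ^ (b + k)) * pascal k b) =
        - ((-1) ^ (j + k + b)) * (pascal j (2 * n + 1 - b) * pascal k b)"
      by (simp only:)
    moreover have "2 * n + 1 - b \<in> {1..2 * n}" using b by auto
    then have "pascal_basis n j (2 * n + 1 - b) = - ((-1) ^ (2 * n + 1 - b + j)) * pascal j (2 * n + 1 - b)"
      "pascal_basis n k b = - ((-1) ^ (b + k)) * pascal k b"
      using jk(1,2) b by (simp_all only: pascal_basis_def simp_thms if_True)
    ultimately show "(-1) ^ b * pascal_basis n j (2 * n + 1 - b) * pascal_basis n k b =
        - ((-1) ^ (j + k + b)) * (pascal j (2 * n + 1 - b) * pascal k b)"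
      by (simp only:)
  qed
  show "symplectic_form n (pascal_basis n j) (pascal_basis n k) = (if j + k = 2 * n + 1 then (-1) ^ (j - 1) else 0)"
  proof (cases "j + k \<le> 2 * n + 1")
    case False
    have "(\<Sum>b=1..2 * n. - ((-1) ^ (j + k + b)) * (pascal j (2 * n + 1 - b) * pascal k b)) = 0"
      by (rule sum.neutral) (use False in \<open>auto simp: pascal_def\<close>)
    then show ?thesis unfolding e1 using False by simp
  next
    case True
    define m where "m = 2 * n + 1 - (j + k)"
    have m: "m + (j + k) = 2 * n + 1" using True by (simp add: m_def)
    have "(\<Sum>b=1..2 * n. - ((-1) ^ (j + k + b)) * (pascal j (2 * n + 1 - b) * pascal k b)) =
        (\<Sum>b=k..k + m. - ((-1) ^ (j + k + b)) * (pascal j (2 * n + 1 - b) * pascal k b))"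
      by (rule sum.mono_neutral_right) (use jk m in \<open>auto simp: pascal_def\<close>)
    also have "\<dots> = (\<Sum>s\<le>m. - ((-1) ^ j / fact m) * ((-1) ^ s * of_nat (m choose s)))"
    proof (rule sum.reindex_bij_witness[of _ "\<lambda>s. k + s" "\<lambda>b. b - k"])
      fix b assume b: "b \<in> {k..k + m}"
      then obtain s where s: "b = k + s" "s \<le> m" by (metis atLeastAtMost_iff le_Suc_ex add_le_cancel_left)
      have x: "2 * n + 1 - b - j = m - s" "j \<le> 2 * n + 1 - b" using s m by auto
      have "(-1) ^ (j + k + b) = ((-1) ^ j * (-1) ^ s :: complex)"
        unfolding s(1) power_add[symmetric] by (rule minus_one_power_eqI) auto
      moreover have "pascal j (2 * n + 1 - b) * pascal k b = of_nat (m choose s) / fact m"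
        using x s binomial_fact[OF s(2), where 'a = complex] by (simp add: pascal_def field_simps)
      ultimately show "- ((-1) ^ j / fact m) * ((-1) ^ (b - k) * of_nat (m choose (b - k))) =
          - ((-1) ^ (j + k + b)) * (pascal j (2 * n + 1 - b) * pascal k b)"
        using s by simp
    qed auto
    also have "\<dots> = - ((-1) ^ j / fact m) * (\<Sum>s\<le>m. (-1) ^ s * of_nat (m choose s))"
      by (rule sum_distrib_left[symmetric])
    also have "\<dots> = (if j + k = 2 * n + 1 then (-1) ^ (j - 1) else 0)"
    proof (cases "m = 0")
      case True
      then show ?thesis using m jk by (cases j) auto
    next
      case False
      then show ?thesis using choose_alternating_sum[of m, where 'a = complex] m by simp
    qed
    finally show ?thesis unfolding e1 .
  qed
qed (auto simp: pascal_basis_def split: if_splits)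

lemma positive_triple_in: "positive_triple n \<in> flag_triples n"
  by (simp add: positive_triple_def flag_triples_def symplectic_std_basis symplectic_opposite_basis symplectic_pascal_basis)

lemma upt_reflect: "q \<le> 2 * n \<Longrightarrow> map (\<lambda>k. 2 * n + 1 - k) [1..<Suc q] = rev [2 * n + 1 - q..<2 * n + 1]"
  by (rule nth_equalityI) (auto simp: rev_nth)

text \<open>A minor of the totally positive matrix with entries \<open>1 / (a - r)!\<close>, up to the order and
  the signs of its rows and columns.\<close>

lemma minor_positive:
  assumes pq: "p + q \<le> n" and Z: "Z = positive_triple n"
  shows "positive ((-1) ^ (n - p) * minor (pairing n Z) (sg 2 (p + q) @ sg 0 (n - p)) (sg 0 q @ sg 1 n))"
proof -
  have Zt: "Z \<in> flag_triples n" unfolding Z by (rule positive_triple_in)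
  have fl: "flag_of Z 0 = std_basis n" "flag_of Z 1 = opposite_basis n" "flag_of Z 2 = pascal_basis n"
    by (simp_all add: Z positive_triple_def flag_of_def)
  let ?m = "pairing n Z" and ?l = "n - p"
  \<comment> \<open>The p columns of the second flag that are left over: the A-rows pair with the
    first \<open>?l\<close> columns by minus the identity and vanish on the others.\<close>
  define B where "B = map (Pair (1::nat)) [Suc ?l..<Suc n]"
  have lB: "length B = p" using pq by (simp add: B_def)
  have sgB: "sg 1 n = sg 1 ?l @ B"
    unfolding sg_def B_def map_append[symmetric] using upt_add_eq_append[of 1 "Suc ?l" p] pq by simp
  have AB: "?m (0, i) (1, k) = (if i = k then -1 else 0)" if "i \<in> {1..2 * n}" "k \<in> {1..2 * n}" for i k
    using that by (simp add: pairing_def fl[unfolded One_nat_def] symplectic_form_opposite std_basis_def)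
  have D: "minor ?m (sg 0 ?l) (sg 1 ?l) = (-1) ^ ?l"
  proof -
    have "minor ?m (sg 0 ?l) (sg 1 ?l) = minor (\<lambda>i k. ?m (0, i) (1, k)) [1..<Suc ?l] [1..<Suc ?l]"
      unfolding sg_def by (rule minor_map) simp
    also have "\<dots> = det (mat ?l ?l (\<lambda>(i, k). if i = k then -1 else 0))"
      unfolding minor_def by (rule arg_cong[of _ _ det], rule eq_matI) (use AB pq in auto)
    also have "\<dots> = prod_list (diag_mat (mat ?l ?l (\<lambda>(i, k). if i = k then -1 else 0 :: complex)))"
      by (rule det_lower_triangular[of ?l]) auto
    also have "diag_mat (mat ?l ?l (\<lambda>(i, k). if i = k then -1 else 0 :: complex)) = map (\<lambda>_. -1) [0..<?l]"
      by (auto simp: diag_mat_def)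
    finally show ?thesis by (simp add: map_replicate_const)
  qed
  have "minor ?m (sg 2 (p + q) @ sg 0 ?l) (sg 0 q @ sg 1 n) = (-1) ^ (?l * p) * minor ?m (sg 2 (p + q) @ sg 0 ?l) ((sg 0 q @ B) @ sg 1 ?l)"
    unfolding sgB using minor_swap_blocks_cols[of "sg 2 (p + q) @ sg 0 ?l" "sg 0 q" "sg 1 ?l" B "[]" ?m] lB pq by simp
  also have "minor ?m (sg 2 (p + q) @ sg 0 ?l) ((sg 0 q @ B) @ sg 1 ?l) = minor ?m (sg 2 (p + q)) (sg 0 q @ B) * minor ?m (sg 0 ?l) (sg 1 ?l)"
  proof (rule minor_block_upper)
    fix r c assume r: "r \<in> set (sg 0 ?l)" and c: "c \<in> set (sg 0 q @ B)"
    obtain i where i: "r = (0, i)" "1 \<le> i" "i \<le> ?l" using that[of "snd r"] r by (simp add: set_sg prod_eq_iff)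
    show "?m r c = 0"
    proof (cases "c \<in> set (sg 0 q)")
      case True
      then show ?thesis using pairing_same_seg[OF Zt r True] pq by simp
    next
      case False
      then obtain k where "c = (1, k)" "?l < k" "k \<le> n" using c by (auto simp: B_def)
      then show ?thesis unfolding i(1) using AB[of i k] i pq by auto
    qed
  qed (use lB pq in auto)
  also have "minor ?m (sg 2 (p + q)) (sg 0 q @ B) = (\<Prod>r\<leftarrow>[1..<Suc (p + q)]. (-1) ^ r) * ((-1) ^ q * (\<Prod>k\<leftarrow>[Suc ?l..<Suc n]. (-1) ^ k)) *
      minor pascal [1..<Suc (p + q)] (rev [2 * n + 1 - q..<2 * n + 1] @ [Suc ?l..<Suc n])"
  proof -
    define coord where "coord = (\<lambda>c :: nat \<times> nat. if fst c = 0 then 2 * n + 1 - snd c else snd c)"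
    define sgn' where "sgn' = (\<lambda>c :: nat \<times> nat. if fst c = 0 then -1 else (-1) ^ snd c :: complex)"
    have ent: "?m r c = (-1) ^ snd r * sgn' c * pascal (snd r) (coord c)" if r: "r \<in> set (sg 2 (p + q))" and c: "c \<in> set (sg 0 q @ B)" for r c
    proof -
      obtain i where i: "r = (2, i)" "1 \<le> i" "i \<le> p + q" using that[of "snd r"] r by (simp add: set_sg prod_eq_iff)
      consider k where "c = (0, k)" "1 \<le> k" "k \<le> q" | k where "c = (1, k)" "1 \<le> k" "k \<le> n"
      proof (cases "c \<in> set (sg 0 q)")
        case True
        then show ?thesis using that(1)[of "snd c"] by (simp add: set_sg prod_eq_iff)
      next
        case False
        then have "c \<in> set B" using c by simp
        then show ?thesis using that(2)[of "snd c"] by (auto simp: B_def)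
      qed
      then show ?thesis
      proof cases
        case (1 k)
        let ?a = "2 * n + 1 - k"
        have k: "k \<in> {1..2 * n}" using 1 pq by auto
        have "?m r c = (-1) ^ ?a * pascal_basis n i ?a"
          unfolding pairing_def 1(1) i(1) using symplectic_form_std[OF k] by (simp add: fl)
        also have "\<dots> = - ((-1) ^ i) * pascal i ?a"
        proof -
          have "?a \<in> {1..2 * n}" "i \<in> {1..2 * n}" using 1 i pq by auto
          then have "pascal_basis n i ?a = - ((-1) ^ (?a + i)) * pascal i ?a"
            by (simp only: pascal_basis_def simp_thms if_True)
          moreover have "(-1) ^ ?a * (-1) ^ (?a + i) = ((-1) ^ i :: complex)"
            unfolding power_add[symmetric] by (rule minus_one_power_eqI) auto
          then have "(-1) ^ ?a * (- ((-1) ^ (?a + i)) * pascal i ?a) = - ((-1) ^ i) * pascal i ?a"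
            by (simp only: mult_minus_left mult_minus_right mult.assoc[symmetric])
          ultimately show ?thesis by (simp only:)
        qed
        finally show ?thesis unfolding 1(1) i(1) by (simp add: coord_def sgn'_def)
      next
        case (2 k)
        have "?m r c = - pascal_basis n i k"
          unfolding pairing_def 2(1) i(1) using 2 pq by (simp add: fl[unfolded One_nat_def] symplectic_form_opposite)
        also have "\<dots> = (-1) ^ i * (-1) ^ k * pascal i k"
          using 2 i pq by (simp add: pascal_basis_def power_add mult_ac)
        finally show ?thesis unfolding 2(1) i(1) by (simp add: coord_def sgn'_def)
      qed
    qed
    have len: "length (sg 2 (p + q)) = length (sg 0 q @ B)" using lB by simp
    have "minor ?m (sg 2 (p + q)) (sg 0 q @ B) = minor (\<lambda>r c. (-1) ^ snd r * sgn' c * pascal (snd r) (coord c)) (sg 2 (p + q)) (sg 0 q @ B)"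
      by (rule minor_cong[OF len ent])
    also have "\<dots> = (\<Prod>r\<leftarrow>sg 2 (p + q). (-1) ^ snd r) * (\<Prod>c\<leftarrow>sg 0 q @ B. sgn' c) * minor (\<lambda>r c. pascal (snd r) (coord c)) (sg 2 (p + q)) (sg 0 q @ B)"
      by (rule minor_scale[OF len])
    also have "minor (\<lambda>r c. pascal (snd r) (coord c)) (sg 2 (p + q)) (sg 0 q @ B) = minor pascal (map snd (sg 2 (p + q))) (map coord (sg 0 q @ B))"
      by (rule minor_map[OF len, symmetric])
    also have "map snd (sg 2 (p + q)) = [1..<Suc (p + q)]" by (simp add: sg_def comp_def)
    also have "map coord (sg 0 q @ B) = rev [2 * n + 1 - q..<2 * n + 1] @ [Suc ?l..<Suc n]"
    proof -
      have "map coord (sg 0 q) = map (\<lambda>k. 2 * n + 1 - k) [1..<Suc q]" by (simp add: sg_def coord_def comp_def)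
      moreover have "map coord B = [Suc ?l..<Suc n]" by (simp add: B_def coord_def comp_def)
      ultimately show ?thesis using upt_reflect[of q n] pq by simp
    qed
    also have "(\<Prod>r\<leftarrow>sg 2 (p + q). (-1) ^ snd r) = ((\<Prod>r\<leftarrow>[1..<Suc (p + q)]. (-1) ^ r) :: complex)"
      by (simp add: sg_def comp_def)
    also have "(\<Prod>c\<leftarrow>sg 0 q @ B. sgn' c) = (-1) ^ q * (\<Prod>k\<leftarrow>[Suc ?l..<Suc n]. (-1) ^ k)"
      by (simp add: sg_def B_def sgn'_def comp_def prod_list_const)
    finally show ?thesis .
  qed
  also have "minor pascal [1..<Suc (p + q)] (rev [2 * n + 1 - q..<2 * n + 1] @ [Suc ?l..<Suc n]) =
      (\<Prod>i<q. (-1) ^ i) * ((-1) ^ (q * p) * minor pascal [1..<Suc (p + q)] ([Suc ?l..<Suc n] @ [2 * n + 1 - q..<2 * n + 1]))"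
  proof -
    have "length [1..<Suc (p + q)] = length ([] @ [2 * n + 1 - q..<2 * n + 1] @ [Suc ?l..<Suc n])" using pq by auto
    from minor_rev_cols[OF this, of pascal] show ?thesis
      using minor_swap_blocks_cols[of "[1..<Suc (p + q)]" "[]" "[2 * n + 1 - q..<2 * n + 1]" "[Suc ?l..<Suc n]" "[]" pascal] pq
      by simp
  qed
  finally have main: "(-1) ^ ?l * minor ?m (sg 2 (p + q) @ sg 0 ?l) (sg 0 q @ sg 1 n) =
      (-1) ^ (?l * p) * ((\<Prod>r\<leftarrow>[1..<Suc (p + q)]. (-1) ^ r) * ((-1) ^ q * (\<Prod>k\<leftarrow>[Suc ?l..<Suc n]. (-1) ^ k)) * ((\<Prod>i<q. (-1) ^ i) * (-1) ^ (q * p))) *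
      minor pascal [1..<Suc (p + q)] ([Suc ?l..<Suc n] @ [2 * n + 1 - q..<2 * n + 1])"
    unfolding D by (simp add: mult_ac)
  \<comment> \<open>\<open>s k\<close> is the sign of reversing k elements.\<close>
  define s where "s = (\<lambda>k. \<Prod>i<k. (-1) ^ i :: complex)"
  have s2: "s k * s k = 1" for k by (simp add: s_def flip: prod.distrib power_mult_distrib)
  have s2': "s k * (s k * z) = z" for k z by (simp add: s2 flip: mult.assoc)
  have shift: "(\<Prod>k\<leftarrow>[Suc a..<Suc (a + b)]. (-1) ^ k) = ((-1) ^ b * ((-1) ^ (a * b) * s b) :: complex)" for a b
  proof (induction b)
    case (Suc b)
    have "[Suc a..<Suc (a + Suc b)] = [Suc a..<Suc (a + b)] @ [Suc (a + b)]" by (simp add: upt_Suc)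
    then have "(\<Prod>k\<leftarrow>[Suc a..<Suc (a + Suc b)]. (-1) ^ k) = ((\<Prod>k\<leftarrow>[Suc a..<Suc (a + b)]. (-1) ^ k) * (-1) ^ Suc (a + b) :: complex)" by simp
    then show ?case unfolding Suc by (simp add: s_def power_add mult_ac)
  qed (simp add: s_def)
  have s_add: "s (p + q) = s p * (s q * (-1) ^ (p * q))"
  proof (induction q)
    case (Suc q)
    have "s (p + Suc q) = s (p + q) * (-1) ^ (p + q)" "s (Suc q) = s q * (-1) ^ q" by (simp_all add: s_def)
    then show ?case unfolding Suc by (simp add: power_add mult_ac)
  qed (simp add: s_def)
  have "(-1) ^ (?l * p) * ((\<Prod>r\<leftarrow>[1..<Suc (p + q)]. (-1) ^ r) * ((-1) ^ q * (\<Prod>k\<leftarrow>[Suc ?l..<Suc n]. (-1) ^ k)) * ((\<Prod>i<q. (-1) ^ i) * (-1) ^ (q * p))) = (1 :: complex)"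
  proof -
    have "(\<Prod>k\<leftarrow>[Suc ?l..<Suc n]. (-1) ^ k) = ((-1) ^ p * ((-1) ^ (?l * p) * s p) :: complex)"
      using shift[of ?l p] pq by simp
    moreover have "(\<Prod>r\<leftarrow>[1..<Suc (p + q)]. (-1) ^ r) = ((-1) ^ (p + q) * (s p * (s q * (-1) ^ (p * q))) :: complex)"
      using shift[of 0 "p + q"] by (simp add: s_add)
    moreover have "(\<Prod>i<q. (-1) ^ i) = s q" by (simp add: s_def)
    moreover have "(-1) ^ (?l * p) * ((-1) ^ (p + q) * (s p * (s q * (-1) ^ (p * q))) * ((-1) ^ q * ((-1) ^ p * ((-1) ^ (?l * p) * s p))) * (s q * (-1) ^ (q * p))) =
        (s p * s p) * (s q * s q) * (((-1) ^ (?l * p) * (-1) ^ (?l * p)) * ((-1) ^ (p * q) * (-1) ^ (p * q)) * ((-1) ^ (p + q) * (-1) ^ (p + q)))"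
      by (simp add: power_add mult_ac)
    ultimately show ?thesis by (simp add: s2 flip: power_mult_distrib)
  qed
  moreover have "positive (minor pascal [1..<Suc (p + q)] ([Suc ?l..<Suc n] @ [2 * n + 1 - q..<2 * n + 1]))"
  proof -
    have "length ([Suc ?l..<Suc n] @ [2 * n + 1 - q..<2 * n + 1]) = p + q" using pq by auto
    moreover have "sorted_wrt (<) ([Suc ?l..<Suc n] @ [2 * n + 1 - q..<2 * n + 1])"
      using pq by (auto simp: sorted_wrt_append)
    moreover have "a \<ge> 1" if "a \<in> set ([Suc ?l..<Suc n] @ [2 * n + 1 - q..<2 * n + 1])" for a using that pq by auto
    ultimately show ?thesis using pascal_positive by metis
  qed
  ultimately show ?thesis unfolding main by simp
qed

section \<open>The exchange relations\<close>

definition diag_function :: "nat \<Rightarrow> nat \<Rightarrow> flags \<Rightarrow> complex" where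
  "diag_function n k = initial_functions n (X k k)"

definition edge_function :: "nat \<Rightarrow> flags \<Rightarrow> complex" where
  "edge_function n = initial_functions n (Y n)"

lemma diag_function_eq: "1 \<le> k \<Longrightarrow> diag_function n k = br111 n (n - k) n k"
  by (simp add: diag_function_def)

lemma edge_function_eq: "edge_function n Z = top_coeff n (flag_form (flag_of Z 0) n \<and>\<^sub>e flag_form (flag_of Z 1) n)"
  by (simp add: edge_function_def flag_of_def case_prod_unfold)

definition label :: "nat \<Rightarrow> nat \<Rightarrow> nat \<Rightarrow> nat \<Rightarrow> flags \<Rightarrow> complex" where
  "label n p j t = (if t = 0 then initial_functions n (X p j)
     else if t < p then br222 n (n - p + t) (2 * n + p - j - t) (j - t) (n + t)
     else br112 n (2 * n - j) n (j - p) (n + p))"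

text \<open>The function for which the exchange relations become uniform octahedron relations.\<close>

definition full_label :: "nat \<Rightarrow> nat \<Rightarrow> nat \<Rightarrow> nat \<Rightarrow> flags \<Rightarrow> complex" where
  "full_label n p j t = br222 n (n - p + t) (2 * n + p - j - t) (j - t) (n + t)"

lemma full_label_eq:
  assumes Z: "Z \<in> flag_triples n" and pj: "p < j" "j \<le> n" "t \<le> p"
  shows "full_label n p j t Z = (if t = 0 then diag_function n n Z else 1) * (if t = p then edge_function n Z else 1) * label n p j t Z"
proof (cases "t = 0")
  case True
  have "full_label n p j t Z = br111 n 0 n n Z * br211 n (n - p) (2 * n + p - j) n j Z"
    using br222_initial[OF Z, of "n - p" "2 * n + p - j" j] pj True by (simp add: full_label_def)
  moreover have "diag_function n n = br111 n 0 n n" using diag_function_eq[of n n] pj by simp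
  moreover have "br211 n (n - p) (2 * n + p - j) n j Z = (if t = p then edge_function n Z else 1) * label n p j t Z"
  proof (cases "p = 0")
    case True
    then show ?thesis using br211_boundary[OF Z, of j] pj \<open>t = 0\<close> by (simp add: label_def edge_function_eq)
  next
    case False
    then show ?thesis using pj True by (simp add: label_def)
  qed
  ultimately show ?thesis using True by simp
next
  case False
  show ?thesis
  proof (cases "t < p")
    case True
    then show ?thesis using False by (simp add: label_def full_label_def)
  next
    case tp: False
    then have "t = p" using pj by simp
    moreover have "n - p + p = n" "2 * n + p - j - p = 2 * n - j" using pj by auto
    moreover have "br222 n n (2 * n - j) (j - p) (n + p) Z = edge_function n Z * br112 n (2 * n - j) n (j - p) (n + p) Z"
      unfolding edge_function_eq by (rule br222_final[OF Z]) (use pj in auto)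
    ultimately show ?thesis using False by (simp add: label_def full_label_def)
  qed
qed

text \<open>Neighbouring vertices and successive mutations change each argument of
  \<open>br222\<close> by at most one. The core of the octahedron is the function in row
  \<open>Suc (Suc h)\<close> after its mutation in the current round.\<close>

lemma octahedron_label:
  assumes Z: "Z \<in> flag_triples n" and pj: "Suc h < j" "j \<le> n" "t \<le> h"
    and core: "full_label n (Suc (Suc h)) j (Suc t) Z \<noteq> 0"
  shows "full_label n (Suc h) j t Z * full_label n (Suc h) j (Suc t) Z =
    full_label n h j t Z * full_label n (Suc (Suc h)) j (Suc t) Z +
    full_label n h (j - 1) t Z * full_label n (Suc (Suc h)) (Suc j) (Suc t) Z"
proof -
  define a b c d where "a = n - Suc h + t" and "b = 2 * n + h - j - t" and "c = j - t - 1" and "d = n + t"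
  have e: "n - h + t = Suc a" "n - Suc (Suc h) + Suc t = a" "n - Suc h + Suc t = Suc a"
    "2 * n + Suc h - j - t = Suc b" "2 * n + Suc h - j - Suc t = b" "2 * n + Suc (Suc h) - j - Suc t = Suc b"
    "2 * n + h - (j - 1) - t = Suc b" "2 * n + Suc (Suc h) - Suc j - Suc t = b"
    "j - t = Suc c" "j - Suc t = c" "j - 1 - t = c" "Suc j - Suc t = Suc c" "n + Suc t = Suc d"
    using pj by (auto simp: a_def b_def c_def d_def)
  note u = full_label_def e a_def[symmetric] b_def[symmetric] d_def[symmetric]
  have "a < n" "n \<le> b" "Suc b \<le> 2 * n" "Suc d \<le> 2 * n" "a + b + c + d + 2 = 4 * n"
    using pj by (auto simp: a_def b_def c_def d_def)
  from octahedron[OF Z this] core show ?thesis unfolding u by blast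
qed

text \<open>What accompanies \<open>X (p - 1) j\<close> in the monomial of the out-neighbours: the
  neighbour in the row above, or next to the diagonal the two diagonal functions into which the core
  factors.\<close>

definition label_side :: "nat \<Rightarrow> nat \<Rightarrow> nat \<Rightarrow> nat \<Rightarrow> flags \<Rightarrow> complex" where
  "label_side n p j t Z = (if j = Suc p then diag_function n (p - t) Z * diag_function n (n - 1 - t) Z else label n (Suc p) j (Suc t) Z)"

definition label_corner :: "nat \<Rightarrow> nat \<Rightarrow> nat \<Rightarrow> nat \<Rightarrow> flags \<Rightarrow> complex" where
  "label_corner n p j t Z = (if j = n then label n (p - 1) (n - 1) t Z * (if t = 0 then diag_function n n Z else 1) *
      (if p = Suc t then edge_function n Z else 1) else label n (Suc p) (Suc j) (Suc t) Z)"

text \<open>The octahedron relation for the full labels carries the factors of t = 0 and of t = h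
  once in every term, and they can be divided out. Only in the white column do they occur a second
  time, inside \<open>label_corner\<close>.\<close>

lemma label_exchange:
  assumes Z: "Z \<in> flag_triples n" and pj: "Suc h < j" "j \<le> n" "t \<le> h"
    and nz: "diag_function n n Z \<noteq> 0" "edge_function n Z \<noteq> 0" "label_side n (Suc h) j t Z \<noteq> 0"
  shows "label n (Suc h) j t Z * label n (Suc h) j (Suc t) Z =
    label n h j t Z * label_side n (Suc h) j t Z + label n h (j - 1) t Z * label_corner n (Suc h) j t Z"
proof -
  let ?d = "if t = 0 then diag_function n n Z else 1" and ?e = "if h = t then edge_function n Z else 1"
  have side: "full_label n (Suc (Suc h)) j (Suc t) Z = label_side n (Suc h) j t Z"
  proof (cases "j = Suc (Suc h)")
    case True
    \<comment> \<open>A position on the diagonal, where the formula is not the function of a mutated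
      vertex but a product of two diagonal functions.\<close>
    have "full_label n (Suc (Suc h)) j (Suc t) Z = br222 n (n - Suc h + t) (2 * n - Suc t) (Suc h - t) (n + Suc t) Z"
    proof -
      have "n - Suc (Suc h) + Suc t = n - Suc h + t" "2 * n + Suc (Suc h) - j - Suc t = 2 * n - Suc t" "j - Suc t = Suc h - t"
        using True pj by auto
      then show ?thesis by (simp only: full_label_def)
    qed
    also have "\<dots> = br111 n (n - Suc h + t) n (Suc h - t) Z * br111 n (2 * n - (2 * n - Suc t)) n (2 * n - (n + Suc t)) Z"
      by (rule br222_diagonal[OF Z]) (use pj in auto)
    also have "n - Suc h + t = n - (Suc h - t)" using pj by auto
    also have "2 * n - (2 * n - Suc t) = n - (n - 1 - t)" using pj by auto
    also have "2 * n - (n + Suc t) = n - 1 - t" by auto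
    also have "br111 n (n - (Suc h - t)) n (Suc h - t) = diag_function n (Suc h - t)" using pj by (subst diag_function_eq) auto
    also have "br111 n (n - (n - 1 - t)) n (n - 1 - t) = diag_function n (n - 1 - t)" using pj by (subst diag_function_eq) auto
    finally show ?thesis using True by (simp add: label_side_def)
  next
    case False
    then show ?thesis using full_label_eq[OF Z, of "Suc (Suc h)" j "Suc t"] pj by (simp add: label_side_def)
  qed
  have corner: "full_label n h (j - 1) t Z * full_label n (Suc (Suc h)) (Suc j) (Suc t) Z = ?d * ?e * (label n h (j - 1) t Z * label_corner n (Suc h) j t Z)"
  proof -
    have l: "full_label n h (j - 1) t Z = ?d * ?e * label n h (j - 1) t Z"
      using full_label_eq[OF Z, of h "j - 1" t] pj by auto
    have "full_label n (Suc (Suc h)) (Suc j) (Suc t) Z = label_corner n (Suc h) j t Z"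
    proof (cases "j = n")
      case True
      \<comment> \<open>Column n + 1 lies outside the triangle, but the formula still makes sense
        there, and duality sends it to \<open>X h (n - 1)\<close> after t mutations.\<close>
      have "full_label n (Suc (Suc h)) (Suc j) (Suc t) Z = full_label n h (n - 1) t Z"
      proof -
        have e: "n - Suc (Suc h) + Suc t = 2 * n - (2 * n + h - (n - 1) - t)" "2 * n + Suc (Suc h) - Suc j - Suc t = 2 * n - (n - h + t)"
          "Suc j - Suc t = 2 * n - (n + t)" "n + Suc t = 2 * n - (n - 1 - t)"
          using True pj by auto
        have "full_label n h (n - 1) t Z = br222 n (2 * n - (2 * n + h - (n - 1) - t)) (2 * n - (n - h + t)) (2 * n - (n + t)) (2 * n - (n - 1 - t)) Z"
          unfolding full_label_def by (rule br222_dual[OF Z]) (use True pj in auto)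
        then show ?thesis unfolding full_label_def e by simp
      qed
      then show ?thesis using l True by (auto simp: label_corner_def)
    next
      case False
      then show ?thesis using full_label_eq[OF Z, of "Suc (Suc h)" "Suc j" "Suc t"] pj by (simp add: label_corner_def)
    qed
    then show ?thesis unfolding l by (simp add: mult_ac)
  qed
  have "full_label n (Suc h) j t Z = ?d * label n (Suc h) j t Z"
    using full_label_eq[OF Z, of "Suc h" j t] pj by simp
  moreover have "full_label n (Suc h) j (Suc t) Z = ?e * label n (Suc h) j (Suc t) Z"
    using full_label_eq[OF Z, of "Suc h" j "Suc t"] pj by auto
  moreover have "full_label n h j t Z = ?d * ?e * label n h j t Z"
    using full_label_eq[OF Z, of h j t] pj by auto
  moreover note octahedron_label[OF Z pj, unfolded side corner, OF nz(3)]
  ultimately have "(?d * label n (Suc h) j t Z) * (?e * label n (Suc h) j (Suc t) Z) =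
      (?d * ?e * label n h j t Z) * label_side n (Suc h) j t Z + ?d * ?e * (label n h (j - 1) t Z * label_corner n (Suc h) j t Z)"
    by simp
  then have "(?d * ?e) * (label n (Suc h) j t Z * label n (Suc h) j (Suc t) Z) =
      (?d * ?e) * (label n h j t Z * label_side n (Suc h) j t Z + label n h (j - 1) t Z * label_corner n (Suc h) j t Z)"
    by (simp only: distrib_left mult.assoc mult.left_commute)
  moreover have "?d * ?e \<noteq> 0" using nz by simp
  ultimately show ?thesis by (simp only: mult_cancel_left) simp
qed

section \<open>Positivity of all functions at the chosen triple\<close>

lemma positive_diag_function:
  assumes "1 \<le> k" "k \<le> n"
  shows "positive (diag_function n k (positive_triple n))"
  using minor_positive[of k 0 n, OF _ refl] br111_middle_minor[OF positive_triple_in, of "n - k" k n] assms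
  by (simp add: diag_function_eq)

lemma positive_edge_function: "positive (edge_function n (positive_triple n))"
  using minor_positive[of 0 0 n, OF _ refl] top_frozen[OF positive_triple_in, of n]
  by (simp add: edge_function_eq flip: power_mult_distrib)

text \<open>The initial brackets are the minors of \<open>minor_positive\<close> with
  \<open>q = j - p\<close>. In the row p = 0 the bracket contains the function of \<open>Y n\<close>
  as an extra factor, which is positive and is divided out.\<close>

lemma positive_initial_label:
  assumes pj: "p < j" "j \<le> n"
  shows "positive (label n p j 0 (positive_triple n))"
proof -
  let ?Z = "positive_triple n"
  have "2 * n - (2 * n + p - j) = j - p" "2 * n - n = n" using pj by auto
  then have "br211 n (n - p) (2 * n + p - j) n j ?Z = (-1) ^ (n - p) * minor (pairing n ?Z) (sg 2 j @ sg 0 (n - p)) (sg 0 (j - p) @ sg 1 n)"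
    using br211_minor[OF positive_triple_in, of "n - p" "2 * n + p - j" n n j] pj by auto
  then have br: "positive (br211 n (n - p) (2 * n + p - j) n j ?Z)"
    using minor_positive[of p "j - p" n, OF _ refl] pj by simp
  show ?thesis
  proof (cases "p = 0")
    case True
    have "br211 n n (2 * n - j) n j ?Z = edge_function n ?Z * label n p j 0 ?Z"
      using br211_boundary[OF positive_triple_in, of j n] True pj by (simp add: label_def edge_function_eq)
    moreover have "edge_function n ?Z \<noteq> 0" using positive_edge_function positive_nonzero by blast
    ultimately have "label n p j 0 ?Z = br211 n n (2 * n - j) n j ?Z / edge_function n ?Z" by simp
    then show ?thesis using br True positive_divide positive_edge_function by simp
  next
    case False
    then show ?thesis using br pj by (simp add: label_def)
  qed
qed

text \<open>The relation that produces the function after t + 1 mutations has no subtraction. It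
  involves functions after t mutations and functions of row p + 1 after t + 1 mutations, whence an
  outer induction on t and an inner one from the top row downwards. The core of the octahedron is
  among the latter or a product of diagonal functions, hence already known to be nonzero.\<close>

lemma positive_label: "p < j \<Longrightarrow> j \<le> n \<Longrightarrow> t \<le> p \<Longrightarrow> positive (label n p j t (positive_triple n))"
proof (induction t arbitrary: p j)
  case 0
  then show ?case by (intro positive_initial_label)
next
  case (Suc t)
  let ?Z = "positive_triple n"
  note outer = Suc.IH
  show ?case using Suc.prems
  proof (induction "n - p" arbitrary: p j rule: less_induct)
    case less
    obtain h where h: "p = Suc h" using less.prems by (cases p) auto
    have pj: "Suc h < j" "j \<le> n" "t \<le> h" using less.prems h by auto
    have side: "positive (label_side n (Suc h) j t ?Z)"
    proof (cases "j = Suc (Suc h)")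
      case True
      then show ?thesis using pj by (auto simp: label_side_def intro!: positive_mult positive_diag_function)
    next
      case False
      then have "positive (label n (Suc (Suc h)) j (Suc t) ?Z)" using pj h by (intro less.hyps) auto
      then show ?thesis using False by (simp add: label_side_def)
    qed
    have one: "positive 1" using positive_of_real[of 1] by simp
    have corner: "positive (label_corner n (Suc h) j t ?Z)"
    proof (cases "j = n")
      case True
      have "positive (label n h (n - 1) t ?Z)" using pj True by (intro outer) auto
      then show ?thesis using True pj positive_diag_function[of n n] positive_edge_function one
        by (auto simp: label_corner_def intro!: positive_mult)
    next
      case False
      then have "positive (label n (Suc (Suc h)) (Suc j) (Suc t) ?Z)" using pj h by (intro less.hyps) auto
      then show ?thesis using False by (simp add: label_corner_def)
    qed
    have "label n (Suc h) j t ?Z * label n (Suc h) j (Suc t) ?Z =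
        label n h j t ?Z * label_side n (Suc h) j t ?Z + label n h (j - 1) t ?Z * label_corner n (Suc h) j t ?Z"
    proof (rule label_exchange[OF positive_triple_in pj])
      show "diag_function n n ?Z \<noteq> 0" using positive_diag_function[of n n] positive_nonzero pj by auto
      show "edge_function n ?Z \<noteq> 0" using positive_edge_function positive_nonzero by blast
      show "label_side n (Suc h) j t ?Z \<noteq> 0" using side by (rule positive_nonzero)
    qed
    moreover have pos: "positive (label n (Suc h) j t ?Z)" "positive (label n h j t ?Z)" "positive (label n h (j - 1) t ?Z)"
      using pj by (auto intro!: outer)
    ultimately have "label n (Suc h) j (Suc t) ?Z = (label n h j t ?Z * label_side n (Suc h) j t ?Z +
        label n h (j - 1) t ?Z * label_corner n (Suc h) j t ?Z) / label n (Suc h) j t ?Z"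
      using positive_nonzero[OF pos(1)] by (simp add: field_simps)
    also have "positive \<dots>" using pos side corner by (intro positive_divide positive_add positive_mult)
    finally show ?case unfolding h .
  qed
qed

section \<open>The mutation sequence\<close>

lemma label_0: "label n p j 0 = initial_functions n (X p j)"
  by (simp add: label_def)

lemma regular_label: "label n p j t \<in> regular_functions n"
  unfolding label_def by (simp add: regular_initial_functions regular_br222 regular_br112 del: initial_functions.simps)

text \<open>All exchange relations hold pointwise off the zero set of this function.\<close>

definition discriminant :: "nat \<Rightarrow> flags \<Rightarrow> complex" where
  "discriminant n Z = edge_function n Z * (\<Prod>k\<in>{1..n}. diag_function n k Z) *
     (\<Prod>(p, j, t)\<in>{(p, j, t). p < j \<and> j \<le> n \<and> t \<le> p}. label n p j t Z)"

lemma finite_label_indices: "finite {(p, j, t). p < j \<and> j \<le> n \<and> t \<le> (p :: nat)}"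
  by (rule finite_subset[of _ "{..n} \<times> {..n} \<times> {..n}"]) auto

lemma regular_discriminant: "discriminant n \<in> regular_functions n"
proof -
  have "(\<lambda>Z. discriminant n Z) \<in> regular_functions n"
    unfolding discriminant_def case_prod_unfold edge_function_def diag_function_def
    by (intro regular_functions.mult regular_prod regular_initial_functions regular_label)
  then show ?thesis by simp
qed

lemma discriminant_nonzeroD:
  assumes "discriminant n Z \<noteq> 0"
  shows "edge_function n Z \<noteq> 0" "1 \<le> k \<Longrightarrow> k \<le> n \<Longrightarrow> diag_function n k Z \<noteq> 0"
    "p < j \<Longrightarrow> j \<le> n \<Longrightarrow> t \<le> p \<Longrightarrow> label n p j t Z \<noteq> 0"
proof -
  have p: "(\<Prod>k\<in>{1..n}. diag_function n k Z) \<noteq> 0" "(\<Prod>(p, j, t)\<in>{(p, j, t). p < j \<and> j \<le> n \<and> t \<le> p}. label n p j t Z) \<noteq> 0"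
    and "edge_function n Z \<noteq> 0"
    using assms by (auto simp: discriminant_def)
  then show "edge_function n Z \<noteq> 0" by simp
  show "1 \<le> k \<Longrightarrow> k \<le> n \<Longrightarrow> diag_function n k Z \<noteq> 0" using p(1) by simp
  show "p < j \<Longrightarrow> j \<le> n \<Longrightarrow> t \<le> p \<Longrightarrow> label n p j t Z \<noteq> 0"
    using p(2) unfolding prod_zero_iff[OF finite_label_indices] by auto
qed

lemma discriminant_positive_triple: "discriminant n (positive_triple n) \<noteq> 0"
proof -
  have "edge_function n (positive_triple n) \<noteq> 0" using positive_edge_function positive_nonzero by blast
  moreover have "(\<Prod>k\<in>{1..n}. diag_function n k (positive_triple n)) \<noteq> 0"
    using positive_diag_function positive_nonzero by (auto simp: prod_zero_iff)
  moreover have "(\<Prod>(p, j, t)\<in>{(p, j, t). p < j \<and> j \<le> n \<and> t \<le> p}. label n p j t (positive_triple n)) \<noteq> 0"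
    unfolding prod_zero_iff[OF finite_label_indices] using positive_label positive_nonzero by auto
  ultimately show ?thesis by (simp add: discriminant_def)
qed

lemma genericallyI:
  assumes "\<And>Z. Z \<in> flag_triples n \<Longrightarrow> discriminant n Z \<noteq> 0 \<Longrightarrow> Q Z"
  shows "generically n Q"
  unfolding generically_def
  using regular_discriminant discriminant_positive_triple positive_triple_in assms by blast

lemma fst_fold_mutate: "fst (fold (mutate n) ks s) = fold mutate_matrix ks (fst s)"
  by (induction ks arbitrary: s) (simp_all add: mutate_def)

lemma snd_fold_mutate: "v \<notin> set ks \<Longrightarrow> snd (fold (mutate n) ks s) v = snd s v"
  by (induction ks arbitrary: s) (simp_all add: mutate_def)

lemma mutated_seed_append: "mutated_seed n (ks @ ls) = fold (mutate n) ls (mutated_seed n ks)"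
  by (simp add: mutated_seed_def)

section \<open>Invariants of the mutation sequence\<close>

text \<open>The minimum with p appears because the rounds after the p-th leave row p alone; the same
  formula covers the row p = 0.\<close>

definition stage :: "nat \<Rightarrow> nat \<Rightarrow> nat \<Rightarrow> vertex list \<Rightarrow> bool" where
  "stage n r s ks \<longleftrightarrow> quiver_state n r s (fst (mutated_seed n ks)) \<and>
     (\<forall>p j. p < j \<and> j \<le> n \<longrightarrow> count_list ks (X p j) = (if p < s then min p (r - 1) else min p r))"

text \<open>Pointwise on one fixed open set, so that values can be substituted into the exchange
  relations without shrinking the set at each mutation.\<close>

definition labelled :: "nat \<Rightarrow> vertex list \<Rightarrow> bool" where
  "labelled n ks \<longleftrightarrow> (\<forall>Z\<in>flag_triples n. discriminant n Z \<noteq> 0 \<longrightarrow>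
     (\<forall>p j. p < j \<and> j \<le> n \<longrightarrow> cluster_function n ks (X p j) Z = label n p j (count_list ks (X p j)) Z))"

definition below_diagonal :: "nat \<Rightarrow> vertex list \<Rightarrow> bool" where
  "below_diagonal n ks \<longleftrightarrow> set ks \<subseteq> {X p j | p j. 1 \<le> p \<and> p < j \<and> j \<le> n}"

lemma count_row: "distinct js \<Longrightarrow> count_list (map (X i) js) (X p j) = (if p = i \<and> j \<in> set js then 1 else 0)"
  by (induction js) auto

lemma stage_initial: "stage n 1 n []"
  using quiver_state_initial[of n] by (simp add: stage_def mutated_seed_def initial_seed_def)

lemma stage_next_round: "1 \<le> r \<Longrightarrow> r < n \<Longrightarrow> stage n r r ks \<Longrightarrow> stage n (Suc r) n ks"
  unfolding stage_def using quiver_state_next_round[of n r] by auto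

lemma stage_row_matrix:
  assumes "stage n (Suc t) (Suc (Suc h)) ks" "t \<le> h" "Suc h < l" "l \<le> n" "w \<in> vertices n"
  shows "fst (mutated_seed n ks) (X (Suc h) l) w = mcount (ready_pos n t (Suc h) l) w - mcount (ready_neg n t (Suc h) l) w"
proof -
  have "fst (mutated_seed n ks) (X (Suc h) l) w = arrows_at n (Suc t) (Suc (Suc h)) (Suc h) l w"
    using assms unfolding stage_def quiver_state_def by simp
  then show ?thesis by (simp add: arrows_at_def Let_def)
qed

lemma stage_row_zero:
  assumes "stage n (Suc t) (Suc (Suc h)) ks" "t \<le> h" "Suc h < n" "Suc h < l" "l \<le> n" "Suc h < l'" "l' \<le> n"
  shows "fst (mutated_seed n ks) (X (Suc h) l) (X (Suc h) l') = 0"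
  using stage_row_matrix[OF assms(1,2,4,5), of "X (Suc h) l'"] ready_same_row[of h l' n t l] assms
  by (simp add: X_in_vertices)

text \<open>The right side depends on \<open>js\<close> only through its set of elements, also when
  the row is mutated only in part.\<close>

lemma row_matrix:
  assumes st: "stage n (Suc t) (Suc (Suc h)) ks" "t \<le> h" "Suc h < n"
    and js: "distinct js" "set js \<subseteq> {Suc h<..n}"
  shows "fst (mutated_seed n (ks @ map (X (Suc h)) js)) v w =
    (let b = fst (mutated_seed n ks) in if v \<in> X (Suc h) ` set js \<or> w \<in> X (Suc h) ` set js then - b v w
     else b v w + (\<Sum>k\<in>X (Suc h) ` set js. contribution (b v k) (b k w)))"
proof -
  have "distinct (map (X (Suc h)) js)" using js(1) by (simp add: distinct_map inj_on_def)
  moreover have "fst (mutated_seed n ks) k k' = 0" if k: "k \<in> set (map (X (Suc h)) js)" "k' \<in> set (map (X (Suc h)) js)" for k k'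
  proof -
    obtain l l' where l: "k = X (Suc h) l" "l \<in> set js" "k' = X (Suc h) l'" "l' \<in> set js" using k by auto
    then have "l \<in> {Suc h<..n}" "l' \<in> {Suc h<..n}" using js(2) by blast+
    then show ?thesis unfolding l(1,3) using stage_row_zero[OF st, of l l'] by simp
  qed
  ultimately show ?thesis
    unfolding mutated_seed_append fst_fold_mutate by (subst fold_mutate_matrix) (simp_all add: Let_def)
qed

lemma stage_row:
  assumes st: "stage n (Suc t) (Suc (Suc h)) ks" "t \<le> h" "Suc h < n"
    and js: "distinct js" "set js = {Suc h<..n}"
  shows "stage n (Suc t) (Suc h) (ks @ map (X (Suc h)) js)"
proof -
  have "quiver_state n (Suc t) (Suc h) (fst (mutated_seed n (ks @ map (X (Suc h)) js)))"
    unfolding mutated_seed_append fst_fold_mutate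
    by (rule quiver_state_step[OF _ st(2,3) js]) (use st(1) in \<open>simp add: stage_def\<close>)
  moreover have "count_list (ks @ map (X (Suc h)) js) (X p j) = (if p < Suc h then min p t else min p (Suc t))" if "p < j" "j \<le> n" for p j
  proof -
    have "count_list ks (X p j) = (if p < Suc (Suc h) then min p t else min p (Suc t))"
      using st(1) that by (simp add: stage_def)
    then show ?thesis using st(2) js that by (auto simp: count_row)
  qed
  ultimately show ?thesis by (simp add: stage_def)
qed

lemma below_diagonal_row: "below_diagonal n ks \<Longrightarrow> set js \<subseteq> {Suc h<..n} \<Longrightarrow> below_diagonal n (ks @ map (X (Suc h)) js)"
  by (auto simp: below_diagonal_def)

text \<open>Any part of the row is allowed, since every initial segment of the mutation sequence has
  to be covered. Vertices are added one at a time, and \<open>label_exchange\<close> evaluates each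
  new function.\<close>

lemma labelled_row:
  assumes st: "stage n (Suc t) (Suc (Suc h)) ks" "t \<le> h" "Suc h < n"
    and lab: "labelled n ks" "below_diagonal n ks"
    and js: "distinct js" "set js \<subseteq> {Suc h<..n}"
  shows "labelled n (ks @ map (X (Suc h)) js)"
  using js
proof (induction js rule: rev_induct)
  case Nil
  then show ?case using lab by simp
next
  case (snoc j js)
  let ?k = "ks @ map (X (Suc h)) js" and ?v = "X (Suc h) j"
  have js: "distinct js" "set js \<subseteq> {Suc h<..n}" "j \<notin> set js" and j: "Suc h < j" "j \<le> n" using snoc.prems by auto
  have IH: "labelled n ?k" using snoc.IH js by simp
  have ms: "mutated_seed n (?k @ [?v]) = mutate n ?v (mutated_seed n ?k)" by (simp add: mutated_seed_append)
  have count: "count_list ?k (X p l) = (if p = Suc h \<and> l \<in> set js then Suc t else if p \<le> Suc h then min p t else min p (Suc t))"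
    if "p < l" "l \<le> n" for p l
  proof -
    have "count_list ks (X p l) = (if p < Suc (Suc h) then min p t else min p (Suc t))"
      using st(1) that by (simp add: stage_def)
    then show ?thesis using st(2) that by (auto simp: count_row[OF js(1)])
  qed
  show ?case unfolding labelled_def
  proof (intro ballI impI allI)
    fix Z p l assume Z: "Z \<in> flag_triples n" and good: "discriminant n Z \<noteq> 0" and pl: "p < l \<and> l \<le> n"
    define f where "f = (\<lambda>v. cluster_function n ?k v Z)"
    have f: "f (X p l) = label n p l (count_list ?k (X p l)) Z" if "p < l" "l \<le> n" for p l
      using IH Z good that by (simp add: labelled_def f_def)
    have "below_diagonal n ?k" using below_diagonal_row lab(2) js(2) by blast
    then have "X k k \<notin> set ?k" "Y n \<notin> set ?k" for k by (auto simp: below_diagonal_def)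
    then have f0: "f (X k k) = diag_function n k Z" "f (Y n) = edge_function n Z" for k
      unfolding f_def mutated_seed_def snd_fold_mutate[OF \<open>X k k \<notin> set ?k\<close>] snd_fold_mutate[OF \<open>Y n \<notin> set ?k\<close>]
      by (simp_all add: initial_seed_def diag_function_def edge_function_def)
    show "cluster_function n (ks @ map (X (Suc h)) (js @ [j])) (X p l) Z =
        label n p l (count_list (ks @ map (X (Suc h)) (js @ [j])) (X p l)) Z"
    proof (cases "X p l = ?v")
      case False
      then have "cluster_function n (?k @ [?v]) (X p l) Z = f (X p l)" unfolding ms by (auto simp: mutate_def f_def)
      moreover have "count_list (?k @ [?v]) (X p l) = count_list ?k (X p l)" using False by auto
      ultimately show ?thesis using f[of p l] pl by simp
    next
      case True
      have cv: "count_list ?k ?v = t" using count[of "Suc h" j] j js(3) st(2) by simp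
      have V: "?v \<in> vertices n" using j st(3) by (simp add: X_in_vertices)
      \<comment> \<open>The vertices of the row mutated earlier are not connected to this one, so
        its arrows are still those of the ready shape.\<close>
      have row: "fst (mutated_seed n ?k) ?v w = mcount (ready_pos n t (Suc h) j) w - mcount (ready_neg n t (Suc h) j) w" if w: "w \<in> vertices n" for w
      proof -
        have z: "fst (mutated_seed n ks) ?v (X (Suc h) l) = 0" if "l \<in> set js" for l
          using stage_row_zero[OF st, of j l] that js(2) j by auto
        have "?v \<notin> X (Suc h) ` set js" using js(3) by auto
        moreover have "(\<Sum>k\<in>X (Suc h) ` set js. contribution (fst (mutated_seed n ks) ?v k) (fst (mutated_seed n ks) k w)) = 0"
          by (rule sum.neutral) (use z in auto)
        moreover have "w \<in> X (Suc h) ` set js \<Longrightarrow> fst (mutated_seed n ks) ?v w = 0" using z by auto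
        ultimately have "fst (mutated_seed n ?k) ?v w = fst (mutated_seed n ks) ?v w"
          unfolding row_matrix[OF st js(1,2)] Let_def by auto
        then show ?thesis using stage_row_matrix[OF st(1,2) j w] by simp
      qed
      have "exchange_rhs n ?v (mutated_seed n ?k) Z = (\<Prod>v\<in>#ready_pos n t (Suc h) j. f v) + (\<Prod>v\<in>#ready_neg n t (Suc h) j. f v)"
        unfolding f_def
      proof (rule exchange_rhs_multiset)
        show "set_mset (ready_pos n t (Suc h) j) \<subseteq> vertices n" "set_mset (ready_neg n t (Suc h) j) \<subseteq> vertices n"
          using j st by (auto simp: ready_pos_def ready_neg_def X_in_vertices Y_in_vertices split: if_splits)
        show "count (ready_pos n t (Suc h) j) w = 0 \<or> count (ready_neg n t (Suc h) j) w = 0" for w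
          by (rule ready_disjoint) (use j st in auto)
      qed (rule row)
      also have "(\<Prod>v\<in>#ready_pos n t (Suc h) j. f v) = label n h j t Z * label_side n (Suc h) j t Z"
      proof (cases "j = Suc (Suc h)")
        case True
        then show ?thesis using f[of h j] count[of h j] st j by (simp add: ready_pos_def label_side_def f0)
      next
        case False
        then show ?thesis using f[of h j] count[of h j] f[of "Suc (Suc h)" j] count[of "Suc (Suc h)" j] st j
          by (simp add: ready_pos_def label_side_def)
      qed
      also have "(\<Prod>v\<in>#ready_neg n t (Suc h) j. f v) = label n h (j - 1) t Z * label_corner n (Suc h) j t Z"
      proof (cases "j = n")
        case True
        have "h < n - 1" using st(3) by auto
        then have "f (X h (n - 1)) = label n h (n - 1) t Z" using f[of h "n - 1"] count[of h "n - 1"] st(2) by auto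
        then show ?thesis using True by (simp add: ready_neg_def label_corner_def f0)
      next
        case False
        have a: "h < j - 1" "j - 1 \<le> n" using j by auto
        then have "f (X h (j - 1)) = label n h (j - 1) t Z" using f[OF a] count[OF a] st(2) by auto
        moreover have "f (X (Suc (Suc h)) (Suc j)) = label n (Suc (Suc h)) (Suc j) (Suc t) Z"
          using f[of "Suc (Suc h)" "Suc j"] count[of "Suc (Suc h)" "Suc j"] False j st(2) by auto
        ultimately show ?thesis using False by (simp add: ready_neg_def label_corner_def)
      qed
      also have "label n h j t Z * label_side n (Suc h) j t Z + label n h (j - 1) t Z * label_corner n (Suc h) j t Z =
          label n (Suc h) j t Z * label n (Suc h) j (Suc t) Z"
      proof (rule label_exchange[OF Z j st(2), symmetric])
        show "diag_function n n Z \<noteq> 0" "edge_function n Z \<noteq> 0"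
          using discriminant_nonzeroD[OF good] st(3) by auto
        show "label_side n (Suc h) j t Z \<noteq> 0"
          using discriminant_nonzeroD[OF good] st(2,3) j by (auto simp: label_side_def)
      qed
      also have "label n (Suc h) j t Z = f ?v" using f[OF j] cv by simp
      finally have "exchange_rhs n ?v (mutated_seed n ?k) Z = f ?v * label n (Suc h) j (Suc t) Z" .
      moreover have "f ?v \<noteq> 0" using f[OF j] cv discriminant_nonzeroD(3)[OF good j, of t] st(2) by simp
      ultimately have "cluster_function n (?k @ [?v]) ?v Z = label n (Suc h) j (Suc t) Z"
        unfolding ms by (simp add: mutate_def f_def)
      moreover have "count_list (?k @ [?v]) ?v = Suc t" using cv by simp
      ultimately show ?thesis using True by simp
    qed
  qed
qed

section \<open>Rows, rounds and the whole sequence\<close>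

text \<open>Records that the quiver is in the expected state before each row, so that later
  inductions over the steps can use it without establishing it again.\<close>

fun chain :: "nat \<Rightarrow> (nat \<Rightarrow> nat \<Rightarrow> nat list) \<Rightarrow> vertex list \<Rightarrow> (nat \<times> nat) list \<Rightarrow> bool" where
  "chain n ord ks [] = True"
| "chain n ord ks ((r, i) # st) = (1 \<le> r \<and> r \<le> i \<and> i < n \<and> distinct (ord r i) \<and> set (ord r i) = {i<..n} \<and>
     stage n r (Suc i) ks \<and> chain n ord (ks @ map (X i) (ord r i)) st)"

lemma mutations_simps [simp]:
  "mutations ord [] = []" "mutations ord ((r, i) # st) = map (X i) (ord r i) @ mutations ord st"
  "mutations ord (st @ st') = mutations ord st @ mutations ord st'"
  by (simp_all add: mutations_def)

lemma chain_append: "chain n ord ks (st @ st') \<longleftrightarrow> chain n ord ks st \<and> chain n ord (ks @ mutations ord st) st'"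
  by (induction n ord ks st rule: chain.induct) auto

lemma chain_round:
  assumes "1 \<le> r" "r \<le> s" "s \<le> n" "stage n r s ks"
    and ord: "\<And>i. r \<le> i \<Longrightarrow> i < n \<Longrightarrow> distinct (ord r i) \<and> set (ord r i) = {i<..n}"
  shows "chain n ord ks (map (Pair r) (rev [r..<s])) \<and> stage n r r (ks @ mutations ord (map (Pair r) (rev [r..<s])))"
  using assms(2-4)
proof (induction s arbitrary: ks rule: dec_induct)
  case base
  then show ?case by simp
next
  case (step s)
  obtain t h where th: "r = Suc t" "s = Suc h" using assms(1) step.hyps by (cases r; cases s) auto
  have "stage n r s (ks @ map (X s) (ord r s))"
    using stage_row[of n t h ks "ord r s"] ord[of s] step.prems step.hyps th by simp
  from step.IH[OF _ this] show ?case using step.prems step.hyps ord[of s] assms(1) by (simp add: upt_Suc_append)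
qed

lemma chain_rounds:
  assumes "1 \<le> r" "r \<le> n" "stage n r n ks"
    and ord: "\<And>r i. 1 \<le> r \<Longrightarrow> r \<le> i \<Longrightarrow> i < n \<Longrightarrow> distinct (ord r i) \<and> set (ord r i) = {i<..n}"
  shows "chain n ord ks (concat (map (\<lambda>r. map (Pair r) (rev [r..<n])) [r..<n])) \<and>
    stage n n n (ks @ mutations ord (concat (map (\<lambda>r. map (Pair r) (rev [r..<n])) [r..<n])))"
  using assms(1-3)
proof (induction "n - r" arbitrary: r ks)
  case 0
  then show ?case by simp
next
  case (Suc k)
  let ?R = "map (Pair r) (rev [r..<n])"
  have rn: "r < n" using Suc.hyps(2) by simp
  have R: "chain n ord ks ?R \<and> stage n r r (ks @ mutations ord ?R)"
    by (rule chain_round) (use Suc.prems ord in auto)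
  then have "stage n (Suc r) n (ks @ mutations ord ?R)" using stage_next_round Suc.prems rn by blast
  from Suc.hyps(1)[OF _ _ _ this] have "chain n ord (ks @ mutations ord ?R) (concat (map (\<lambda>r. map (Pair r) (rev [r..<n])) [Suc r..<n])) \<and>
      stage n n n ((ks @ mutations ord ?R) @ mutations ord (concat (map (\<lambda>r. map (Pair r) (rev [r..<n])) [Suc r..<n])))"
    using Suc.hyps(2) rn by simp
  moreover have "[r..<n] = r # [Suc r..<n]" using rn by (rule upt_conv_Cons)
  ultimately show ?case using R by (simp add: chain_append)
qed

lemma row_steps_concat: "row_steps n = concat (map (\<lambda>r. map (Pair r) (rev [r..<n])) [1..<n])"
proof -
  have "concat (map (\<lambda>i. [(r, i)]) xs) = map (Pair r) xs" for r :: nat and xs :: "nat list"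
    by (induction xs) auto
  then show ?thesis by (simp add: row_steps_def)
qed

lemma set_row_steps: "set (row_steps n) = {(r, i). 1 \<le> r \<and> r \<le> i \<and> i < n}"
  unfolding row_steps_concat by (auto simp: image_iff)

lemma row_orderD: "row_order n ord \<Longrightarrow> 1 \<le> r \<Longrightarrow> r \<le> i \<Longrightarrow> i < n \<Longrightarrow> distinct (ord r i) \<and> set (ord r i) = {i<..n}"
  unfolding row_order_def set_row_steps by blast

lemma chain_row_steps:
  assumes "1 \<le> n" "row_order n ord"
  shows "chain n ord [] (row_steps n)" "stage n n n (mutations ord (row_steps n))"
  using chain_rounds[of 1 n "[]" ord] stage_initial[of n] row_orderD[OF assms(2)] assms(1)
  unfolding row_steps_concat by simp_all

lemma below_diagonal_chain: "chain n ord ks st \<Longrightarrow> below_diagonal n ks \<Longrightarrow> below_diagonal n (ks @ mutations ord st)"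
proof (induction n ord ks st rule: chain.induct)
  case (2 n ord ks r i st)
  obtain h where h: "i = Suc h" using 2 by (cases i) auto
  have "below_diagonal n (ks @ map (X i) (ord r i))"
    using below_diagonal_row[of n ks "ord r i" h] 2 unfolding h by simp
  then show ?case using 2 by simp
qed simp

text \<open>A prefix may end inside a row. Within the first row \<open>labelled_row\<close> applies
  directly; a longer prefix contains the whole row and falls under the induction hypothesis.\<close>

lemma labelled_chain:
  "chain n ord ks st \<Longrightarrow> labelled n ks \<Longrightarrow> below_diagonal n ks \<Longrightarrow> labelled n (ks @ take m (mutations ord st))"
proof (induction n ord ks st arbitrary: m rule: chain.induct)
  case (2 n ord ks r i st)
  obtain t h where th: "r = Suc t" "i = Suc h" using 2 by (cases r; cases i) auto
  have lab: "labelled n (ks @ map (X i) js)" if "distinct js" "set js \<subseteq> {i<..n}" for js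
    using labelled_row[of n t h ks js] 2 that th by simp
  show ?case
  proof (cases "m \<le> length (ord r i)")
    case True
    have "set (take m (ord r i)) \<subseteq> {i<..n}" using 2 set_take_subset[of m "ord r i"] by auto
    then have "labelled n (ks @ map (X i) (take m (ord r i)))" using 2 by (intro lab) auto
    then show ?thesis using True by (simp add: take_map)
  next
    case False
    have "below_diagonal n (ks @ map (X i) (ord r i))"
      using below_diagonal_row[of n ks "ord r i" h] 2 unfolding th by simp
    moreover have "labelled n (ks @ map (X i) (ord r i))" using 2 by (intro lab) auto
    ultimately have "labelled n ((ks @ map (X i) (ord r i)) @ take (m - length (ord r i)) (mutations ord st))"
      using 2 by simp
    then show ?thesis using False by simp
  qed
qed simp

text \<open>After a complete row the matrix depends only on the set of mutated vertices, which is
  the same for both orders.\<close>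

lemma chain_matrix:
  "chain n ord ks st \<Longrightarrow> chain n ord' ks' st \<Longrightarrow> fst (mutated_seed n ks) = fst (mutated_seed n ks') \<Longrightarrow>
    fst (mutated_seed n (ks @ mutations ord (take l st))) = fst (mutated_seed n (ks' @ mutations ord' (take l st)))"
proof (induction n ord ks st arbitrary: l ks' rule: chain.induct)
  case (2 n ord ks r i st)
  obtain t h where th: "r = Suc t" "i = Suc h" using 2 by (cases r; cases i) auto
  have c: "fst (mutated_seed n (ks @ map (X i) (ord r i))) = fst (mutated_seed n (ks' @ map (X i) (ord' r i)))"
  proof (intro ext)
    fix v w
    show "fst (mutated_seed n (ks @ map (X i) (ord r i))) v w = fst (mutated_seed n (ks' @ map (X i) (ord' r i))) v w"
      using row_matrix[of n t h ks "ord r i" v w] row_matrix[of n t h ks' "ord' r i" v w] 2(2-4) unfolding th by (simp add: Let_def)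
  qed
  show ?case
  proof (cases l)
    case 0
    then show ?thesis using 2(4) by simp
  next
    case (Suc l')
    then show ?thesis using 2(1)[of "ks' @ map (X i) (ord' r i)" l'] 2(2,3) c by simp
  qed
qed simp

lemma count_mutations:
  "(\<And>r i. (r, i) \<in> set st \<Longrightarrow> distinct (ord r i) \<and> distinct (ord' r i) \<and> set (ord r i) = set (ord' r i)) \<Longrightarrow>
    count_list (mutations ord st) (X p j) = count_list (mutations ord' st) (X p j)"
proof (induction st)
  case (Cons a st)
  obtain r i where a: "a = (r, i)" by (cases a)
  have "distinct (ord r i)" "distinct (ord' r i)" "set (ord r i) = set (ord' r i)" using Cons.prems[of r i] a by auto
  then have "count_list (map (X i) (ord r i)) (X p j) = count_list (map (X i) (ord' r i)) (X p j)"
    by (simp only: count_row)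
  then show ?case using Cons by (simp add: a)
qed simp

lemma count_list_take: "count_list (take m ks) v \<le> count_list ks v"
proof -
  have "count_list ks v = count_list (take m ks) v + count_list (drop m ks) v"
    by (metis append_take_drop_id count_list_append)
  then show ?thesis by simp
qed

theorem theorem3p8:
  fixes n :: nat and ord :: "nat \<Rightarrow> nat \<Rightarrow> nat list" and ks :: "vertex list"
  assumes "n \<ge> 1"
    and "row_order n ord"
    and "ks = mutations ord (row_steps n)"
  shows
    \<comment> \<open>all mutations are at unfrozen vertices with nonzero function\<close>
    "(\<forall>m<length ks. ks ! m \<in> vertices n - frozen n \<and>
        generically n (\<lambda>Z. cluster_function n (take m ks) (ks ! m) Z \<noteq> 0))
   \<and> \<comment> \<open>the order within a row is immaterial\<close>
     (\<forall>ord' l. row_order n ord' \<longrightarrow>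
        (let ls = mutations ord (take l (row_steps n)); ls' = mutations ord' (take l (row_steps n)) in
           fst (mutated_seed n ls) = fst (mutated_seed n ls') \<and>
           (\<forall>v\<in>vertices n. rational_eq n (cluster_function n ls v) (cluster_function n ls' v))))
   \<and> (\<forall>i j. 1 \<le> i \<and> i < j \<and> j \<le> n \<longrightarrow>
        count_list ks (X i j) = i
      \<and> (\<forall>m\<le>length ks.
           let t = count_list (take m ks) (X i j); f = cluster_function n (take m ks) (X i j) in
             (t = 0 \<longrightarrow> f = br211 n (n - i) (2 * n + i - j) n j)
           \<and> (1 \<le> t \<and> t \<le> i - 1 \<longrightarrow>
                rational_eq n f (br222 n (n - i + t) (2 * n + i - j - t) (j - t) (n + t)))
           \<and> (t = i \<longrightarrow> rational_eq n f (br112 n (2 * n - j) n (j - i) (n + i))))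
      \<and> (\<forall>Z\<in>flag_triples n.
           br112 n (2 * n - j) n (j - i) (n + i) Z = br112 n j n (n - i) (2 * n + i - j) Z))"
proof -
  have chain: "chain n o' [] (row_steps n)" if "row_order n o'" for o'
    by (rule chain_row_steps(1)[OF assms(1) that])
  have final: "stage n n n ks" unfolding assms(3) by (rule chain_row_steps(2)[OF assms(1,2)])
  have lab0: "labelled n []" by (simp add: labelled_def mutated_seed_def initial_seed_def label_0 del: initial_functions.simps)
  have bd0: "below_diagonal n []" by (simp add: below_diagonal_def)
  have lab: "labelled n (take m (mutations o' (row_steps n)))" if "row_order n o'" for o' m
    using labelled_chain[OF chain[OF that] lab0 bd0, of m] by simp
  have bd: "below_diagonal n (mutations o' (row_steps n))" if "row_order n o'" for o'
    using below_diagonal_chain[OF chain[OF that] bd0] by simp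
  have total: "count_list ks (X p j) = p" if "p < j" "j \<le> n" for p j
    using final that by (auto simp: stage_def)
  have val: "cluster_function n (take m ks) (X p j) Z = label n p j (count_list (take m ks) (X p j)) Z"
    if "Z \<in> flag_triples n" "discriminant n Z \<noteq> 0" "p < j" "j \<le> n" for m p j Z
    using lab[OF assms(2), of m] that unfolding assms(3) labelled_def by blast
  have unmutated: "cluster_function n ls v = initial_functions n v" if "v \<notin> set ls" for ls v
    unfolding mutated_seed_def snd_fold_mutate[OF that] by (simp add: initial_seed_def)
  have part1: "ks ! m \<in> vertices n - frozen n \<and> generically n (\<lambda>Z. cluster_function n (take m ks) (ks ! m) Z \<noteq> 0)"
    if m: "m < length ks" for m
  proof -
    have "ks ! m \<in> {X p j | p j. 1 \<le> p \<and> p < j \<and> j \<le> n}"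
      using bd[OF assms(2)] nth_mem[OF m] unfolding below_diagonal_def assms(3) by blast
    then obtain p j where pj: "ks ! m = X p j" "1 \<le> p" "p < j" "j \<le> n" by blast
    have le: "count_list (take m ks) (X p j) \<le> p" using count_list_take[of m ks "X p j"] total[OF pj(3,4)] by simp
    have "generically n (\<lambda>Z. cluster_function n (take m ks) (X p j) Z \<noteq> 0)"
      by (rule genericallyI) (use val[OF _ _ pj(3,4), of _ m] discriminant_nonzeroD(3)[OF _ pj(3,4) le] in auto)
    then show ?thesis using pj by (auto simp: X_in_vertices frozen_def)
  qed
  have part2: "fst (mutated_seed n (mutations ord (take l (row_steps n)))) = fst (mutated_seed n (mutations ord' (take l (row_steps n)))) \<and>
      (\<forall>v\<in>vertices n. rational_eq n (cluster_function n (mutations ord (take l (row_steps n))) v)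
        (cluster_function n (mutations ord' (take l (row_steps n))) v))" if ord': "row_order n ord'" for ord' l
  proof (intro conjI ballI)
    show "fst (mutated_seed n (mutations ord (take l (row_steps n)))) = fst (mutated_seed n (mutations ord' (take l (row_steps n))))"
      using chain_matrix[OF chain[OF assms(2)] chain[OF ord'] refl, of l] by simp
    \<comment> \<open>Finitely many complete rows form a prefix of the vertex list, so what is known
      of prefixes applies to them.\<close>
    have pre: "mutations o' (take l (row_steps n)) = take (length (mutations o' (take l (row_steps n)))) (mutations o' (row_steps n))" for o'
      by (metis append_eq_conv_conj append_take_drop_id mutations_simps(3))
    have lab': "labelled n (mutations o' (take l (row_steps n)))" if "row_order n o'" for o'
      using lab[OF that, of "length (mutations o' (take l (row_steps n)))"] unfolding pre[symmetric] .
    have sub: "set (mutations o' (take l (row_steps n))) \<subseteq> set (mutations o' (row_steps n))" for o'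
      by (subst pre) (rule set_take_subset)
    \<comment> \<open>The counts do not depend on the order, so on the open set both functions equal
      the same label.\<close>
    have c: "count_list (mutations ord (take l (row_steps n))) (X p j) = count_list (mutations ord' (take l (row_steps n))) (X p j)" for p j
    proof (rule count_mutations)
      fix r i assume "(r, i) \<in> set (take l (row_steps n))"
      then have "(r, i) \<in> set (row_steps n)" by (rule in_set_takeD)
      then show "distinct (ord r i) \<and> distinct (ord' r i) \<and> set (ord r i) = set (ord' r i)"
        using row_orderD[OF assms(2), of r i] row_orderD[OF ord', of r i] unfolding set_row_steps by auto
    qed
    fix v assume "v \<in> vertices n"
    show "rational_eq n (cluster_function n (mutations ord (take l (row_steps n))) v) (cluster_function n (mutations ord' (take l (row_steps n))) v)"
      unfolding rational_eq_def
    proof (rule genericallyI)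
      fix Z assume Z: "Z \<in> flag_triples n" "discriminant n Z \<noteq> 0"
      show "cluster_function n (mutations ord (take l (row_steps n))) v Z = cluster_function n (mutations ord' (take l (row_steps n))) v Z"
      proof (cases "\<exists>p j. v = X p j \<and> p < j \<and> j \<le> n")
        case True
        then show ?thesis using lab'[OF assms(2)] lab'[OF ord'] Z c unfolding labelled_def by auto
      next
        case False
        then have "v \<notin> set (mutations o' (take l (row_steps n)))" if "row_order n o'" for o'
          using bd[OF that] sub[of o'] unfolding below_diagonal_def by blast
        then show ?thesis using unmutated assms(2) ord' by simp
      qed
    qed
  qed
  have part3: "(t = 0 \<longrightarrow> f = br211 n (n - i) (2 * n + i - j) n j)
      \<and> (1 \<le> t \<and> t \<le> i - 1 \<longrightarrow> rational_eq n f (br222 n (n - i + t) (2 * n + i - j - t) (j - t) (n + t)))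
      \<and> (t = i \<longrightarrow> rational_eq n f (br112 n (2 * n - j) n (j - i) (n + i)))"
    if ij: "1 \<le> i" "i < j" "j \<le> n" and t: "t = count_list (take m ks) (X i j)" and f: "f = cluster_function n (take m ks) (X i j)" for i j m t f
  proof -
    have eq: "rational_eq n f (label n i j t)"
      unfolding rational_eq_def by (rule genericallyI) (use val[OF _ _ ij(2,3), of _ m] in \<open>simp add: t f\<close>)
    \<comment> \<open>For t = 0 the vertex has not been mutated, and the equality holds everywhere
      and not only generically.\<close>
    have "f = br211 n (n - i) (2 * n + i - j) n j" if "t = 0"
      using unmutated[of "X i j" "take m ks"] that ij by (simp add: t f count_list_0_iff)
    moreover have "label n i j t = br222 n (n - i + t) (2 * n + i - j - t) (j - t) (n + t)" if "1 \<le> t" "t \<le> i - 1"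
    proof -
      have "t < i" using that ij by simp
      then show ?thesis using that by (simp add: label_def)
    qed
    moreover have "label n i j t = br112 n (2 * n - j) n (j - i) (n + i)" if "t = i"
      using that ij by (simp add: label_def)
    ultimately show ?thesis using eq by auto
  qed
  show ?thesis
    using part1 part2 part3 total br112_symmetric unfolding Let_def by auto
qed

end
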